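(* Let $K$ be a field, let $\Gamma=(E,V,s,t)$ be a finite digraph, let $(\Gamma,\Pi)$ be a separated graph, and let $\Lambda\subseteq\Pi$. Let $L=CL_K(\Gamma,\Pi,\Lambda)$ be the separated Cohn-Leavitt path algebra of the triple $(\Gamma,\Pi,\Lambda)$, and let $\Omega=V\sqcup(\Pi\setminus\Lambda)$. Then $L$ has IBN if and only if $\sum_{v\in V}v$ is not in the $\mathbb{Q}$-span of $\{\,sX-\sum_{e\in X}t(e)\,\}_{X\in\Lambda}$ in $\mathbb{Q}\Omega$.
   Context: A digraph $\Gamma=(E,V,s,t)$ has vertex set $V$, edge set $E$, and source and target functions $s,t:E\to V$; it is finite if $V$ and $E$ are finite. A sink is a vertex $v$ with $s^{-1}(v)=\emptyset$. A separated graph $(\Gamma,\Pi)$ is a digraph $\Gamma$ together with a partition $\Pi$ of $E$ (into nonempty blocks) which is finer than (possibly equal to) $\{s^{-1}(v)\mid v\in V,\ v\text{ not a sink}\}$. Thus all edges in a block $X\in\Pi$ have the same source, denoted $sX$. For $\Lambda\subseteq\Pi$, the separated Cohn-Leavitt path algebra $CL_K(\Gamma,\Pi,\Lambda)$ over the field $K$ is the $K$-algebra generated by $\{v\mid v\in V\}\cup\{e,e^*\mid e\in E\}$ subject to the relations: (V) $vw=\delta_{v,w}v$ for all $v,w\in V$; (E1) $s(e)e=e\,t(e)=e$ for all $e\in E$; (E2) $t(e)e^*=e^*s(e)=e^*$ for all $e\in E$; (CK1) for all $X\in\Pi$, $e^*f=\delta_{e,f}\,t(e)$ for all $e,f\in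 X$; (CK2) for all $X\in\Lambda$, $sX=\sum_{e\in X}ee^*$. Since $V$ is finite, this algebra is unital with $1=\sum_{v\in V}v$. $\mathbb{Q}\Omega$ is the $\mathbb{Q}$-vector space with basis $\Omega$. A unital ring $R$ has IBN (Invariant Basis Number) if $R^m\not\cong R^{m'}$ as right $R$-modules for all distinct positive integers $m\neq m'$. *)

theory Defs
  imports
    "Graph_Theory.Digraph"
    "HOL-Algebra.QuotRing"
    "HOL-Library.Poly_Mapping"
    "HOL-Library.Disjoint_Sets"
    "HOL-Library.FuncSet"
begin

section \<open>Vector spaces on finitely supported functions\<close>

definition pm_scale :: "'k::field \<Rightarrow> ('x \<Rightarrow>\<^sub>0 'k) \<Rightarrow> ('x \<Rightarrow>\<^sub>0 'k)" where
  "pm_scale c p = Poly_Mapping.map ((*) c) p"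

lemma lookup_pm_scale [simp]: "Poly_Mapping.lookup (pm_scale c p) x = c * Poly_Mapping.lookup p x"
  by (simp add: pm_scale_def Poly_Mapping.map.rep_eq when_def)

global_interpretation pm: vector_space pm_scale
  by standard (auto intro!: poly_mapping_eqI simp: lookup_add algebra_simps)

text \<open>The vector space with basis \<open>B\<close>; \<open>b \<in> B\<close> is the vector \<open>Poly_Mapping.single b 1\<close>.\<close>

definition free_space :: "'x set \<Rightarrow> ('x \<Rightarrow>\<^sub>0 'k::field) set" where
  "free_space B = {f. Poly_Mapping.keys f \<subseteq> B}"

lemma free_space_iff: "p \<in> free_space B \<longleftrightarrow> (\<forall>x. x \<notin> B \<longrightarrow> Poly_Mapping.lookup p x = 0)"
  by (auto simp: free_space_def in_keys_iff)

lemma subspace_free_space: "pm.subspace (free_space B)"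
  unfolding pm.subspace_def by (auto simp: free_space_iff lookup_add)


section \<open>Separated graphs\<close>

text \<open>\<open>tail\<close> is the source map and \<open>head\<close> the target map.\<close>

definition separated_graph :: "('v, 'e) pre_digraph \<Rightarrow> 'e set set \<Rightarrow> bool" where
  "separated_graph G P \<longleftrightarrow> wf_digraph G \<and>
     refines (arcs G) P {out_arcs G v | v. v \<in> verts G \<and> out_arcs G v \<noteq> {}}"

definition block_source :: "('v, 'e) pre_digraph \<Rightarrow> 'e set \<Rightarrow> 'v" where
  "block_source G X = the_elem (tail G ` X)"

lemma block_source:
  assumes "separated_graph G P" "X \<in> P" "e \<in> X"
  shows "block_source G X = tail G e" "e \<in> arcs G"
proof -
  from assms obtain v where v: "X \<subseteq> out_arcs G v"
    by (fastforce simp: separated_graph_def refines_def)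
  then have "tail G ` X = {tail G e}" using assms(3) by (auto simp: out_arcs_def)
  then show "block_source G X = tail G e" by (simp add: block_source_def)
  show "e \<in> arcs G" using v assms(3) by (auto simp: out_arcs_def)
qed

definition Omega :: "('v, 'e) pre_digraph \<Rightarrow> 'e set set \<Rightarrow> 'e set set \<Rightarrow> ('v + 'e set) set" where
  "Omega G P \<Lambda> = Sum_Type.Plus (verts G) (P - \<Lambda>)"

abbreviation vertex_vec :: "'v \<Rightarrow> ('v + 'e set) \<Rightarrow>\<^sub>0 rat" where
  "vertex_vec v \<equiv> Poly_Mapping.single (Inl v) 1"

lemma vertex_vec_in_free_space:
  "v \<in> verts G \<Longrightarrow> vertex_vec v \<in> free_space (Omega G P \<Lambda>)"
  by (auto simp: free_space_def Omega_def)

lemma block_vec_in_free_space: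
  assumes "separated_graph G P" "X \<in> P"
  shows "vertex_vec (block_source G X) - (\<Sum>e\<in>X. vertex_vec (head G e))
           \<in> free_space (Omega G P \<Lambda>)"
proof -
  have wf: "wf_digraph G" and "X \<noteq> {}"
    using assms by (auto simp: separated_graph_def refines_def partition_on_def)
  then obtain e where "e \<in> X" by blast
  then have "block_source G X \<in> verts G"
    using block_source[OF assms] wf by (simp add: wf_digraph.tail_in_verts)
  moreover have "head G e \<in> verts G" if "e \<in> X" for e
    using block_source(2)[OF assms that] wf by (simp add: wf_digraph.head_in_verts)
  ultimately show ?thesis
    by (intro pm.subspace_diff pm.subspace_sum subspace_free_space vertex_vec_in_free_space)
qed


section \<open>Free algebras without unit\<close>

text \<open>A copy of the list type, to carry concatenation as a \<open>monoid_add\<close> structure; finitely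
  supported functions on it then multiply as noncommutative polynomials.\<close>

datatype 'a free_monoid = Wd (letters: "'a list")

instantiation free_monoid :: (type) monoid_add
begin

definition zero_free_monoid :: "'a free_monoid" where
  "0 = Wd []"

definition plus_free_monoid :: "'a free_monoid \<Rightarrow> 'a free_monoid \<Rightarrow> 'a free_monoid" where
  "u + w = Wd (letters u @ letters w)"

instance
  by standard (simp_all add: zero_free_monoid_def plus_free_monoid_def)

end

type_synonym ('a, 'k) ncpoly = "'a free_monoid \<Rightarrow>\<^sub>0 'k"

definition gen :: "'a \<Rightarrow> ('a, 'k::field) ncpoly" where
  "gen x = Poly_Mapping.single (Wd [x]) 1"

text \<open>The words are nonempty, so this algebra has no unit and the field \<open>one\<close> is meaningless.\<close>

definition free_algebra :: "'a set \<Rightarrow> ('a, 'k::field) ncpoly ring" where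
  "free_algebra S = \<lparr>carrier = free_space {w. letters w \<noteq> [] \<and> set (letters w) \<subseteq> S},
     mult = (*), one = undefined, zero = 0, add = (+)\<rparr>"

inductive_set algebra_ideal ::
    "'a set \<Rightarrow> ('a, 'k::field) ncpoly set \<Rightarrow> ('a, 'k) ncpoly set"
  for S :: "'a set" and R :: "('a, 'k::field) ncpoly set" where
  rel: "r \<in> R \<Longrightarrow> r \<in> algebra_ideal S R"
| zero: "0 \<in> algebra_ideal S R"
| add: "p \<in> algebra_ideal S R \<Longrightarrow> q \<in> algebra_ideal S R \<Longrightarrow> p + q \<in> algebra_ideal S R"
| scale: "p \<in> algebra_ideal S R \<Longrightarrow> pm_scale c p \<in> algebra_ideal S R"
| lmult: "p \<in> algebra_ideal S R \<Longrightarrow> a \<in> carrier (free_algebra S) \<Longrightarrow> a * p \<in> algebra_ideal S R"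
| rmult: "p \<in> algebra_ideal S R \<Longrightarrow> a \<in> carrier (free_algebra S) \<Longrightarrow> p * a \<in> algebra_ideal S R"


section \<open>Separated Cohn-Leavitt path algebras\<close>

datatype ('v, 'e) cl_gen = Vertex 'v | Edge 'e | Ghost 'e

definition cl_gens :: "('v, 'e) pre_digraph \<Rightarrow> ('v, 'e) cl_gen set" where
  "cl_gens G = Vertex ` verts G \<union> Edge ` arcs G \<union> Ghost ` arcs G"

abbreviation (input) vtx :: "'v \<Rightarrow> (('v, 'e) cl_gen, 'k::field) ncpoly" where
  "vtx v \<equiv> gen (Vertex v)"

abbreviation (input) edg :: "'e \<Rightarrow> (('v, 'e) cl_gen, 'k::field) ncpoly" where
  "edg e \<equiv> gen (Edge e)"

abbreviation (input) gho :: "'e \<Rightarrow> (('v, 'e) cl_gen, 'k::field) ncpoly" where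
  "gho e \<equiv> gen (Ghost e)"

text \<open>A relation \<open>l = r\<close> is recorded as the element \<open>l - r\<close>.\<close>

inductive_set cl_relations ::
    "('v, 'e) pre_digraph \<Rightarrow> 'e set set \<Rightarrow> 'e set set \<Rightarrow> (('v, 'e) cl_gen, 'k::field) ncpoly set"
  for G :: "('v, 'e) pre_digraph" and P \<Lambda> :: "'e set set" where
  V: "v \<in> verts G \<Longrightarrow> w \<in> verts G \<Longrightarrow>
        vtx v * vtx w - (if v = w then vtx v else 0) \<in> cl_relations G P \<Lambda>"
| E1_source: "e \<in> arcs G \<Longrightarrow> vtx (tail G e) * edg e - edg e \<in> cl_relations G P \<Lambda>"
| E1_target: "e \<in> arcs G \<Longrightarrow> edg e * vtx (head G e) - edg e \<in> cl_relations G P \<Lambda>"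
| E2_target: "e \<in> arcs G \<Longrightarrow> vtx (head G e) * gho e - gho e \<in> cl_relations G P \<Lambda>"
| E2_source: "e \<in> arcs G \<Longrightarrow> gho e * vtx (tail G e) - gho e \<in> cl_relations G P \<Lambda>"
| CK1: "X \<in> P \<Longrightarrow> e \<in> X \<Longrightarrow> f \<in> X \<Longrightarrow>
        gho e * edg f - (if e = f then vtx (head G e) else 0) \<in> cl_relations G P \<Lambda>"
| CK2: "X \<in> \<Lambda> \<Longrightarrow>
        vtx (block_source G X) - (\<Sum>e\<in>X. edg e * gho e) \<in> cl_relations G P \<Lambda>"

definition cl_ideal ::
    "('v, 'e) pre_digraph \<Rightarrow> 'e set set \<Rightarrow> 'e set set \<Rightarrow> (('v, 'e) cl_gen, 'k::field) ncpoly set" where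
  "cl_ideal G P \<Lambda> = algebra_ideal (cl_gens G) (cl_relations G P \<Lambda>)"

type_synonym ('v, 'e, 'k) cl_ring = "(('v, 'e) cl_gen, 'k) ncpoly set ring"

text \<open>The quotient of the free algebra without unit by the ideal of the relations. Its unit is the
  class of the sum of the vertices, which \<open>FactRing\<close> cannot know.\<close>

definition CL_algebra ::
    "('v, 'e) pre_digraph \<Rightarrow> 'e set set \<Rightarrow> 'e set set \<Rightarrow> ('v, 'e, 'k::field) cl_ring" where
  "CL_algebra G P \<Lambda> =
     (free_algebra (cl_gens G) Quot cl_ideal G P \<Lambda>)
       \<lparr>one := cl_ideal G P \<Lambda> +>\<^bsub>free_algebra (cl_gens G)\<^esub> (\<Sum>v\<in>verts G. vtx v)\<rparr>"


context
  fixes S :: "'a set" and R :: "('a, 'k::field) ncpoly set"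
begin

private abbreviation (input) "F \<equiv> free_algebra S :: ('a, 'k) ncpoly ring"
private abbreviation (input) "I \<equiv> algebra_ideal S R"

lemma free_algebra_simps [simp]:
  "p \<otimes>\<^bsub>F\<^esub> q = p * q" "p \<oplus>\<^bsub>F\<^esub> q = p + q" "\<zero>\<^bsub>F\<^esub> = 0"
  by (simp_all add: free_algebra_def)

lemma subspace_free_algebra: "pm.subspace (carrier F)"
  by (simp add: free_algebra_def subspace_free_space)

lemma free_algebra_mult: "p \<in> carrier F \<Longrightarrow> q \<in> carrier F \<Longrightarrow> p * q \<in> carrier F"
proof -
  assume p: "p \<in> carrier F" and q: "q \<in> carrier F"
  have "letters w \<noteq> [] \<and> set (letters w) \<subseteq> S" if "w \<in> Poly_Mapping.keys (p * q)" for w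
  proof -
    from that keys_mult[of p q] obtain a b
      where "w = a + b" "a \<in> Poly_Mapping.keys p" "b \<in> Poly_Mapping.keys q" by blast
    moreover from this p q have "letters a \<noteq> []" "set (letters a) \<subseteq> S" "set (letters b) \<subseteq> S"
      unfolding free_algebra_def free_space_def by auto
    ultimately show ?thesis by (simp add: plus_free_monoid_def)
  qed
  then show "p * q \<in> carrier F" unfolding free_algebra_def free_space_def by simp blast
qed

lemma gen_in_free_algebra: "x \<in> S \<Longrightarrow> gen x \<in> carrier F"
  by (simp add: free_algebra_def free_space_def gen_def)

lemma subspace_algebra_ideal: "pm.subspace I"
  unfolding pm.subspace_def by (auto intro: algebra_ideal.intros)

lemma algebra_ideal_subset:
  assumes "R \<subseteq> carrier F" "p \<in> I"
  shows "p \<in> carrier F"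
  using assms(2)
proof induction
  case (rel r)
  then show ?case using assms(1) by blast
next
  case zero
  show ?case by (rule pm.subspace_0[OF subspace_free_algebra])
next
  case (add p q)
  then show ?case by (blast intro: pm.subspace_add[OF subspace_free_algebra])
next
  case (scale p c)
  then show ?case by (blast intro: pm.subspace_scale[OF subspace_free_algebra])
qed (blast intro: free_algebra_mult)+

lemma coset_iff: "q \<in> I +>\<^bsub>F\<^esub> p \<longleftrightarrow> q - p \<in> I"
proof -
  have "q \<in> I +>\<^bsub>F\<^esub> p \<longleftrightarrow> (\<exists>h\<in>I. q = h + p)" by (simp add: a_r_coset_def')
  also have "\<dots> \<longleftrightarrow> q - p \<in> I"
  proof
    assume "q - p \<in> I"
    moreover have "q = (q - p) + p" by simp
    ultimately show "\<exists>h\<in>I. q = h + p" by (rule rev_bexI)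
  qed auto
  finally show ?thesis .
qed

lemma coset_eq_iff: "I +>\<^bsub>F\<^esub> p = I +>\<^bsub>F\<^esub> q \<longleftrightarrow> p - q \<in> I"
proof
  assume "I +>\<^bsub>F\<^esub> p = I +>\<^bsub>F\<^esub> q"
  moreover have "p \<in> I +>\<^bsub>F\<^esub> p" by (simp add: coset_iff algebra_ideal.zero)
  ultimately show "p - q \<in> I" by (simp add: coset_iff)
next
  assume pq: "p - q \<in> I"
  have "x - p \<in> I \<longleftrightarrow> x - q \<in> I" for x
  proof
    assume "x - p \<in> I"
    from pm.subspace_add[OF subspace_algebra_ideal this pq] show "x - q \<in> I" by simp
  next
    assume "x - q \<in> I"
    from pm.subspace_diff[OF subspace_algebra_ideal this pq] show "x - p \<in> I" by simp
  qed
  then show "I +>\<^bsub>F\<^esub> p = I +>\<^bsub>F\<^esub> q" by (auto simp: coset_iff)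
qed

lemma coset_add: "(I +>\<^bsub>F\<^esub> p) <+>\<^bsub>F\<^esub> (I +>\<^bsub>F\<^esub> q) = I +>\<^bsub>F\<^esub> (p + q)"
proof (intro equalityI subsetI)
  fix x assume "x \<in> (I +>\<^bsub>F\<^esub> p) <+>\<^bsub>F\<^esub> (I +>\<^bsub>F\<^esub> q)"
  then obtain y z where "y - p \<in> I" "z - q \<in> I" and x: "x = y + z"
    unfolding set_add_def' free_algebra_simps by (auto simp: coset_iff)
  then have "(y - p) + (z - q) \<in> I" by (blast intro: algebra_ideal.add)
  then show "x \<in> I +>\<^bsub>F\<^esub> (p + q)" unfolding x coset_iff add_diff_add .
next
  fix x assume "x \<in> I +>\<^bsub>F\<^esub> (p + q)"
  then have "x - q \<in> I +>\<^bsub>F\<^esub> p" "q \<in> I +>\<^bsub>F\<^esub> q"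
    by (simp_all add: coset_iff algebra_ideal.zero diff_diff_add add.commute)
  then show "x \<in> (I +>\<^bsub>F\<^esub> p) <+>\<^bsub>F\<^esub> (I +>\<^bsub>F\<^esub> q)"
    unfolding set_add_def' free_algebra_simps by (intro UN_I[of "x - q"] UN_I[of q]) simp_all
qed

lemma coset_mult:
  assumes R: "R \<subseteq> carrier F" and p: "p \<in> carrier F" and q: "q \<in> carrier F"
  shows "rcoset_mult F I (I +>\<^bsub>F\<^esub> p) (I +>\<^bsub>F\<^esub> q) = I +>\<^bsub>F\<^esub> (p * q)"
proof -
  have "I +>\<^bsub>F\<^esub> (x * y) = I +>\<^bsub>F\<^esub> (p * q)" if x: "x - p \<in> I" and y: "y - q \<in> I" for x y
  proof -
    have "x \<in> carrier F"
      using pm.subspace_add[OF subspace_free_algebra algebra_ideal_subset[OF R x] p] by simp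
    then have "x * (y - q) + (x - p) * q \<in> I"
      using x y q by (intro algebra_ideal.add algebra_ideal.lmult algebra_ideal.rmult)
    then show ?thesis by (simp add: coset_eq_iff algebra_simps)
  qed
  then have "rcoset_mult F I (I +>\<^bsub>F\<^esub> p) (I +>\<^bsub>F\<^esub> q)
      = (\<Union>a\<in>I +>\<^bsub>F\<^esub> p. \<Union>b\<in>I +>\<^bsub>F\<^esub> q. I +>\<^bsub>F\<^esub> (p * q))"
    unfolding rcoset_mult_def free_algebra_simps by (intro SUP_cong refl) (simp add: coset_iff)
  moreover have "p \<in> I +>\<^bsub>F\<^esub> p" "q \<in> I +>\<^bsub>F\<^esub> q" by (simp_all add: coset_iff algebra_ideal.zero)
  ultimately show ?thesis by blast
qed

end

lemma cl_relations_subset: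
  assumes "separated_graph G P" "\<Lambda> \<subseteq> P"
  shows "(cl_relations G P \<Lambda> :: (('v, 'e) cl_gen, 'k::field) ncpoly set)
           \<subseteq> carrier (free_algebra (cl_gens G))"
proof
  have wf: "wf_digraph G" using assms(1) by (simp add: separated_graph_def)
  have nonempty: "X \<noteq> {}" if "X \<in> P" for X
    using assms(1) that by (auto simp: separated_graph_def refines_def partition_on_def)
  let ?F = "carrier (free_algebra (cl_gens G)) :: (('v, 'e) cl_gen, 'k) ncpoly set"
  have v: "vtx v \<in> ?F" if "v \<in> verts G" for v
    using that by (intro gen_in_free_algebra) (simp add: cl_gens_def)
  have e: "edg e \<in> ?F" "gho e \<in> ?F" "vtx (tail G e) \<in> ?F" "vtx (head G e) \<in> ?F"
    if "e \<in> arcs G" for e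
    using that wf by (auto intro!: gen_in_free_algebra v
        simp: cl_gens_def wf_digraph.tail_in_verts wf_digraph.head_in_verts)
  note closed = pm.subspace_diff[OF subspace_free_algebra] free_algebra_mult
    pm.subspace_0[OF subspace_free_algebra] pm.subspace_sum[OF subspace_free_algebra]
  fix r :: "(('v, 'e) cl_gen, 'k) ncpoly"
  assume "r \<in> cl_relations G P \<Lambda>"
  then show "r \<in> ?F"
  proof cases
    case (CK1 X a b)
    then have "a \<in> arcs G" "b \<in> arcs G" using block_source(2)[OF assms(1)] by blast+
    with CK1 show ?thesis by (auto intro!: closed e)
  next
    case (CK2 X)
    then have X: "X \<in> P" using assms(2) by blast
    then obtain a where a: "a \<in> X" using nonempty by blast
    have "e \<in> arcs G" if "e \<in> X" for e using block_source(2)[OF assms(1) X that] .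
    with a CK2 show ?thesis
      by (auto intro!: closed e simp: block_source(1)[OF assms(1) X a])
  qed (auto intro!: closed v e)
qed

text \<open>Multiplying a generator by the sum of the vertices fixes it modulo the relations.\<close>

lemma cl_unit_gen:
  fixes G :: "('v, 'e) pre_digraph"
  assumes "fin_digraph G" "x \<in> cl_gens G"
  defines "u \<equiv> (\<Sum>v\<in>verts G. vtx v) :: (('v, 'e) cl_gen, 'k::field) ncpoly"
  shows "u * gen x - gen x \<in> cl_ideal G P \<Lambda>" "gen x * u - gen x \<in> cl_ideal G P \<Lambda>"
proof -
  let ?I = "cl_ideal G P \<Lambda> :: (('v, 'e) cl_gen, 'k) ncpoly set"
  let ?F = "free_algebra (cl_gens G) :: (('v, 'e) cl_gen, 'k) ncpoly ring"
  have fin: "finite (verts G)" and wf: "wf_digraph G"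
    using assms(1) by (simp_all add: fin_digraph.finite_verts fin_digraph_def)
  have sub: "pm.subspace ?I" by (simp add: cl_ideal_def subspace_algebra_ideal)
  have rel: "r \<in> ?I" if "r \<in> cl_relations G P \<Lambda>" for r
    using that by (simp add: cl_ideal_def algebra_ideal.rel)
  have lm: "a * p \<in> ?I" and rm: "p * a \<in> ?I" if "p \<in> ?I" "a \<in> carrier ?F" for p a
    using that by (simp_all add: cl_ideal_def algebra_ideal.lmult algebra_ideal.rmult)
  have vert: "u * vtx w - vtx w \<in> ?I" "vtx w * u - vtx w \<in> ?I" if w: "w \<in> verts G" for w
  proof -
    have "vtx w = (\<Sum>v\<in>verts G. if v = w then vtx v else 0)"
      "vtx w = (\<Sum>v\<in>verts G. if w = v then vtx w else 0)"
      using fin w by simp_all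
    then have "u * vtx w - vtx w = (\<Sum>v\<in>verts G. vtx v * vtx w - (if v = w then vtx v else 0))"
      "vtx w * u - vtx w = (\<Sum>v\<in>verts G. vtx w * vtx v - (if w = v then vtx w else 0))"
      by (simp_all add: u_def sum_subtractf sum_distrib_left sum_distrib_right)
    then show "u * vtx w - vtx w \<in> ?I" "vtx w * u - vtx w \<in> ?I"
      using w by (simp_all only:) (intro pm.subspace_sum[OF sub] rel cl_relations.V; assumption)+
  qed
  have left: "u * y - y \<in> ?I"
    if "w \<in> verts G" "vtx w * y - y \<in> ?I" "y \<in> carrier ?F" "u \<in> carrier ?F" for w y
  proof -
    have "(u * vtx w - vtx w) * y \<in> ?I" "u * (vtx w * y - y) \<in> ?I"
      using that by (auto intro: lm rm vert)
    then have "(u * vtx w - vtx w) * y - u * (vtx w * y - y) + (vtx w * y - y) \<in> ?I"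
      using that(2) by (blast intro: pm.subspace_add[OF sub] pm.subspace_diff[OF sub])
    then show ?thesis by (simp add: algebra_simps)
  qed
  have right: "y * u - y \<in> ?I"
    if "w \<in> verts G" "y * vtx w - y \<in> ?I" "y \<in> carrier ?F" "u \<in> carrier ?F" for w y
  proof -
    have "y * (vtx w * u - vtx w) \<in> ?I" "(y * vtx w - y) * u \<in> ?I"
      using that by (auto intro: lm rm vert)
    then have "y * (vtx w * u - vtx w) - (y * vtx w - y) * u + (y * vtx w - y) \<in> ?I"
      using that(2) by (blast intro: pm.subspace_add[OF sub] pm.subspace_diff[OF sub])
    then show ?thesis by (simp add: algebra_simps)
  qed
  have u: "u \<in> carrier ?F" unfolding u_def
    by (intro pm.subspace_sum[OF subspace_free_algebra] gen_in_free_algebra) (simp add: cl_gens_def)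
  have x: "gen x \<in> carrier ?F" by (rule gen_in_free_algebra[OF assms(2)])
  consider v where "x = Vertex v" "v \<in> verts G" | e where "x = Edge e" "e \<in> arcs G"
    | e where "x = Ghost e" "e \<in> arcs G"
    using assms(2) by (auto simp: cl_gens_def)
  then have "u * gen x - gen x \<in> ?I \<and> gen x * u - gen x \<in> ?I"
  proof cases
    case 1
    then show ?thesis using vert by simp
  next
    case (2 e)
    with u x wf left[of "tail G e" "gen x"] right[of "head G e" "gen x"] show ?thesis
      by (simp add: rel cl_relations.E1_source cl_relations.E1_target
          wf_digraph.tail_in_verts wf_digraph.head_in_verts)
  next
    case (3 e)
    with u x wf left[of "head G e" "gen x"] right[of "tail G e" "gen x"] show ?thesis
      by (simp add: rel cl_relations.E2_source cl_relations.E2_target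
          wf_digraph.tail_in_verts wf_digraph.head_in_verts)
  qed
  then show "u * gen x - gen x \<in> ?I" "gen x * u - gen x \<in> ?I" by auto
qed

lemma cl_unit_word:
  fixes G :: "('v, 'e) pre_digraph"
  assumes "fin_digraph G" "xs \<noteq> []" "set xs \<subseteq> cl_gens G"
  defines "u \<equiv> (\<Sum>v\<in>verts G. vtx v) :: (('v, 'e) cl_gen, 'k::field) ncpoly"
  shows "u * Poly_Mapping.single (Wd xs) 1 - Poly_Mapping.single (Wd xs) 1 \<in> cl_ideal G P \<Lambda>"
    "Poly_Mapping.single (Wd xs) 1 * u - Poly_Mapping.single (Wd xs) 1 \<in> cl_ideal G P \<Lambda>"
proof -
  let ?I = "cl_ideal G P \<Lambda> :: (('v, 'e) cl_gen, 'k) ncpoly set"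
  let ?F = "free_algebra (cl_gens G) :: (('v, 'e) cl_gen, 'k) ncpoly ring"
  let ?s = "\<lambda>xs. Poly_Mapping.single (Wd xs) 1 :: (('v, 'e) cl_gen, 'k) ncpoly"
  have lm: "a * p \<in> ?I" and rm: "p * a \<in> ?I" if "p \<in> ?I" "a \<in> carrier ?F" for p a
    using that by (simp_all add: cl_ideal_def algebra_ideal.lmult algebra_ideal.rmult)
  have word: "?s ys \<in> carrier ?F" if "ys \<noteq> []" "set ys \<subseteq> cl_gens G" for ys
    using that by (simp add: free_algebra_def free_space_def)
  have app: "?s (ys @ zs) = ?s ys * ?s zs" for ys zs
    by (simp add: mult_single plus_free_monoid_def)
  obtain x ys where xs: "xs = x # ys" using assms(2) by (cases xs) auto
  show "u * ?s xs - ?s xs \<in> ?I"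
  proof (cases "ys = []")
    case True
    then show ?thesis using cl_unit_gen(1)[OF assms(1)] assms(3) xs by (simp add: u_def gen_def)
  next
    case False
    then have "(u * gen x - gen x) * ?s ys \<in> ?I" unfolding u_def
      using assms(3) xs by (intro rm cl_unit_gen assms(1) word) auto
    then show ?thesis using app[of "[x]" ys] by (simp add: xs gen_def algebra_simps)
  qed
  obtain z zs where xs: "xs = zs @ [z]" using assms(2) by (cases xs rule: rev_cases) auto
  show "?s xs * u - ?s xs \<in> ?I"
  proof (cases "zs = []")
    case True
    then show ?thesis using cl_unit_gen(2)[OF assms(1)] assms(3) xs by (simp add: u_def gen_def)
  next
    case False
    then have "?s zs * (gen z * u - gen z) \<in> ?I" unfolding u_def
      using assms(3) xs by (intro lm cl_unit_gen assms(1) word) auto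
    then show ?thesis using app[of zs "[z]"] by (simp add: xs gen_def algebra_simps)
  qed
qed

lemma ncpoly_expand:
  "(p :: ('a, 'k::field) ncpoly)
     = (\<Sum>w\<in>Poly_Mapping.keys p. pm_scale (Poly_Mapping.lookup p w) (Poly_Mapping.single w 1))"
proof (rule poly_mapping_eqI)
  fix w
  have "(\<Sum>x\<in>Poly_Mapping.keys p. Poly_Mapping.lookup p x * (1 when x = w))
      = (\<Sum>x\<in>Poly_Mapping.keys p. if x = w then Poly_Mapping.lookup p x else 0)"
    by (rule sum.cong) auto
  then show "Poly_Mapping.lookup p w = Poly_Mapping.lookup
      (\<Sum>w\<in>Poly_Mapping.keys p. pm_scale (Poly_Mapping.lookup p w) (Poly_Mapping.single w 1)) w"
    by (simp add: lookup_sum lookup_single in_keys_iff)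
qed

lemma pm_scale_mult:
  fixes p q :: "('a, 'k::field) ncpoly"
  shows "pm_scale c p * q = pm_scale c (p * q)" "p * pm_scale c q = pm_scale c (p * q)"
proof -
  have scale: "pm_scale c p = Poly_Mapping.single 0 c * p" for c and p :: "('a, 'k) ncpoly"
    by (simp add: pm_scale_def mult_map_scale_conv_mult)
  have comm: "p * Poly_Mapping.single 0 c = Poly_Mapping.single 0 c * p"
  proof -
    have "pm_scale a (Poly_Mapping.single w 1) * Poly_Mapping.single 0 c
        = Poly_Mapping.single 0 c * (pm_scale a (Poly_Mapping.single w 1) :: ('a, 'k) ncpoly)" for a w
      by (simp add: scale mult_single mult.commute)
    then have "(\<Sum>w\<in>Poly_Mapping.keys p. pm_scale (Poly_Mapping.lookup p w) (Poly_Mapping.single w 1))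
          * Poly_Mapping.single 0 c
        = Poly_Mapping.single 0 c * (\<Sum>w\<in>Poly_Mapping.keys p.
            pm_scale (Poly_Mapping.lookup p w) (Poly_Mapping.single w 1))"
      by (simp only: sum_distrib_left sum_distrib_right)
    then show ?thesis by (simp only: ncpoly_expand[symmetric])
  qed
  show "pm_scale c p * q = pm_scale c (p * q)" by (simp add: scale mult.assoc)
  show "p * pm_scale c q = pm_scale c (p * q)"
    by (simp add: scale mult.assoc[symmetric] comm)
qed

lemma cl_unit:
  fixes G :: "('v, 'e) pre_digraph" and p :: "(('v, 'e) cl_gen, 'k::field) ncpoly"
  assumes "fin_digraph G" "p \<in> carrier (free_algebra (cl_gens G))"
  shows "(\<Sum>v\<in>verts G. vtx v) * p - p \<in> cl_ideal G P \<Lambda>"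
    "p * (\<Sum>v\<in>verts G. vtx v) - p \<in> cl_ideal G P \<Lambda>"
proof -
  let ?I = "cl_ideal G P \<Lambda> :: (('v, 'e) cl_gen, 'k) ncpoly set"
  let ?u = "(\<Sum>v\<in>verts G. vtx v) :: (('v, 'e) cl_gen, 'k) ncpoly"
  let ?s = "\<lambda>w. Poly_Mapping.single w 1 :: (('v, 'e) cl_gen, 'k) ncpoly"
  have sub: "pm.subspace ?I" by (simp add: cl_ideal_def subspace_algebra_ideal)
  have word: "?u * ?s w - ?s w \<in> ?I" "?s w * ?u - ?s w \<in> ?I"
    if "w \<in> Poly_Mapping.keys p" for w
  proof -
    have "letters w \<noteq> []" "set (letters w) \<subseteq> cl_gens G"
      using that assms(2) by (auto simp: free_algebra_def free_space_def)
    then show "?u * ?s w - ?s w \<in> ?I" "?s w * ?u - ?s w \<in> ?I"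
      using cl_unit_word[OF assms(1), of "letters w"] by simp_all
  qed
  let ?c = "Poly_Mapping.lookup p"
  have "?u * p - p = ?u * (\<Sum>w\<in>Poly_Mapping.keys p. pm_scale (?c w) (?s w)) - (\<Sum>w\<in>Poly_Mapping.keys p. pm_scale (?c w) (?s w))"
    by (simp only: ncpoly_expand[symmetric])
  also have "\<dots> = (\<Sum>w\<in>Poly_Mapping.keys p. pm_scale (?c w) (?u * ?s w - ?s w))"
    by (simp add: sum_distrib_left pm_scale_mult sum_subtractf pm.scale_right_diff_distrib)
  finally have "?u * p - p = (\<Sum>w\<in>Poly_Mapping.keys p. pm_scale (?c w) (?u * ?s w - ?s w))" .
  then show "?u * p - p \<in> ?I"
    by (auto intro!: pm.subspace_sum[OF sub] pm.subspace_scale[OF sub] word)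
  have "p * ?u - p = (\<Sum>w\<in>Poly_Mapping.keys p. pm_scale (?c w) (?s w)) * ?u - (\<Sum>w\<in>Poly_Mapping.keys p. pm_scale (?c w) (?s w))"
    by (simp only: ncpoly_expand[symmetric])
  also have "\<dots> = (\<Sum>w\<in>Poly_Mapping.keys p. pm_scale (?c w) (?s w * ?u - ?s w))"
    by (simp add: sum_distrib_right pm_scale_mult sum_subtractf pm.scale_right_diff_distrib)
  finally have "p * ?u - p = (\<Sum>w\<in>Poly_Mapping.keys p. pm_scale (?c w) (?s w * ?u - ?s w))" .
  then show "p * ?u - p \<in> ?I"
    by (auto intro!: pm.subspace_sum[OF sub] pm.subspace_scale[OF sub] word)
qed

theorem ring_CL_algebra:
  assumes fin: "fin_digraph G" and sep: "separated_graph G P" and "\<Lambda> \<subseteq> P"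
  shows "ring (CL_algebra G P \<Lambda> :: ('v, 'e, 'k::field) cl_ring)"
proof -
  let ?L = "CL_algebra G P \<Lambda> :: ('v, 'e, 'k) cl_ring"
  let ?F = "free_algebra (cl_gens G) :: (('v, 'e) cl_gen, 'k) ncpoly ring"
  let ?I = "cl_ideal G P \<Lambda> :: (('v, 'e) cl_gen, 'k) ncpoly set"
  let ?u = "(\<Sum>v\<in>verts G. vtx v) :: (('v, 'e) cl_gen, 'k) ncpoly"
  let ?c = "\<lambda>p. ?I +>\<^bsub>?F\<^esub> p"
  note R = cl_relations_subset[OF sep assms(3), where 'k = 'k]
  have carr: "carrier ?L = ?c ` carrier ?F"
    by (auto simp: CL_algebra_def FactRing_def A_RCOSETS_def')
  have add: "?c p \<oplus>\<^bsub>?L\<^esub> ?c q = ?c (p + q)" for p q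
    by (simp add: CL_algebra_def FactRing_def cl_ideal_def coset_add)
  have mult: "?c p \<otimes>\<^bsub>?L\<^esub> ?c q = ?c (p * q)" if "p \<in> carrier ?F" "q \<in> carrier ?F" for p q
    using that by (simp add: CL_algebra_def FactRing_def cl_ideal_def coset_mult[OF R])
  have one: "\<one>\<^bsub>?L\<^esub> = ?c ?u" by (simp add: CL_algebra_def)
  have zero: "\<zero>\<^bsub>?L\<^esub> = ?c 0"
    by (auto simp: CL_algebra_def FactRing_def cl_ideal_def coset_iff)
  have eq: "?c p = ?c q \<longleftrightarrow> p - q \<in> ?I" for p q by (simp add: cl_ideal_def coset_eq_iff)
  have u: "?u \<in> carrier ?F"
    by (intro pm.subspace_sum[OF subspace_free_algebra] gen_in_free_algebra) (simp add: cl_gens_def)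
  note sub = subspace_free_algebra[of "cl_gens G", where 'k = 'k]
  note closed = pm.subspace_add[OF sub] pm.subspace_0[OF sub] pm.subspace_neg[OF sub]
    free_algebra_mult[of _ "cl_gens G"] u
  show ?thesis
  proof (rule ringI)
    show "abelian_group ?L"
    proof (rule abelian_groupI)
      fix x assume "x \<in> carrier ?L"
      then obtain p where p: "p \<in> carrier ?F" "x = ?c p" unfolding carr by blast
      then have "?c (- p) \<in> carrier ?L" "?c (- p) \<oplus>\<^bsub>?L\<^esub> x = \<zero>\<^bsub>?L\<^esub>"
        unfolding carr add zero p(2) using p(1) by (auto intro: closed)
      then show "\<exists>y\<in>carrier ?L. y \<oplus>\<^bsub>?L\<^esub> x = \<zero>\<^bsub>?L\<^esub>" by blast
    qed (auto simp: carr add zero algebra_simps closed)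
  next
    show "monoid ?L"
    proof (rule monoidI)
      fix x assume "x \<in> carrier ?L"
      then obtain p where p: "p \<in> carrier ?F" "x = ?c p" unfolding carr by blast
      then show "\<one>\<^bsub>?L\<^esub> \<otimes>\<^bsub>?L\<^esub> x = x" "x \<otimes>\<^bsub>?L\<^esub> \<one>\<^bsub>?L\<^esub> = x"
        by (simp_all add: one mult u eq cl_unit[OF fin])
    qed (auto simp: carr mult one mult.assoc closed)
  qed (auto simp: carr add mult closed algebra_simps)
qed


section \<open>Invariant basis number\<close>

text \<open>The right \<open>R\<close>-module \<open>R\<^sup>m\<close>, with componentwise operations.\<close>

definition free_rmodule :: "('a, 'b) ring_scheme \<Rightarrow> nat \<Rightarrow> (nat \<Rightarrow> 'a) set" where
  "free_rmodule R m = {..<m} \<rightarrow>\<^sub>E carrier R"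

definition free_rmodule_add ::
    "('a, 'b) ring_scheme \<Rightarrow> nat \<Rightarrow> (nat \<Rightarrow> 'a) \<Rightarrow> (nat \<Rightarrow> 'a) \<Rightarrow> (nat \<Rightarrow> 'a)" where
  "free_rmodule_add R m x y = (\<lambda>i\<in>{..<m}. x i \<oplus>\<^bsub>R\<^esub> y i)"

definition free_rmodule_act ::
    "('a, 'b) ring_scheme \<Rightarrow> nat \<Rightarrow> (nat \<Rightarrow> 'a) \<Rightarrow> 'a \<Rightarrow> (nat \<Rightarrow> 'a)" where
  "free_rmodule_act R m x r = (\<lambda>i\<in>{..<m}. x i \<otimes>\<^bsub>R\<^esub> r)"

definition free_rmodule_iso ::
    "('a, 'b) ring_scheme \<Rightarrow> nat \<Rightarrow> nat \<Rightarrow> ((nat \<Rightarrow> 'a) \<Rightarrow> (nat \<Rightarrow> 'a)) \<Rightarrow> bool" where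
  "free_rmodule_iso R m n \<phi> \<longleftrightarrow>
     bij_betw \<phi> (free_rmodule R m) (free_rmodule R n) \<and>
     (\<forall>x\<in>free_rmodule R m. \<forall>y\<in>free_rmodule R m.
        \<phi> (free_rmodule_add R m x y) = free_rmodule_add R n (\<phi> x) (\<phi> y)) \<and>
     (\<forall>x\<in>free_rmodule R m. \<forall>r\<in>carrier R.
        \<phi> (free_rmodule_act R m x r) = free_rmodule_act R n (\<phi> x) r)"

definition IBN :: "('a, 'b) ring_scheme \<Rightarrow> bool" where
  "IBN R \<longleftrightarrow> (\<forall>m n. 0 < m \<longrightarrow> 0 < n \<longrightarrow> m \<noteq> n \<longrightarrow> \<not> (\<exists>\<phi>. free_rmodule_iso R m n \<phi>))"

end

theory Submission
  imports Defs "HOL-Library.Multiset"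
begin

text \<open>
  Write \<open>L\<close> for the Cohn-Leavitt algebra and call an integer function \<open>f\<close> on the vertices balanced if
  \<open>f (sX) = (\<Sum>e\<in>X. f (t e))\<close> for all \<open>X \<in> \<Lambda>\<close>. A balanced function is a candidate for a homomorphism from
  the Grothendieck group \<open>K\<^sub>0(L)\<close> to the integers that sends the class of the module \<open>vL\<close> to \<open>f v\<close>, and the
  class of \<open>L\<close> itself to \<open>\<Sum>v. f v\<close>. By linear duality, \<open>\<Sum>v. v\<close> lies outside the span of the vectors
  \<open>sX - (\<Sum>e\<in>X. t e)\<close> exactly if some balanced \<open>f\<close> has \<open>(\<Sum>v. f v) \<noteq> 0\<close>.

  If \<open>\<Sum>v. v\<close> is in the span, IBN fails for an elementary reason. For \<open>X \<in> \<Lambda>\<close> the relations (CK1) and (CK2)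
  give \<open>(sX)L \<cong> (\<Oplus>e\<in>X. (t e)L)\<close>. Clearing denominators turns the linear dependence into an isomorphism
  \<open>L\<^sup>N \<oplus> Q \<cong> Q\<close> with \<open>N > 0\<close> and \<open>Q\<close> a finite direct sum of modules \<open>vL\<close> (lemma
  \<open>iso_difference_span\<close>). Adding a complement of \<open>Q\<close> in some \<open>L\<^sup>k\<close> yields \<open>L\<^bsup>N+k\<^esup> \<cong> L\<^sup>k\<close>.

  If it is not in the span, it remains to realise a balanced \<open>f\<close> with nonzero sum as an invariant of modules.
  Dimensions of representations do not suffice, since \<open>f\<close> may take negative values, and traces lose information
  in positive characteristic. Instead \<open>f\<close> is realised as a difference of two infinite dimensions. For a
  balanced function \<open>c\<close> let \<open>B\<^sub>c\<close> be the set of pairs \<open>(v, k)\<close> with \<open>k \<ge> c v\<close>, a half-line of integers for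
  each vertex. The algebra \<open>L\<close> acts on the vector space with basis \<open>B\<^sub>c\<close> by partial injections of the basis:
  \<open>v\<close> restricts to the half-line of \<open>v\<close>, and the edges of a block \<open>X\<close> map their target half-lines
  injectively and with disjoint images into the half-line of \<open>sX\<close>, onto it if \<open>X \<in> \<Lambda>\<close>. Far out these
  injections can be given by formulas \<open>k \<mapsto> r k + j\<close> that do not depend on \<open>c\<close>; what is left is a bijection
  between finite sets, which for \<open>X \<in> \<Lambda>\<close> have equal cardinality precisely because \<open>c\<close> is balanced
  (\<open>exists_bij_with_linear_tail\<close>). Therefore the actions for \<open>c = 0\<close> and \<open>c = f\<close> differ by operators of
  finite rank, while the relative dimension of \<open>B\<^sub>0\<close> and \<open>B\<^sub>f\<close> is \<open>\<Sum>v. f v\<close>. An isomorphism \<open>L\<^sup>m \<cong> L\<^sup>n\<close>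
  gives isomorphisms of the \<open>m\<close>-fold onto the \<open>n\<close>-fold space for both actions, again equal up to finite
  rank, and such a pair preserves the relative dimension (\<open>rel_dim_eq_of_almost_equal_isos\<close>). So
  \<open>m * (\<Sum>v. f v) = n * (\<Sum>v. f v)\<close> and \<open>m = n\<close>.
\<close>

section \<open>Linear maps on finitely supported functions\<close>

text \<open>Rank-nullity on a finite-dimensional subspace of a space that may be infinite-dimensional.\<close>

lemma (in vector_space_pair) dim_kernel_plus_dim_image:
  assumes f: "Vector_Spaces.linear s1 s2 f" and V: "vs1.subspace V" and C: "finite C" "V \<subseteq> vs1.span C"
  shows "vs1.dim V = vs1.dim {x \<in> V. f x = 0} + vs2.dim (f ` V)"
proof -
  let ?N = "{x \<in> V. f x = 0}"
  obtain N where N: "N \<subseteq> ?N" "vs1.independent N" "?N \<subseteq> vs1.span N"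
    using vs1.maximal_independent_subset[of ?N] by blast
  obtain B where B: "N \<subseteq> B" "B \<subseteq> V" "vs1.independent B" "V \<subseteq> vs1.span B"
    using vs1.maximal_independent_subset_extend[of N V] N by blast
  have finB: "finite B"
    using vs1.independent_span_bound[OF C(1) B(3)] B(2) C(2) by blast
  \<comment> \<open>A kernel vector in the span of \<open>B - N\<close> also lies in the span of \<open>N\<close>, so its coordinates in \<open>B\<close> vanish.\<close>
  have injB: "inj_on f (vs1.span (B - N))"
  proof (subst linear_inj_on_iff_eq_0[OF f vs1.subspace_span], intro ballI impI)
    fix x assume x: "x \<in> vs1.span (B - N)" "f x = 0"
    have "vs1.span (B - N) \<subseteq> V" using B V by (intro vs1.span_minimal) auto
    with x have "x \<in> vs1.span N" using N(3) by blast
    show "x = 0"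
    proof -
      have r: "vs1.representation B x = vs1.representation N x"
        by (rule vs1.representation_extend) fact+
      have r': "vs1.representation B x = vs1.representation (B - N) x"
        by (rule vs1.representation_extend) (use B x in auto)
      have "vs1.representation B x = (\<lambda>_. 0)"
      proof
        fix b
        show "vs1.representation B x b = 0"
          using vs1.representation_ne_zero[of N x b] vs1.representation_ne_zero[of "B - N" x b] r r'
          by auto
      qed
      moreover have "x \<in> vs1.span B" using x(1) vs1.span_mono[of "B - N" B] by blast
      ultimately show ?thesis
        using vs1.sum_nonzero_representation_eq[OF B(3), of x] by simp
    qed
  qed
  have im: "f ` V \<subseteq> vs2.span (f ` (B - N))"
  proof (intro image_subsetI)
    fix x assume "x \<in> V"
    then have "f x \<in> f ` vs1.span B" using B by blast
    also have "\<dots> = vs2.span (f ` B)" by (rule linear_span_image[OF f, symmetric])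
    also have "\<dots> \<subseteq> vs2.span (insert 0 (f ` (B - N)))"
      using N(1) by (intro vs2.span_mono) auto
    finally show "f x \<in> vs2.span (f ` (B - N))" by simp
  qed
  have "vs1.dim V = card B" using vs1.basis_card_eq_dim[OF B(2,4,3)] by simp
  moreover have "vs1.dim ?N = card N" using vs1.basis_card_eq_dim[OF N(1,3,2)] by simp
  moreover have "vs2.dim (f ` V) = card (f ` (B - N))"
  proof (rule vs2.basis_card_eq_dim[symmetric, OF _ im])
    show "f ` (B - N) \<subseteq> f ` V" using B by blast
    show "vs2.independent (f ` (B - N))"
      using linear_independent_injective_image[OF f _ injB] vs1.independent_mono[OF B(3)] by blast
  qed
  moreover have "card (f ` (B - N)) = card (B - N)"
    by (rule card_image) (use injB inj_on_subset vs1.span_superset in blast)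
  ultimately show ?thesis
    using card_Diff_subset[of N B] card_mono[OF finB B(1)] finite_subset[OF B(1) finB] B(1) by simp
qed

interpretation pmp: vector_space_pair
  "pm_scale :: 'k::field \<Rightarrow> ('a \<Rightarrow>\<^sub>0 'k) \<Rightarrow> _" "pm_scale :: 'k::field \<Rightarrow> ('b \<Rightarrow>\<^sub>0 'k) \<Rightarrow> _" ..

abbreviation (input) basis_vec :: "'b \<Rightarrow> ('b \<Rightarrow>\<^sub>0 'k::field)" where
  "basis_vec b \<equiv> Poly_Mapping.single b 1"

abbreviation pm_linear :: "(('a \<Rightarrow>\<^sub>0 'k::field) \<Rightarrow> ('b \<Rightarrow>\<^sub>0 'k)) \<Rightarrow> bool" where
  "pm_linear \<equiv> Vector_Spaces.linear pm_scale pm_scale"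

definition lin_ext :: "('a \<Rightarrow> ('b \<Rightarrow>\<^sub>0 'k::field)) \<Rightarrow> ('a \<Rightarrow>\<^sub>0 'k) \<Rightarrow> ('b \<Rightarrow>\<^sub>0 'k)" where
  "lin_ext \<phi> x = (\<Sum>s\<in>Poly_Mapping.keys x. pm_scale (Poly_Mapping.lookup x s) (\<phi> s))"

lemma lin_ext_superset:
  assumes "finite A" "Poly_Mapping.keys x \<subseteq> A"
  shows "lin_ext \<phi> x = (\<Sum>s\<in>A. pm_scale (Poly_Mapping.lookup x s) (\<phi> s))"
  unfolding lin_ext_def by (rule sum.mono_neutral_left) (use assms in \<open>auto simp: in_keys_iff\<close>)

lemma pm_linearI:
  assumes "\<And>x y. f (x + y) = f x + f y" "\<And>c x. f (pm_scale c x) = pm_scale c (f x)"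
  shows "pm_linear f"
  using assms by (simp add: Vector_Spaces.linear_iff pm.vector_space_axioms)

lemma linear_lin_ext:
  fixes \<phi> :: "'a \<Rightarrow> ('b \<Rightarrow>\<^sub>0 'k::field)"
  shows "pm_linear (lin_ext \<phi>)"
proof (rule pm_linearI)
  fix x y :: "'a \<Rightarrow>\<^sub>0 'k"
  let ?A = "Poly_Mapping.keys x \<union> Poly_Mapping.keys y"
  have "lin_ext \<phi> z = (\<Sum>s\<in>?A. pm_scale (Poly_Mapping.lookup z s) (\<phi> s))"
    if "z \<in> {x, y, x + y}" for z
    by (rule lin_ext_superset) (use that keys_add[of x y] in auto)
  then show "lin_ext \<phi> (x + y) = lin_ext \<phi> x + lin_ext \<phi> y"
    by (simp add: lookup_add pm.scale_left_distrib sum.distrib)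
next
  fix c and x :: "'a \<Rightarrow>\<^sub>0 'k"
  have "lin_ext \<phi> (pm_scale c x)
      = (\<Sum>s\<in>Poly_Mapping.keys x. pm_scale (Poly_Mapping.lookup (pm_scale c x) s) (\<phi> s))"
    by (rule lin_ext_superset) (auto simp: in_keys_iff)
  then show "lin_ext \<phi> (pm_scale c x) = pm_scale c (lin_ext \<phi> x)"
    by (simp add: lin_ext_def pm.scale_sum_right)
qed

lemma lin_ext_basis_vec [simp]: "lin_ext \<phi> (basis_vec s) = \<phi> s"
  by (simp add: lin_ext_def)

lemma pm_expand: "x = lin_ext basis_vec (x :: 'a \<Rightarrow>\<^sub>0 'k::field)"
proof (rule poly_mapping_eqI)
  fix w
  have "(\<Sum>s\<in>Poly_Mapping.keys x. Poly_Mapping.lookup x s * (1 when s = w))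
      = (\<Sum>s\<in>Poly_Mapping.keys x. if s = w then Poly_Mapping.lookup x s else 0)"
    by (rule sum.cong) auto
  then show "Poly_Mapping.lookup x w = Poly_Mapping.lookup (lin_ext basis_vec x) w"
    by (simp add: lin_ext_def lookup_sum lookup_single in_keys_iff)
qed

lemma span_basis_vec: "pm.span (basis_vec ` S) = (free_space S :: ('a \<Rightarrow>\<^sub>0 'k::field) set)"
proof
  show "pm.span (basis_vec ` S) \<subseteq> (free_space S :: ('a \<Rightarrow>\<^sub>0 'k) set)"
    by (rule pm.span_minimal[OF _ subspace_free_space]) (auto simp: free_space_def)
  show "(free_space S :: ('a \<Rightarrow>\<^sub>0 'k) set) \<subseteq> pm.span (basis_vec ` S)"
  proof
    fix x :: "'a \<Rightarrow>\<^sub>0 'k" assume "x \<in> free_space S"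
    then have "lin_ext basis_vec x \<in> pm.span (basis_vec ` S)" unfolding lin_ext_def
      by (intro pm.span_sum pm.span_scale pm.span_base) (auto simp: free_space_def)
    then show "x \<in> pm.span (basis_vec ` S)" by (simp add: pm_expand[symmetric])
  qed
qed

lemma pm_linear_eqI:
  fixes f g :: "('a \<Rightarrow>\<^sub>0 'k::field) \<Rightarrow> ('b \<Rightarrow>\<^sub>0 'k)"
  assumes "pm_linear f" "pm_linear g" "x \<in> free_space S"
    "\<And>s. s \<in> S \<Longrightarrow> f (basis_vec s) = g (basis_vec s)"
  shows "f x = g x"
  using assms pmp.linear_eq_on[of f g x "basis_vec ` S"] by (auto simp: span_basis_vec)

lemma pm_linear_into_subspace:
  fixes f :: "('a \<Rightarrow>\<^sub>0 'k::field) \<Rightarrow> ('b \<Rightarrow>\<^sub>0 'k)"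
  assumes "pm_linear f" "pm.subspace W" "x \<in> free_space S"
    "\<And>s. s \<in> S \<Longrightarrow> f (basis_vec s) \<in> W"
  shows "f x \<in> W"
proof -
  have "f ` free_space S = pm.span (f ` basis_vec ` S)"
    by (simp add: span_basis_vec pmp.linear_span_image[OF assms(1)])
  also have "\<dots> \<subseteq> W" using assms by (intro pm.span_minimal) auto
  finally show ?thesis using assms(3) by blast
qed

lemma independent_basis_vec: "pm.independent (basis_vec ` S :: ('a \<Rightarrow>\<^sub>0 'k::field) set)"
proof
  assume "pm.dependent (basis_vec ` S :: ('a \<Rightarrow>\<^sub>0 'k::field) set)"
  then obtain a where a: "a \<in> S"
    "(basis_vec a :: 'a \<Rightarrow>\<^sub>0 'k) \<in> pm.span (basis_vec ` S - {basis_vec a})"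
    unfolding pm.dependent_def by blast
  have "pm.span (basis_vec ` S - {basis_vec a :: 'a \<Rightarrow>\<^sub>0 'k}) \<subseteq> pm.span (basis_vec ` (S - {a}))"
    by (intro pm.span_mono) auto
  with a show False by (auto simp: span_basis_vec free_space_def)
qed

lemma card_basis_vec: "card (basis_vec ` S :: ('a \<Rightarrow>\<^sub>0 'k::field) set) = card S"
  by (rule card_image) (auto simp: inj_on_def dest: arg_cong[where f = Poly_Mapping.keys])

lemma dim_free_space: "pm.dim (free_space S :: ('a \<Rightarrow>\<^sub>0 'k::field) set) = card S"
  using pm.dim_span_eq_card_independent[OF independent_basis_vec[of S]]
  by (simp add: span_basis_vec card_basis_vec)

definition pm_restrict :: "'a set \<Rightarrow> ('a \<Rightarrow>\<^sub>0 'k::field) \<Rightarrow> ('a \<Rightarrow>\<^sub>0 'k)" where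
  "pm_restrict T = lin_ext (\<lambda>s. if s \<in> T then basis_vec s else 0)"

lemma lookup_pm_restrict [simp]:
  "Poly_Mapping.lookup (pm_restrict T x) s = (if s \<in> T then Poly_Mapping.lookup x s else 0)"
proof -
  have "(\<Sum>u\<in>Poly_Mapping.keys x. Poly_Mapping.lookup x u *
        Poly_Mapping.lookup (if u \<in> T then basis_vec u else 0) s)
      = (\<Sum>u\<in>Poly_Mapping.keys x. if u = s then if s \<in> T then Poly_Mapping.lookup x s else 0 else 0)"
    by (rule sum.cong) (auto simp: lookup_single)
  then show ?thesis
    by (auto simp: pm_restrict_def lin_ext_def lookup_sum in_keys_iff)
qed

lemma linear_pm_restrict: "pm_linear (pm_restrict T)"
  unfolding pm_restrict_def by (rule linear_lin_ext)

section \<open>Relative dimension and isomorphisms that agree up to finite rank\<close>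

text \<open>The difference of the dimensions of the spaces with bases \<open>S\<close> and \<open>S'\<close>; it makes sense for infinite \<open>S\<close> and
  \<open>S'\<close> as long as their symmetric difference is finite.\<close>

definition rel_dim :: "'a set \<Rightarrow> 'a set \<Rightarrow> int" where
  "rel_dim S S' = int (card (S - S')) - int (card (S' - S))"

lemma rel_dim_eq_card_diff:
  assumes "finite T" "S - S' \<subseteq> T" "S' - S \<subseteq> T"
  shows "rel_dim S S' = int (card (S \<inter> T)) - int (card (S' \<inter> T))"
proof -
  have "card (S \<inter> T) = card ((S - S') \<union> (S \<inter> S' \<inter> T))"
    "card (S' \<inter> T) = card ((S' - S) \<union> (S \<inter> S' \<inter> T))"
    using assms by (auto intro!: arg_cong[where f = card])
  moreover have "card ((S - S') \<union> (S \<inter> S' \<inter> T)) = card (S - S') + card (S \<inter> S' \<inter> T)"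
    "card ((S' - S) \<union> (S \<inter> S' \<inter> T)) = card (S' - S) + card (S \<inter> S' \<inter> T)"
    using assms by (auto intro!: card_Un_disjoint intro: finite_subset)
  ultimately show ?thesis by (simp add: rel_dim_def)
qed

text \<open>The two isomorphisms \<open>A True\<close> and \<open>A False\<close> agree on a common subspace \<open>U\<close> of finite codimension, so
  both source spaces can be compared with \<open>U\<close> and both target spaces with the image of \<open>U\<close>. To count
  with finite dimensions only, take a finite set \<open>T\<close> of basis vectors outside of which everything agrees,
  and a finite \<open>T'\<close> so large that \<open>B i\<close> maps basis vectors outside \<open>T'\<close> into \<open>U\<close>; this is possible because
  the matrix of \<open>B i\<close> has finite rows. Let \<open>Q i\<close> be the finite-dimensional space of those vectors that
  \<open>A i\<close> maps into the span of \<open>R i \<inter> T'\<close>. Restriction to \<open>T\<close> maps \<open>Q i\<close> onto the span of \<open>S i \<inter> T\<close>,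
  with a kernel \<open>N\<close> that does not depend on \<open>i\<close>. Subtracting the two rank-nullity formulas gives the claim.\<close>

lemma rel_dim_eq_of_almost_equal_isos:
  fixes A :: "bool \<Rightarrow> ('a \<Rightarrow>\<^sub>0 'k::field) \<Rightarrow> ('b \<Rightarrow>\<^sub>0 'k)"
    and B :: "bool \<Rightarrow> ('b \<Rightarrow>\<^sub>0 'k) \<Rightarrow> ('a \<Rightarrow>\<^sub>0 'k)"
  assumes A: "\<And>i. pm_linear (A i)" "\<And>i x. x \<in> free_space (S i) \<Longrightarrow> A i x \<in> free_space (R i)"
    and B: "\<And>i. pm_linear (B i)" "\<And>i y. y \<in> free_space (R i) \<Longrightarrow> B i y \<in> free_space (S i)"
    and BA: "\<And>i x. x \<in> free_space (S i) \<Longrightarrow> B i (A i x) = x"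
    and AB: "\<And>i y. y \<in> free_space (R i) \<Longrightarrow> A i (B i y) = y"
    and finS: "finite (S True - S False)" "finite (S False - S True)"
    and finR: "finite (R True - R False)" "finite (R False - R True)"
    and finA: "finite {s. A True (basis_vec s) \<noteq> A False (basis_vec s)}"
    and finB: "\<And>i s. finite {r. Poly_Mapping.lookup (B i (basis_vec r)) s \<noteq> 0}"
  shows "rel_dim (S True) (S False) = rel_dim (R True) (R False)"
proof -
  define T where "T = {s. A True (basis_vec s) \<noteq> A False (basis_vec s)}
    \<union> (S True - S False) \<union> (S False - S True)"
  have finT: "finite T" using finA finS by (simp add: T_def)
  define T' where "T' = (R True - R False) \<union> (R False - R True)
    \<union> (\<Union>s\<in>T. \<Union>i. {r. Poly_Mapping.lookup (B i (basis_vec r)) s \<noteq> 0})"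
  have finT': "finite T'" using finT finR finB by (simp add: T'_def)
  define U :: "('a \<Rightarrow>\<^sub>0 'k) set" where "U = free_space (S True \<inter> S False - T)"
  have ST: "S i - T = S True \<inter> S False - T" for i
    by (cases i) (auto simp: T_def)
  have RT: "R i - T' = R True \<inter> R False - T'" for i
    by (cases i) (auto simp: T'_def)
  have US: "x \<in> free_space (S i)" if "x \<in> U" for x i
    using that by (cases i) (auto simp: U_def free_space_def)
  have AU: "A i x = A j x" if "x \<in> U" for x i j
  proof -
    have "A True x = A False x"
      by (rule pm_linear_eqI[OF A(1) A(1) that[unfolded U_def]]) (simp add: T_def)
    then show ?thesis by (cases i; cases j) auto
  qed
  have BU: "B i y \<in> U" if y: "y \<in> free_space (R i - T')" for i y
  proof -
    have "B i y \<in> free_space (- T)"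
      by (rule pm_linear_into_subspace[OF B(1) subspace_free_space y])
        (auto simp: free_space_iff T'_def)
    moreover have "B i y \<in> free_space (S i)"
      using B(2) y by (auto simp: free_space_def)
    ultimately have "B i y \<in> free_space (S i - T)" by (auto simp: free_space_def)
    then show ?thesis by (simp add: U_def ST)
  qed
  define Q where "Q = (\<lambda>i. {x \<in> free_space (S i). A i x \<in> free_space (R i \<inter> T')})"
  define N where "N = {x \<in> U. A True x \<in> free_space T'}"
  have Q_eq: "Q i = B i ` free_space (R i \<inter> T')" for i
  proof (intro equalityI subsetI)
    fix x assume "x \<in> Q i"
    then show "x \<in> B i ` free_space (R i \<inter> T')"
      using BA[of x i] by (auto simp: Q_def intro: image_eqI[of _ _ "A i x"])
  next
    fix x assume "x \<in> B i ` free_space (R i \<inter> T')"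
    then obtain y where y: "y \<in> free_space (R i \<inter> T')" "x = B i y" by blast
    moreover from y(1) have "y \<in> free_space (R i)" by (auto simp: free_space_def)
    ultimately show "x \<in> Q i" using AB[of y i] B(2)[of y i] by (simp add: Q_def)
  qed
  have Q_span: "Q i = pm.span (B i ` basis_vec ` (R i \<inter> T'))" for i
    by (simp add: Q_eq pmp.linear_span_image[OF B(1)] span_basis_vec)
  have dimQ: "pm.dim (Q i) = card (R i \<inter> T')" for i
  proof -
    have inj: "inj_on (B i) (free_space (R i \<inter> T'))"
      by (rule inj_on_inverseI[of _ "A i"]) (use AB in \<open>auto simp: free_space_def\<close>)
    then have "pm.independent (B i ` basis_vec ` (R i \<inter> T'))"
      by (intro pmp.linear_independent_injective_image[OF B(1) independent_basis_vec])
        (simp add: span_basis_vec)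
    then have "pm.dim (Q i) = card (B i ` basis_vec ` (R i \<inter> T'))"
      unfolding Q_span by (rule pm.dim_span_eq_card_independent)
    also have "\<dots> = card (basis_vec ` (R i \<inter> T') :: ('b \<Rightarrow>\<^sub>0 'k) set)"
      by (rule card_image, rule inj_on_subset[OF inj]) (auto simp: free_space_def)
    also have "\<dots> = card (R i \<inter> T')" by (rule card_basis_vec)
    finally show ?thesis .
  qed
  have ker: "{x \<in> Q i. pm_restrict T x = 0} = N" for i
  proof (intro equalityI subsetI)
    fix x assume x: "x \<in> {x \<in> Q i. pm_restrict T x = 0}"
    have "Poly_Mapping.lookup x s = 0" if "s \<in> T" for s
      using x lookup_pm_restrict[of T x s] that by simp
    with x have "x \<in> free_space (S i - T)" by (auto simp: Q_def free_space_iff)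
    then have xU: "x \<in> U" by (simp add: U_def ST)
    moreover have "A True x \<in> free_space T'"
      using x AU[OF xU, of True i] by (auto simp: Q_def free_space_def)
    ultimately show "x \<in> N" by (simp add: N_def)
  next
    fix x assume x: "x \<in> N"
    then have xU: "x \<in> U" by (simp add: N_def)
    have "A i x \<in> free_space (R i)" using US[OF xU] by (rule A(2))
    moreover have "A i x \<in> free_space T'"
      using x by (simp add: AU[OF xU, of i True] N_def)
    ultimately have "x \<in> Q i" using US[OF xU] by (auto simp: Q_def free_space_def)
    moreover have "pm_restrict T x = 0"
      using xU by (auto intro!: poly_mapping_eqI simp: U_def free_space_iff)
    ultimately show "x \<in> {x \<in> Q i. pm_restrict T x = 0}" by simp
  qed
  have im: "pm_restrict T ` Q i = free_space (S i \<inter> T)" for i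
  proof (intro equalityI subsetI)
    fix x assume "x \<in> pm_restrict T ` Q i"
    then show "x \<in> free_space (S i \<inter> T)" by (auto simp: Q_def free_space_iff)
  next
    fix x :: "'a \<Rightarrow>\<^sub>0 'k" assume x: "x \<in> free_space (S i \<inter> T)"
    then have xS: "x \<in> free_space (S i)" by (auto simp: free_space_def)
    \<comment> \<open>Subtracting \<open>B i z\<close> cancels the part of \<open>A i x\<close> outside \<open>T'\<close> and does not change \<open>x\<close> on \<open>T\<close>.\<close>
    define z where "z = pm_restrict (- T') (A i x)"
    have zR: "z \<in> free_space (R i - T')"
      using A(2)[OF xS] by (auto simp: z_def free_space_iff)
    then have zU: "B i z \<in> U" by (rule BU)
    have ABz: "A i (B i z) = z" using zR by (intro AB) (auto simp: free_space_def)
    have "A i (x - B i z) = pm_restrict T' (A i x)"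
      unfolding pmp.linear_diff[OF A(1)] ABz
      by (rule poly_mapping_eqI) (simp add: z_def lookup_minus)
    moreover have "pm_restrict T' (A i x) \<in> free_space (R i \<inter> T')"
      using A(2)[OF xS] by (auto simp: free_space_iff)
    moreover have "x - B i z \<in> free_space (S i)"
      using xS US[OF zU] by (intro pm.subspace_diff subspace_free_space)
    ultimately have "x - B i z \<in> Q i" by (simp add: Q_def)
    moreover have "pm_restrict T (x - B i z) = x"
      using x zU by (intro poly_mapping_eqI) (auto simp: lookup_minus U_def free_space_iff)
    ultimately show "x \<in> pm_restrict T ` Q i" by (metis image_eqI)
  qed
  have "card (R i \<inter> T') = pm.dim N + card (S i \<inter> T)" for i
  proof -
    have "pm.dim (Q i) = pm.dim {x \<in> Q i. pm_restrict T x = 0} + pm.dim (pm_restrict T ` Q i)"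
    proof (rule pmp.dim_kernel_plus_dim_image[OF linear_pm_restrict])
      show "pm.subspace (Q i)" by (simp add: Q_span)
      show "finite (B i ` basis_vec ` (R i \<inter> T'))" using finT' by simp
      show "Q i \<subseteq> pm.span (B i ` basis_vec ` (R i \<inter> T'))" by (simp add: Q_span)
    qed
    then show ?thesis by (simp add: dimQ ker im dim_free_space)
  qed
  moreover have "rel_dim (S True) (S False) = int (card (S True \<inter> T)) - int (card (S False \<inter> T))"
    by (rule rel_dim_eq_card_diff[OF finT]) (auto simp: T_def)
  moreover have "rel_dim (R True) (R False) = int (card (R True \<inter> T')) - int (card (R False \<inter> T'))"
    by (rule rel_dim_eq_card_diff[OF finT']) (auto simp: T'_def)
  ultimately show ?thesis by simp
qed

section \<open>Actions of free algebras by partial injections\<close>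

definition pmap_op :: "('b \<rightharpoonup> 'c) \<Rightarrow> ('b \<Rightarrow>\<^sub>0 'k::field) \<Rightarrow> ('c \<Rightarrow>\<^sub>0 'k)" where
  "pmap_op h = lin_ext (\<lambda>s. case h s of None \<Rightarrow> 0 | Some t \<Rightarrow> basis_vec t)"

lemma pmap_op_basis_vec [simp]:
  "pmap_op h (basis_vec s) = (case h s of None \<Rightarrow> 0 | Some t \<Rightarrow> basis_vec t)"
  by (simp add: pmap_op_def)

lemma linear_pmap_op: "pm_linear (pmap_op h)"
  unfolding pmap_op_def by (rule linear_lin_ext)

definition word_act :: "('a \<Rightarrow> 'b \<rightharpoonup> 'b) \<Rightarrow> 'a list \<Rightarrow> 'b \<rightharpoonup> 'b" where
  "word_act act xs = foldr (\<lambda>x h. act x \<circ>\<^sub>m h) xs Some"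

lemma word_act_simps [simp]:
  "word_act act [] = Some" "word_act act (x # xs) = act x \<circ>\<^sub>m word_act act xs"
  by (simp_all add: word_act_def)

lemma word_act_append: "word_act act (xs @ ys) = word_act act xs \<circ>\<^sub>m word_act act ys"
  by (induction xs) (auto simp: map_comp_def fun_eq_iff split: option.splits)

definition rep :: "('a \<Rightarrow> 'b \<rightharpoonup> 'b) \<Rightarrow> ('a, 'k::field) ncpoly \<Rightarrow> ('b \<Rightarrow>\<^sub>0 'k) \<Rightarrow> ('b \<Rightarrow>\<^sub>0 'k)" where
  "rep act p x = lin_ext (\<lambda>w. pmap_op (word_act act (letters w)) x) p"

lemma linear_rep_left: "pm_linear (\<lambda>p. rep act p x)"
  unfolding rep_def by (rule linear_lin_ext)

lemma linear_rep_right: "pm_linear (rep act p)"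
proof (rule pm_linearI)
  fix x y
  show "rep act p (x + y) = rep act p x + rep act p y"
    by (simp add: rep_def lin_ext_def pmp.linear_add[OF linear_pmap_op] pm.scale_right_distrib sum.distrib)
next
  fix c x
  show "rep act p (pm_scale c x) = pm_scale c (rep act p x)"
    by (simp add: rep_def lin_ext_def pmp.linear_scale[OF linear_pmap_op] pm.scale_sum_right
        mult.commute)
qed

lemmas rep_simps =
  pmp.linear_add[OF linear_rep_left] pmp.linear_diff[OF linear_rep_left]
  pmp.linear_scale[OF linear_rep_left] pmp.linear_0[OF linear_rep_left]
  pmp.linear_sum[OF linear_rep_left] pmp.linear_0[OF linear_rep_right]

lemma rep_single: "rep act (basis_vec w) x = pmap_op (word_act act (letters w)) x"
  by (simp add: rep_def)

lemma rep_gen [simp]: "rep act (gen a) x = pmap_op (act a) x"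
proof -
  have "act a \<circ>\<^sub>m Some = act a" by (auto simp: map_comp_def)
  then show ?thesis by (simp add: gen_def rep_single)
qed

lemma rep_mult: "rep act (p * q) x = rep act p (rep act q x)"
proof (rule pm_linear_eqI[where S = UNIV and x = p and f = "\<lambda>p. rep act (p * q) x"
      and g = "\<lambda>p. rep act p (rep act q x)"])
  show "pm_linear (\<lambda>p. rep act (p * q) x)"
    by (rule pm_linearI) (simp_all add: distrib_right pm_scale_mult rep_simps)
  show "pm_linear (\<lambda>p. rep act p (rep act q x))" by (rule linear_rep_left)
  show "p \<in> free_space UNIV" by (simp add: free_space_def)
  fix u
  show "rep act (basis_vec u * q) x = rep act (basis_vec u) (rep act q x)"
  proof (rule pm_linear_eqI[where S = UNIV and x = q and f = "\<lambda>q. rep act (basis_vec u * q) x"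
        and g = "\<lambda>q. rep act (basis_vec u) (rep act q x)"])
    show "pm_linear (\<lambda>q. rep act (basis_vec u * q) x)"
      by (rule pm_linearI) (simp_all add: distrib_left pm_scale_mult rep_simps)
    show "pm_linear (\<lambda>q. rep act (basis_vec u) (rep act q x))"
      by (rule pm_linearI) (simp_all add: rep_simps pmp.linear_add[OF linear_rep_right]
          pmp.linear_scale[OF linear_rep_right])
    show "q \<in> free_space UNIV" by (simp add: free_space_def)
    fix w
    show "rep act (basis_vec u * basis_vec w) x = rep act (basis_vec u) (rep act (basis_vec w) x)"
    proof (rule pm_linear_eqI[where S = UNIV and x = x and f = "rep act (basis_vec u * basis_vec w)"
          and g = "\<lambda>x. rep act (basis_vec u) (rep act (basis_vec w) x)"])
      show "pm_linear (rep act (basis_vec u * basis_vec w))" by (rule linear_rep_right)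
      show "pm_linear (\<lambda>x. rep act (basis_vec u) (rep act (basis_vec w) x))"
        by (rule pm_linearI) (simp_all add: pmp.linear_add[OF linear_rep_right]
            pmp.linear_scale[OF linear_rep_right])
      show "x \<in> free_space UNIV" by (simp add: free_space_def)
      fix s
      show "rep act (basis_vec u * basis_vec w) (basis_vec s)
          = rep act (basis_vec u) (rep act (basis_vec w) (basis_vec s))"
        by (simp add: mult_single rep_single plus_free_monoid_def word_act_append map_comp_def
            pmp.linear_0[OF linear_pmap_op] split: option.splits)
    qed
  qed
qed

lemma rep_eq_0_if_basis_vec:
  assumes "\<And>s. rep act p (basis_vec s) = 0"
  shows "rep act p x = 0"
  by (rule pm_linear_eqI[where S = UNIV, OF linear_rep_right pmp.linear_zero])
    (simp_all add: assms free_space_def)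

lemma rep_algebra_ideal:
  assumes "\<And>r x. r \<in> R \<Longrightarrow> rep act r x = 0" "p \<in> algebra_ideal S R"
  shows "rep act p x = 0"
  using assms(2)
  by (induction arbitrary: x) (simp_all add: assms(1) rep_simps rep_mult)

text \<open>All words have a first letter because the free algebra has no unit, hence only the images of single letters
  matter.\<close>

lemma rep_into_free_space:
  assumes "\<And>a s t. act a s = Some t \<Longrightarrow> t \<in> B" "p \<in> carrier (free_algebra S)"
  shows "rep act p x \<in> free_space B"
proof (rule pm_linear_into_subspace[where f = "\<lambda>p. rep act p x", OF linear_rep_left subspace_free_space])
  show "p \<in> free_space {w. letters w \<noteq> [] \<and> set (letters w) \<subseteq> S}"
    using assms(2) by (simp add: free_algebra_def)
  fix w :: "'a free_monoid" assume "w \<in> {w. letters w \<noteq> [] \<and> set (letters w) \<subseteq> S}"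
  then obtain a ys where w: "letters w = a # ys" by (auto simp: neq_Nil_conv)
  show "rep act (basis_vec w) x \<in> free_space B"
  proof (rule pm_linear_into_subspace[OF linear_rep_right subspace_free_space, of _ UNIV])
    show "x \<in> free_space UNIV" by (simp add: free_space_def)
    fix s
    show "rep act (basis_vec w) (basis_vec s) \<in> free_space B"
      using assms(1) by (auto simp: rep_single w free_space_def map_comp_def split: option.splits)
  qed
qed

lemma inj_on_map_comp:
  assumes "inj_on h (dom h)" "inj_on k (dom k)"
  shows "inj_on (h \<circ>\<^sub>m k) (dom (h \<circ>\<^sub>m k))"
  using assms by (auto simp: inj_on_def map_comp_def dom_def split: option.splits)

lemma inj_on_word_act:
  assumes "\<And>a. inj_on (act a) (dom (act a))"
  shows "inj_on (word_act act xs) (dom (word_act act xs))"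
  by (induction xs) (simp_all add: inj_on_map_comp assms)

lemma finite_partial_fibre:
  assumes "inj_on h (dom h)"
  shows "finite {s. h s = Some t}"
proof (cases "\<exists>u. h u = Some t")
  case True
  then obtain u where "h u = Some t" by blast
  with assms have "{s. h s = Some t} \<subseteq> {u}" by (auto simp: inj_on_def dom_def)
  then show ?thesis by (rule finite_subset) simp
qed simp

text \<open>A product of partial maps can change only where the inner factor changes or at a preimage of a point where the
  outer factor changes; injectivity makes the preimages finite.\<close>

lemma finite_word_act_diff:
  assumes inj: "\<And>a. inj_on (act a) (dom (act a))"
    and fin: "\<And>a. finite {s. act a s \<noteq> act' a s}"
  shows "finite {s. word_act act xs s \<noteq> word_act act' xs s}"
proof (induction xs)
  case (Cons a xs)
  let ?D = "{s. act a s \<noteq> act' a s}"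
  have "{s. word_act act (a # xs) s \<noteq> word_act act' (a # xs) s}
      \<subseteq> {s. word_act act xs s \<noteq> word_act act' xs s} \<union> (\<Union>t\<in>?D. {s. word_act act xs s = Some t})"
    by (auto simp: map_comp_def split: option.splits) metis
  moreover have "finite (\<Union>t\<in>?D. {s. word_act act xs s = Some t})"
    using fin finite_partial_fibre[OF inj_on_word_act[of act, OF inj]] by blast
  ultimately show ?case using Cons by (meson finite_UnI finite_subset)
qed simp

lemma finite_rep_diff:
  fixes p :: "('a, 'k::field) ncpoly"
  assumes inj: "\<And>a. inj_on (act a) (dom (act a))"
    and fin: "\<And>a. finite {s. act a s \<noteq> act' a s}"
  shows "finite {s. rep act p (basis_vec s) \<noteq> rep act' p (basis_vec s)}"
proof (rule finite_subset)
  show "finite (\<Union>w\<in>Poly_Mapping.keys p.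
      {s. word_act act (letters w) s \<noteq> word_act act' (letters w) s})"
    by (intro finite_UN_I finite_keys finite_word_act_diff inj fin)
  show "{s. rep act p (basis_vec s) \<noteq> rep act' p (basis_vec s)}
      \<subseteq> (\<Union>w\<in>Poly_Mapping.keys p. {s. word_act act (letters w) s \<noteq> word_act act' (letters w) s})"
    unfolding rep_def lin_ext_def by (auto intro!: sum.cong)
qed

lemma finite_rep_row:
  fixes p :: "('a, 'k::field) ncpoly"
  assumes inj: "\<And>a. inj_on (act a) (dom (act a))"
  shows "finite {s. Poly_Mapping.lookup (rep act p (basis_vec s)) t \<noteq> 0}"
proof (rule finite_subset)
  show "finite (\<Union>w\<in>Poly_Mapping.keys p. {s. word_act act (letters w) s = Some t})"
    by (intro finite_UN_I finite_keys finite_partial_fibre inj_on_word_act inj)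
  show "{s. Poly_Mapping.lookup (rep act p (basis_vec s)) t \<noteq> 0}
      \<subseteq> (\<Union>w\<in>Poly_Mapping.keys p. {s. word_act act (letters w) s = Some t})"
  proof
    fix s assume "s \<in> {s. Poly_Mapping.lookup (rep act p (basis_vec s)) t \<noteq> 0}"
    then obtain w where "w \<in> Poly_Mapping.keys p"
      "Poly_Mapping.lookup (pmap_op (word_act act (letters w)) (basis_vec s) :: 'b \<Rightarrow>\<^sub>0 'k) t \<noteq> 0"
      unfolding rep_def lin_ext_def lookup_sum mem_Collect_eq
      by (auto elim!: sum.not_neutral_contains_not_neutral simp del: pmap_op_basis_vec)
    then show "s \<in> (\<Union>w\<in>Poly_Mapping.keys p. {s. word_act act (letters w) s = Some t})"
      by (auto split: option.splits simp: lookup_single when_def split: if_splits)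
  qed
qed

section \<open>Matrices over a free algebra\<close>

definition emb :: "nat \<Rightarrow> ('b \<Rightarrow>\<^sub>0 'k::field) \<Rightarrow> (nat \<times> 'b \<Rightarrow>\<^sub>0 'k)" where
  "emb j = lin_ext (\<lambda>s. basis_vec (j, s))"

lemma linear_emb: "pm_linear (emb j)"
  unfolding emb_def by (rule linear_lin_ext)

lemma emb_basis_vec [simp]: "emb j (basis_vec s) = basis_vec (j, s)"
  by (simp add: emb_def)

lemma lookup_emb: "Poly_Mapping.lookup (emb j y) (i, t) = (if i = j then Poly_Mapping.lookup y t else 0)"
proof -
  have "Poly_Mapping.lookup (emb j y) (i, t)
      = (\<Sum>s\<in>Poly_Mapping.keys y. if s = t then if i = j then Poly_Mapping.lookup y t else 0 else 0)"
    unfolding emb_def lin_ext_def lookup_sum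
    by (rule sum.cong) (auto simp: lookup_single when_def)
  then show ?thesis by (auto simp: in_keys_iff)
qed

text \<open>An \<open>n \<times> m\<close> matrix over the free algebra acts from \<open>m\<close> copies of the module to \<open>n\<close> copies. Basis vectors
  outside of the first \<open>m\<close> copies go to \<open>0\<close>, so that all but finitely many copies can be ignored.\<close>

definition matrix_rep :: "('a \<Rightarrow> 'b \<rightharpoonup> 'b) \<Rightarrow> nat \<Rightarrow> nat \<Rightarrow> (nat \<Rightarrow> nat \<Rightarrow> ('a, 'k::field) ncpoly)
    \<Rightarrow> (nat \<times> 'b \<Rightarrow>\<^sub>0 'k) \<Rightarrow> (nat \<times> 'b \<Rightarrow>\<^sub>0 'k)" where
  "matrix_rep act n m A = lin_ext (\<lambda>(j, s).
     if j < m then \<Sum>i<n. emb i (rep act (A i j) (basis_vec s)) else 0)"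

lemma linear_matrix_rep: "pm_linear (matrix_rep act n m A)"
  unfolding matrix_rep_def by (rule linear_lin_ext)

lemma matrix_rep_basis_vec:
  "matrix_rep act n m A (basis_vec (j, s))
     = (if j < m then \<Sum>i<n. emb i (rep act (A i j) (basis_vec s)) else 0)"
  by (simp add: matrix_rep_def)

lemma matrix_rep_emb:
  assumes "j < m"
  shows "matrix_rep act n m A (emb j y) = (\<Sum>i<n. emb i (rep act (A i j) y))"
proof (rule pm_linear_eqI[where S = UNIV and x = y and f = "\<lambda>y. matrix_rep act n m A (emb j y)"
      and g = "\<lambda>y. \<Sum>i<n. emb i (rep act (A i j) y)"])
  show "pm_linear (\<lambda>y. matrix_rep act n m A (emb j y))"
    by (rule pm_linearI) (simp_all add: pmp.linear_add[OF linear_emb] pmp.linear_scale[OF linear_emb]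
      pmp.linear_add[OF linear_matrix_rep] pmp.linear_scale[OF linear_matrix_rep])
  show "pm_linear (\<lambda>y. \<Sum>i<n. emb i (rep act (A i j) y))"
    by (rule pm_linearI) (simp_all add: pmp.linear_add[OF linear_emb] pmp.linear_scale[OF linear_emb]
      pmp.linear_add[OF linear_rep_right] pmp.linear_scale[OF linear_rep_right] sum.distrib
      pm.scale_sum_right)
  show "y \<in> free_space UNIV" by (simp add: free_space_def)
qed (simp add: matrix_rep_basis_vec assms)

lemma matrix_rep_mult:
  assumes "k < m"
  shows "matrix_rep act m' n B (matrix_rep act n m A (basis_vec (k, s)))
    = (\<Sum>j<m'. emb j (rep act (\<Sum>i<n. B j i * A i k) (basis_vec s)))"
proof -
  have "matrix_rep act m' n B (matrix_rep act n m A (basis_vec (k, s)))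
      = (\<Sum>i<n. \<Sum>j<m'. emb j (rep act (B j i) (rep act (A i k) (basis_vec s))))"
    using assms by (simp add: matrix_rep_basis_vec pmp.linear_sum[OF linear_matrix_rep] matrix_rep_emb)
  also have "\<dots> = (\<Sum>j<m'. \<Sum>i<n. emb j (rep act (B j i) (rep act (A i k) (basis_vec s))))"
    by (rule sum.swap)
  finally show ?thesis
    by (simp add: rep_simps rep_mult pmp.linear_sum[OF linear_emb])
qed

lemma matrix_rep_into_free_space:
  fixes act :: "'a \<Rightarrow> 'b \<rightharpoonup> 'b"
  assumes "\<And>a s t. act a s = Some t \<Longrightarrow> t \<in> B"
    "\<And>i j. i < n \<Longrightarrow> j < m \<Longrightarrow> A i j \<in> carrier (free_algebra S)"
  shows "matrix_rep act n m A x \<in> free_space ({..<n} \<times> B)"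
proof (rule pm_linear_into_subspace[OF linear_matrix_rep subspace_free_space, of _ UNIV])
  show "x \<in> free_space UNIV" by (simp add: free_space_def)
  fix r :: "nat \<times> 'b"
  obtain j s where r: "r = (j, s)" by force
  have "emb i (rep act (A i j) (basis_vec s)) \<in> free_space ({..<n} \<times> B)"
    if "i < n" "j < m" for i
    using rep_into_free_space[of act B "A i j" S "basis_vec s"] assms that
    by (auto simp: free_space_iff lookup_emb)
  then show "matrix_rep act n m A (basis_vec r) \<in> free_space ({..<n} \<times> B)"
    unfolding r matrix_rep_basis_vec
    using pm.subspace_0[OF subspace_free_space] by (auto intro!: pm.subspace_sum subspace_free_space)
qed

lemma finite_matrix_rep_diff:
  assumes inj: "\<And>a. inj_on (act a) (dom (act a))"
    and fin: "\<And>a. finite {s. act a s \<noteq> act' a s}"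
  shows "finite {r. matrix_rep act n m A (basis_vec r) \<noteq> matrix_rep act' n m A (basis_vec r)}"
proof (rule finite_subset)
  let ?D = "\<lambda>i j. {s. rep act (A i j) (basis_vec s) \<noteq> rep act' (A i j) (basis_vec s)}"
  show "finite ({..<m} \<times> (\<Union>i<n. \<Union>j<m. ?D i j))"
    by (intro finite_cartesian_product finite_UN_I finite_lessThan finite_rep_diff inj fin)
  show "{r. matrix_rep act n m A (basis_vec r) \<noteq> matrix_rep act' n m A (basis_vec r)}
      \<subseteq> {..<m} \<times> (\<Union>i<n. \<Union>j<m. ?D i j)"
    by (fastforce simp: matrix_rep_basis_vec split: if_splits intro!: sum.cong)
qed

lemma finite_matrix_rep_row:
  assumes inj: "\<And>a. inj_on (act a) (dom (act a))"
  shows "finite {r. Poly_Mapping.lookup (matrix_rep act n m A (basis_vec r)) u \<noteq> 0}"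
proof -
  obtain i t where u: "u = (i, t)" by force
  let ?D = "\<lambda>j. {s. Poly_Mapping.lookup (rep act (A i j) (basis_vec s)) t \<noteq> 0}"
  have "finite ({..<m} \<times> (\<Union>j<m. ?D j))"
    by (intro finite_cartesian_product finite_UN_I finite_lessThan finite_rep_row inj)
  moreover have "{r. Poly_Mapping.lookup (matrix_rep act n m A (basis_vec r)) u \<noteq> 0}
      \<subseteq> {..<m} \<times> (\<Union>j<m. ?D j)"
    by (auto simp: matrix_rep_basis_vec u lookup_sum lookup_emb split: if_splits)
  ultimately show ?thesis by (rule rev_finite_subset)
qed

lemma rel_dim_Times: "rel_dim ({..<n::nat} \<times> S) ({..<n} \<times> S') = int n * rel_dim S S'"
proof -
  have "{..<n} \<times> S - {..<n} \<times> S' = {..<n} \<times> (S - S')" for S S' :: "'a set" by auto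
  then show ?thesis by (simp add: rel_dim_def card_cartesian_product algebra_simps)
qed

text \<open>Here \<open>u\<close> plays the role of the unit of the algebra under study, and the matrices \<open>A\<close> and \<open>B\<close> are inverse to
  each other as far as the two representations can see.\<close>

lemma matrix_size_eq_of_almost_equal_reps:
  fixes act :: "bool \<Rightarrow> 'a \<Rightarrow> 'b \<rightharpoonup> 'b"
    and A B :: "nat \<Rightarrow> nat \<Rightarrow> ('a, 'k::field) ncpoly"
  assumes inj: "\<And>i a. inj_on (act i a) (dom (act i a))"
    and diff: "\<And>a. finite {s. act True a s \<noteq> act False a s}"
    and S: "\<And>i a s t. act i a s = Some t \<Longrightarrow> t \<in> S i"
    and finS: "finite (S True - S False)" "finite (S False - S True)"
    and u: "\<And>i s. s \<in> S i \<Longrightarrow> rep (act i) u (basis_vec s) = basis_vec s"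
    and A: "\<And>i j. i < n \<Longrightarrow> j < m \<Longrightarrow> A i j \<in> carrier (free_algebra X)"
    and B: "\<And>i j. j < m \<Longrightarrow> i < n \<Longrightarrow> B j i \<in> carrier (free_algebra X)"
    and AB: "\<And>i k x b. i < n \<Longrightarrow> k < n \<Longrightarrow>
      rep (act b) (\<Sum>j<m. A i j * B j k) x = (if i = k then rep (act b) u x else 0)"
    and BA: "\<And>j k x b. j < m \<Longrightarrow> k < m \<Longrightarrow>
      rep (act b) (\<Sum>i<n. B j i * A i k) x = (if j = k then rep (act b) u x else 0)"
  shows "int m * rel_dim (S True) (S False) = int n * rel_dim (S True) (S False)"
proof -
  have inverse: "matrix_rep (act b) p q D (matrix_rep (act b) q p C x) = x"
    if x: "x \<in> free_space ({..<p} \<times> S b)"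
      and DC: "\<And>j k y. j < p \<Longrightarrow> k < p \<Longrightarrow>
        rep (act b) (\<Sum>i<q. D j i * C i k) y = (if j = k then rep (act b) u y else 0)"
    for b p q and C D :: "nat \<Rightarrow> nat \<Rightarrow> ('a, 'k) ncpoly" and x
  proof (rule pm_linear_eqI[OF _ _ x])
    show "pm_linear (\<lambda>x. matrix_rep (act b) p q D (matrix_rep (act b) q p C x))"
      by (rule pm_linearI) (simp_all add: pmp.linear_add[OF linear_matrix_rep]
          pmp.linear_scale[OF linear_matrix_rep])
    show "pm_linear (\<lambda>x::nat \<times> 'b \<Rightarrow>\<^sub>0 'k. x)" by (rule pm_linearI) simp_all
    fix r assume "r \<in> {..<p} \<times> S b"
    then obtain k s where r: "r = (k, s)" "k < p" "s \<in> S b" by auto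
    have "emb j (if j = k then rep (act b) u (basis_vec s) else 0)
        = (if k = j then basis_vec (k, s) else 0 :: nat \<times> 'b \<Rightarrow>\<^sub>0 'k)" for j
      using r(3) by (simp add: u pmp.linear_0[OF linear_emb])
    then have "matrix_rep (act b) p q D (matrix_rep (act b) q p C (basis_vec r))
        = (\<Sum>j<p. if k = j then basis_vec (k, s) else 0)"
      using r(2) by (simp add: r(1) matrix_rep_mult DC)
    then show "matrix_rep (act b) p q D (matrix_rep (act b) q p C (basis_vec r)) = basis_vec r"
      using r by simp
  qed
  have finT: "finite ({..<p::nat} \<times> S True - {..<p} \<times> S False)"
    "finite ({..<p::nat} \<times> S False - {..<p} \<times> S True)" for p
  proof -
    have "{..<p} \<times> S b - {..<p} \<times> S b' = {..<p} \<times> (S b - S b')" for b b' by auto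
    then show "finite ({..<p} \<times> S True - {..<p} \<times> S False)"
      "finite ({..<p} \<times> S False - {..<p} \<times> S True)"
      using finS by simp_all
  qed
  have "rel_dim ({..<m} \<times> S True) ({..<m} \<times> S False) = rel_dim ({..<n} \<times> S True) ({..<n} \<times> S False)"
  proof (rule rel_dim_eq_of_almost_equal_isos[where S = "\<lambda>b. {..<m} \<times> S b" and R = "\<lambda>b. {..<n} \<times> S b"
        and A = "\<lambda>b. matrix_rep (act b) n m A" and B = "\<lambda>b. matrix_rep (act b) m n B"])
    show "matrix_rep (act b) n m A x \<in> free_space ({..<n} \<times> S b)" for b x
      by (rule matrix_rep_into_free_space[OF S A])
    show "matrix_rep (act b) m n B x \<in> free_space ({..<m} \<times> S b)" for b x
      by (rule matrix_rep_into_free_space[OF S B])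
  qed (simp_all add: linear_matrix_rep inverse AB BA finT
      finite_matrix_rep_diff[OF inj diff] finite_matrix_rep_row[OF inj])
  then show ?thesis by (simp add: rel_dim_Times)
qed

section \<open>Injections of half-lines along the edges\<close>

text \<open>Above \<open>M\<close> the pairs \<open>(i, k)\<close> are enumerated by \<open>r * k + idx i\<close> with \<open>r = card I\<close>, that is, by quotient and
  remainder, and they fill the half-line from \<open>r * M\<close> on. Below \<open>M\<close> there remain \<open>r * M - (\<Sum>i\<in>I. c i)\<close> pairs,
  exactly as many as there are integers between \<open>\<Sum>i\<in>I. c i\<close> and \<open>r * M\<close>. The choice of the finite bijection is immaterial;
  what counts is that the formula for the tail does not involve \<open>c\<close>.\<close>

lemma exists_bij_with_linear_tail:
  fixes c :: "'i \<Rightarrow> int"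
  assumes I: "finite I" "I \<noteq> {}" and idx: "bij_betw idx I {0..<int (card I)}"
    and c: "\<And>i. i \<in> I \<Longrightarrow> c i \<le> M"
  obtains g where "bij_betw (\<lambda>(i, k). g i k) (SIGMA i:I. {c i..}) {(\<Sum>i\<in>I. c i)..}"
    "\<And>i k. i \<in> I \<Longrightarrow> M \<le> k \<Longrightarrow> g i k = int (card I) * k + idx i"
proof -
  define r where "r = int (card I)"
  define d where "d = (\<Sum>i\<in>I. c i)"
  have r: "r > 0" using I by (simp add: r_def card_gt_0_iff)
  have dM: "d \<le> r * M"
    using sum_mono[of I c "\<lambda>_. M"] c by (simp add: d_def r_def)
  have "bij_betw (\<lambda>(i, k). r * k + idx i) (I \<times> {M..}) {r * M..}"
  proof (rule bij_betw_byWitness[where f' = "\<lambda>n. (inv_into I idx (n mod r), n div r)"])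
    show "\<forall>a\<in>I \<times> {M..}. (\<lambda>n. (inv_into I idx (n mod r), n div r)) ((\<lambda>(i, k). r * k + idx i) a) = a"
    proof
      fix a assume "a \<in> I \<times> {M..}"
      then obtain i k where a: "a = (i, k)" "i \<in> I" by auto
      then have "idx i \<in> {0..<r}" using idx by (auto simp: bij_betw_def r_def)
      then show "(\<lambda>n. (inv_into I idx (n mod r), n div r)) ((\<lambda>(i, k). r * k + idx i) a) = a"
        using a idx by (simp add: bij_betw_def div_add1_eq inv_into_f_f)
    qed
    show "\<forall>n\<in>{r * M..}. (\<lambda>(i, k). r * k + idx i) (inv_into I idx (n mod r), n div r) = n"
    proof
      fix n
      have "n mod r \<in> idx ` I" using idx r by (auto simp: bij_betw_def r_def)
      then show "(\<lambda>(i, k). r * k + idx i) (inv_into I idx (n mod r), n div r) = n"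
        by (simp add: f_inv_into_f)
    qed
    show "(\<lambda>(i, k). r * k + idx i) ` (I \<times> {M..}) \<subseteq> {r * M..}"
    proof clarsimp
      fix i k assume "i \<in> I" "M \<le> k"
      moreover from this have "0 \<le> idx i" using idx by (auto simp: bij_betw_def)
      moreover have "r * M \<le> r * k" using \<open>M \<le> k\<close> r by simp
      ultimately show "r * M \<le> r * k + idx i" by linarith
    qed
    show "(\<lambda>n. (inv_into I idx (n mod r), n div r)) ` {r * M..} \<subseteq> I \<times> {M..}"
    proof clarsimp
      fix n assume n: "r * M \<le> n"
      have "n mod r \<in> idx ` I" using idx r by (auto simp: bij_betw_def r_def)
      moreover have "M \<le> n div r" using zdiv_mono1[OF n r] r by simp
      ultimately show "inv_into I idx (n mod r) \<in> I \<and> M \<le> n div r"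
        by (simp add: inv_into_into)
    qed
  qed
  moreover
  have "card (SIGMA i:I. {c i..<M}) = card {d..<r * M}"
  proof -
    have "int (card (SIGMA i:I. {c i..<M})) = (\<Sum>i\<in>I. M - c i)"
      using c I by (simp add: card_SigmaI)
    also have "\<dots> = r * M - d" by (simp add: sum_subtractf r_def d_def)
    finally show ?thesis using dM by simp
  qed
  then obtain h where "bij_betw h (SIGMA i:I. {c i..<M}) {d..<r * M}"
    using finite_same_card_bij[of "SIGMA i:I. {c i..<M}" "{d..<r * M}"] I by auto
  ultimately have "bij_betw (\<lambda>a. if a \<in> (SIGMA i:I. {c i..<M}) then h a else (\<lambda>(i, k). r * k + idx i) a)
      ((SIGMA i:I. {c i..<M}) \<union> I \<times> {M..}) ({d..<r * M} \<union> {r * M..})"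
    by (intro bij_betw_disjoint_Un) (auto intro: bij_betw_cong[THEN iffD1])
  moreover have "(SIGMA i:I. {c i..<M}) \<union> I \<times> {M..} = (SIGMA i:I. {c i..})"
    using c by force
  moreover have "{d..<r * M} \<union> {r * M..} = {d..}" using dM by auto
  ultimately have bij: "bij_betw (\<lambda>a. if a \<in> (SIGMA i:I. {c i..<M}) then h a else (\<lambda>(i, k). r * k + idx i) a)
      (SIGMA i:I. {c i..}) {d..}" by simp
  show thesis
  proof (rule that)
    show "bij_betw (\<lambda>(i, k). (\<lambda>i k. if (i, k) \<in> (SIGMA i:I. {c i..<M}) then h (i, k) else r * k + idx i) i k)
        (SIGMA i:I. {c i..}) {(\<Sum>i\<in>I. c i)..}"
      using bij unfolding d_def[symmetric] by (rule bij_betw_cong[THEN iffD1, rotated]) (auto split: if_splits)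
  qed (simp add: r_def)
qed

definition balanced :: "('v, 'e) pre_digraph \<Rightarrow> 'e set set \<Rightarrow> ('v \<Rightarrow> int) \<Rightarrow> bool" where
  "balanced G \<Lambda> c \<longleftrightarrow> (\<forall>X\<in>\<Lambda>. c (block_source G X) = (\<Sum>e\<in>X. c (head G e)))"

text \<open>The edge \<open>e\<close> maps the point \<open>k\<close> of the half-line over its target to the point \<open>g e k\<close> over its source.
  Injectivity on a whole block is what (CK1) requires, surjectivity is what (CK2) requires.\<close>

definition edge_maps :: "('v, 'e) pre_digraph \<Rightarrow> 'e set set \<Rightarrow> 'e set set \<Rightarrow> ('v \<Rightarrow> int) \<Rightarrow> ('e \<Rightarrow> int \<Rightarrow> int) \<Rightarrow> bool" where
  "edge_maps G P \<Lambda> c g \<longleftrightarrow> (\<forall>X\<in>P.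
     inj_on (\<lambda>(e, k). g e k) (SIGMA e:X. {c (head G e)..}) \<and>
     (\<lambda>(e, k). g e k) ` (SIGMA e:X. {c (head G e)..}) \<subseteq> {c (block_source G X)..} \<and>
     (X \<in> \<Lambda> \<longrightarrow> {c (block_source G X)..} \<subseteq> (\<lambda>(e, k). g e k) ` (SIGMA e:X. {c (head G e)..})))"

lemma separated_graph_block:
  assumes "separated_graph G P" "e \<in> arcs G"
  shows "\<exists>X\<in>P. e \<in> X"
  using assms by (auto simp: separated_graph_def refines_def partition_on_def)

lemma separated_graph_block_nonempty:
  assumes "separated_graph G P" "X \<in> P"
  obtains e where "e \<in> X"
proof -
  have "X \<noteq> {}" using assms by (auto simp: separated_graph_def refines_def partition_on_def)
  then show thesis using that by blast
qed

lemma separated_graph_block_unique: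
  assumes "separated_graph G P" "X \<in> P" "Y \<in> P" "e \<in> X" "e \<in> Y"
  shows "X = Y"
proof -
  have "disjoint P" using assms(1) by (simp add: separated_graph_def refines_def partition_on_def)
  then show ?thesis using assms(2-5) by (auto simp: disjoint_def)
qed

lemma finite_blocks:
  assumes "fin_digraph G" "separated_graph G P"
  shows "finite P" "X \<in> P \<Longrightarrow> finite X"
proof -
  have "P \<subseteq> Pow (arcs G)" using block_source(2)[OF assms(2)] by blast
  moreover have "finite (arcs G)" using assms(1) by (rule fin_digraph.finite_arcs)
  ultimately show "finite P" "X \<in> P \<Longrightarrow> finite X" by (auto intro: finite_subset)
qed

text \<open>The tails \<open>k \<mapsto> r e * k + j e\<close> are the same for all balanced \<open>c\<close>, which makes actions for different \<open>c\<close>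
  comparable. A block outside \<open>\<Lambda>\<close> imposes no equation on \<open>c\<close>. Such a block gets an additional phantom edge
  \<open>None\<close> whose half-line starts at the value that restores the equation; forgetting the phantom edge leaves
  an injection that is not onto. In \<open>K\<^sub>0\<close> the phantom edge corresponds to the basis vector \<open>X\<close> of the space
  with basis \<open>\<Omega>\<close>.\<close>

lemma exists_edge_maps:
  fixes G :: "('v, 'e) pre_digraph"
  assumes fin: "fin_digraph G" and sep: "separated_graph G P"
  obtains r j :: "'e \<Rightarrow> int" where
    "\<And>c. balanced G \<Lambda> c \<Longrightarrow> \<exists>g M. edge_maps G P \<Lambda> c g \<and>
       (\<forall>e\<in>arcs G. \<forall>k\<ge>M. g e k = r e * k + j e)"
proof -
  define I where "I X = Some ` X \<union> (if X \<in> \<Lambda> then {} else {None})" for X :: "'e set"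
  have finI: "finite (I X)" if "X \<in> P" for X
    using finite_blocks(2)[OF assms that] by (simp add: I_def)
  have neI: "I X \<noteq> {}" if "X \<in> P" for X
    using sep that by (auto simp: I_def separated_graph_def refines_def partition_on_def)
  have "\<forall>X\<in>P. \<exists>idx. bij_betw idx (I X) {0..<int (card (I X))}"
    using finI by (auto intro: finite_same_card_bij)
  then obtain idx where idx: "\<And>X. X \<in> P \<Longrightarrow> bij_betw (idx X) (I X) {0..<int (card (I X))}"
    by metis
  obtain blk where blk: "\<And>e. e \<in> arcs G \<Longrightarrow> blk e \<in> P \<and> e \<in> blk e"
    using separated_graph_block[OF sep] by metis
  have blk_eq: "blk e = X" if "X \<in> P" "e \<in> X" for e X
    using separated_graph_block_unique[OF sep, of "blk e" X e] blk block_source(2)[OF sep that] that by blast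
  show thesis
  proof (rule that)
    fix c :: "'v \<Rightarrow> int" assume c: "balanced G \<Lambda> c"
    define d where "d X i = (case i of Some e \<Rightarrow> c (head G e)
      | None \<Rightarrow> c (block_source G X) - (\<Sum>e\<in>X. c (head G e)))" for X i
    have sum_d: "(\<Sum>i\<in>I X. d X i) = c (block_source G X)" if "X \<in> P" for X
    proof -
      have "(\<Sum>i\<in>Some ` X. d X i) = (\<Sum>e\<in>X. c (head G e))"
        by (subst sum.reindex) (simp_all add: d_def)
      moreover have "None \<notin> Some ` X" by auto
      ultimately show ?thesis using c that finite_blocks(2)[OF assms that]
        by (auto simp: I_def balanced_def d_def)
    qed
    \<comment> \<open>The \<open>0\<close> only keeps the set nonempty when there are no blocks.\<close>
    define M where "M = Max (insert 0 (\<Union>X\<in>P. d X ` I X))"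
    have "d X i \<le> M" if "X \<in> P" "i \<in> I X" for X i
      unfolding M_def using that finI finite_blocks(1)[OF assms] by (intro Max_ge) auto
    then have "\<forall>X\<in>P. \<exists>g. bij_betw (\<lambda>(i, k). g i k) (SIGMA i:I X. {d X i..}) {c (block_source G X)..}
        \<and> (\<forall>i\<in>I X. \<forall>k\<ge>M. g i k = int (card (I X)) * k + idx X i)"
      using exists_bij_with_linear_tail[OF finI neI idx, of _ "d _" M] sum_d by metis
    then obtain g where g: "\<And>X. X \<in> P \<Longrightarrow>
        bij_betw (\<lambda>(i, k). g X i k) (SIGMA i:I X. {d X i..}) {c (block_source G X)..}"
      and gM: "\<And>X i k. X \<in> P \<Longrightarrow> i \<in> I X \<Longrightarrow> M \<le> k \<Longrightarrow> g X i k = int (card (I X)) * k + idx X i"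
      by metis
    define g' where "g' e k = g (blk e) (Some e) k" for e k
    have "edge_maps G P \<Lambda> c g'"
      unfolding edge_maps_def
    proof (intro ballI conjI impI)
      fix X assume X: "X \<in> P"
      let ?S = "SIGMA e:X. {c (head G e)..}" and ?T = "SIGMA i:I X. {d X i..}"
      have emb: "(\<lambda>(e, k). (Some e, k)) ` ?S \<subseteq> ?T"
        by (auto simp: I_def d_def)
      have g': "(\<lambda>(e, k). g' e k) a = (\<lambda>(i, k). g X i k) ((\<lambda>(e, k). (Some e, k)) a)" if "a \<in> ?S" for a
        using that blk_eq[OF X] by (auto simp: g'_def)
      have inj: "inj_on (\<lambda>(i, k). g X i k) ?T" and im: "(\<lambda>(i, k). g X i k) ` ?T = {c (block_source G X)..}"
        using g[OF X] by (simp_all add: bij_betw_def)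
      have "inj_on (\<lambda>a. (\<lambda>(i, k). g X i k) ((\<lambda>(e, k). (Some e, k)) a)) ?S"
        using inj_on_subset[OF inj emb] by (auto simp: inj_on_def)
      then show "inj_on (\<lambda>(e, k). g' e k) ?S"
        by (rule inj_on_cong[THEN iffD1, rotated]) (use g' in simp)
      have im': "(\<lambda>(e, k). g' e k) ` ?S = (\<lambda>(i, k). g X i k) ` (\<lambda>(e, k). (Some e, k)) ` ?S"
        unfolding image_image by (rule image_cong[OF refl g'])
      show "(\<lambda>(e, k). g' e k) ` ?S \<subseteq> {c (block_source G X)..}"
        unfolding im' im[symmetric] by (rule image_mono[OF emb])
      assume "X \<in> \<Lambda>"
      then have "(\<lambda>(e, k). (Some e, k)) ` ?S = ?T"
        by (auto simp: I_def d_def image_iff)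
      then show "{c (block_source G X)..} \<subseteq> (\<lambda>(e, k). g' e k) ` ?S"
        by (simp add: im' im)
    qed
    moreover have "\<forall>e\<in>arcs G. \<forall>k\<ge>M. g' e k = int (card (I (blk e))) * k + idx (blk e) (Some e)"
      using blk gM by (simp add: g'_def I_def)
    ultimately show "\<exists>g M. edge_maps G P \<Lambda> c g \<and>
        (\<forall>e\<in>arcs G. \<forall>k\<ge>M. g e k = int (card (I (blk e))) * k + idx (blk e) (Some e))"
      by blast
  qed
qed

section \<open>Cohn-Leavitt algebras act by partial injections\<close>

definition partial_inv :: "('a \<rightharpoonup> 'b) \<Rightarrow> 'b \<rightharpoonup> 'a" where
  "partial_inv h t = (if \<exists>s. h s = Some t then Some (SOME s. h s = Some t) else None)"

lemma partial_inv_eq_Some_iff: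
  assumes "inj_on h (dom h)"
  shows "partial_inv h t = Some s \<longleftrightarrow> h s = Some t"
proof
  show "partial_inv h t = Some s \<Longrightarrow> h s = Some t"
    by (auto simp: partial_inv_def split: if_splits intro: someI)
  assume s: "h s = Some t"
  then have "h (SOME s. h s = Some t) = Some t" by (rule someI)
  with s assms have "(SOME s. h s = Some t) = s" by (auto simp: inj_on_def dom_def)
  with s show "partial_inv h t = Some s" by (auto simp: partial_inv_def)
qed

lemma inj_on_partial_inv:
  assumes "inj_on h (dom h)"
  shows "inj_on (partial_inv h) (dom (partial_inv h))"
proof (rule inj_onI)
  fix s t assume "s \<in> dom (partial_inv h)" "partial_inv h s = partial_inv h t"
  then obtain u where "partial_inv h s = Some u" "partial_inv h t = Some u" by fastforce
  then have "h u = Some s" "h u = Some t" by (simp_all add: partial_inv_eq_Some_iff[OF assms])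
  then show "s = t" by simp
qed

text \<open>A point where the inverses differ is the image, under one of the two maps, of a point where the maps differ.\<close>

lemma finite_partial_inv_diff:
  assumes "inj_on h (dom h)" "inj_on k (dom k)" "finite {s. h s \<noteq> k s}"
  shows "finite {t. partial_inv h t \<noteq> partial_inv k t}"
proof (rule finite_subset)
  let ?D = "{s. h s \<noteq> k s}"
  show "finite ((\<lambda>s. the (h s)) ` ?D \<union> (\<lambda>s. the (k s)) ` ?D)" using assms(3) by simp
  show "{t. partial_inv h t \<noteq> partial_inv k t} \<subseteq> (\<lambda>s. the (h s)) ` ?D \<union> (\<lambda>s. the (k s)) ` ?D"
  proof
    fix t assume t: "t \<in> {t. partial_inv h t \<noteq> partial_inv k t}"
    then obtain s where "partial_inv h t = Some s \<and> partial_inv k t \<noteq> Some s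
        \<or> partial_inv k t = Some s \<and> partial_inv h t \<noteq> Some s"
      by (cases "partial_inv h t"; cases "partial_inv k t") auto
    then show "t \<in> (\<lambda>s. the (h s)) ` ?D \<union> (\<lambda>s. the (k s)) ` ?D"
      unfolding partial_inv_eq_Some_iff[OF assms(1)] partial_inv_eq_Some_iff[OF assms(2)]
      by (auto intro!: image_eqI[of _ _ s])
  qed
qed

definition edge_act :: "('v, 'e) pre_digraph \<Rightarrow> ('v \<Rightarrow> int) \<Rightarrow> ('e \<Rightarrow> int \<Rightarrow> int) \<Rightarrow> 'e \<Rightarrow> 'v \<times> int \<rightharpoonup> 'v \<times> int" where
  "edge_act G c g e = (\<lambda>(w, k).
     if e \<in> arcs G \<and> w = head G e \<and> c w \<le> k then Some (tail G e, g e k) else None)"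

text \<open>The guards let letters that are not generators of the algebra act by the empty map, so every letter acts by a
  partial injection.\<close>

fun cl_act :: "('v, 'e) pre_digraph \<Rightarrow> ('v \<Rightarrow> int) \<Rightarrow> ('e \<Rightarrow> int \<Rightarrow> int) \<Rightarrow> ('v, 'e) cl_gen \<Rightarrow> 'v \<times> int \<rightharpoonup> 'v \<times> int" where
  "cl_act G c g (Vertex v) = (\<lambda>(w, k). if v \<in> verts G \<and> w = v \<and> c w \<le> k then Some (w, k) else None)"
| "cl_act G c g (Edge e) = edge_act G c g e"
| "cl_act G c g (Ghost e) = partial_inv (edge_act G c g e)"

text \<open>The basis of the module on which the algebra acts; the sum of the vertices acts as the projection onto it.\<close>

definition half_lines :: "('v, 'e) pre_digraph \<Rightarrow> ('v \<Rightarrow> int) \<Rightarrow> ('v \<times> int) set" where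
  "half_lines G c = (SIGMA v:verts G. {c v..})"

lemma rep_vtx_basis_vec:
  assumes "v \<in> verts G"
  shows "rep (cl_act G c g) (gen (Vertex v)) (basis_vec s)
    = (if s \<in> half_lines G c \<and> fst s = v then basis_vec s else 0)"
  using assms by (cases s) (auto simp: half_lines_def)

lemma rep_sum_vtx_basis_vec:
  assumes "finite (verts G)"
  shows "rep (cl_act G c g) (\<Sum>v\<in>verts G. gen (Vertex v)) (basis_vec s)
    = (if s \<in> half_lines G c then basis_vec s else 0)"
proof -
  have "rep (cl_act G c g) (\<Sum>v\<in>verts G. gen (Vertex v)) (basis_vec s)
     = (\<Sum>v\<in>verts G. if v = fst s then if s \<in> half_lines G c then basis_vec s else 0 else 0)"
    unfolding rep_simps by (rule sum.cong) (auto simp: rep_vtx_basis_vec simp del: rep_gen)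
  then show ?thesis using assms by (auto simp: half_lines_def)
qed

context
  fixes G :: "('v, 'e) pre_digraph" and P \<Lambda> :: "'e set set" and c :: "'v \<Rightarrow> int" and g :: "'e \<Rightarrow> int \<Rightarrow> int"
  assumes sep: "separated_graph G P" and sub: "\<Lambda> \<subseteq> P" and g: "edge_maps G P \<Lambda> c g"
begin

lemma edge_act_eq_Some_iff:
  "edge_act G c g e (w, k) = Some (w', k') \<longleftrightarrow>
     e \<in> arcs G \<and> w = head G e \<and> c w \<le> k \<and> w' = tail G e \<and> k' = g e k"
  by (auto simp: edge_act_def)

lemma edge_act_inj:
  assumes "X \<in> P" "e \<in> X" "f \<in> X" "edge_act G c g e s = Some u" "edge_act G c g f t = Some u"
  shows "e = f" "s = t"
proof -
  obtain w k w' k' where st: "s = (w, k)" "t = (w', k')" by (cases s; cases t) auto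
  obtain x l where u: "u = (x, l)" by force
  have *: "e \<in> arcs G" "w = head G e" "c w \<le> k" "l = g e k" "w' = head G f" "c w' \<le> k'" "l = g f k'"
    using assms(4,5) unfolding st u edge_act_eq_Some_iff by blast+
  have "(e, k) = (f, k')"
    by (rule inj_onD[of "\<lambda>(e, k). g e k" "SIGMA e:X. {c (head G e)..}"])
      (use g assms(1-3) * in \<open>auto simp: edge_maps_def\<close>)
  then show "e = f" "s = t" by (simp_all add: st *)
qed

lemma inj_on_edge_act: "inj_on (edge_act G c g e) (dom (edge_act G c g e))"
proof (rule inj_onI)
  fix s t assume "s \<in> dom (edge_act G c g e)" and eq: "edge_act G c g e s = edge_act G c g e t"
  then obtain u where u: "edge_act G c g e s = Some u" by fastforce
  then have "e \<in> arcs G" by (auto simp: edge_act_def split: prod.splits if_splits)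
  then obtain X where "X \<in> P" "e \<in> X" using separated_graph_block[OF sep] by blast
  then show "s = t" using edge_act_inj(2) u eq by metis
qed

lemma inj_on_cl_act: "inj_on (cl_act G c g x) (dom (cl_act G c g x))"
proof (cases x)
  case (Vertex v)
  then show ?thesis by (auto simp: inj_on_def dom_def split: if_splits)
qed (simp_all add: inj_on_edge_act inj_on_partial_inv)

lemma wf: "wf_digraph G" using sep by (simp add: separated_graph_def)

lemma edge_act_half_lines:
  assumes "edge_act G c g e s = Some t"
  shows "s \<in> half_lines G c" "t \<in> half_lines G c"
proof -
  obtain w k w' k' where st: "s = (w, k)" "t = (w', k')" by (cases s; cases t) auto
  have *: "e \<in> arcs G" "w = head G e" "c w \<le> k" "w' = tail G e" "k' = g e k"
    using assms unfolding st edge_act_eq_Some_iff by blast+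
  then show "s \<in> half_lines G c" using wf by (simp add: st half_lines_def wf_digraph.head_in_verts)
  obtain X where X: "X \<in> P" "e \<in> X" using separated_graph_block[OF sep *(1)] by blast
  have "(\<lambda>(e, k). g e k) ` (SIGMA e:X. {c (head G e)..}) \<subseteq> {c (block_source G X)..}"
    using g X(1) unfolding edge_maps_def by blast
  then have "(\<lambda>(e, k). g e k) ` (SIGMA e:X. {c (head G e)..}) \<subseteq> {c (tail G e)..}"
    by (simp only: block_source(1)[OF sep X])
  moreover have "(e, k) \<in> (SIGMA e:X. {c (head G e)..})" using X * by simp
  ultimately have "g e k \<in> {c (tail G e)..}" by force
  then show "t \<in> half_lines G c"
    using * wf by (simp add: st half_lines_def wf_digraph.tail_in_verts)
qed

lemma cl_act_half_lines:
  assumes "cl_act G c g x s = Some t"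
  shows "t \<in> half_lines G c"
proof (cases x)
  case (Vertex v)
  then show ?thesis using assms by (auto simp: half_lines_def split: prod.splits if_splits)
next
  case (Edge e)
  then show ?thesis using assms edge_act_half_lines by simp
next
  case (Ghost e)
  then show ?thesis using assms edge_act_half_lines by (simp add: partial_inv_eq_Some_iff[OF inj_on_edge_act])
qed

lemma edge_act_covers:
  assumes "X \<in> \<Lambda>" "c (block_source G X) \<le> k"
  shows "\<exists>e\<in>X. \<exists>s. edge_act G c g e s = Some (block_source G X, k)"
proof -
  have X: "X \<in> P" using assms sub by blast
  have "k \<in> (\<lambda>(e, k). g e k) ` (SIGMA e:X. {c (head G e)..})"
    using g X assms by (auto simp: edge_maps_def)
  then obtain e l where "e \<in> X" "c (head G e) \<le> l" "k = g e l" by auto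
  then have "e \<in> X" "edge_act G c g e (head G e, l) = Some (block_source G X, k)"
    using block_source[OF sep X] by (auto simp: edge_act_eq_Some_iff)
  then show ?thesis by blast
qed

lemma rep_edg_gho_basis_vec:
  "rep (cl_act G c g) (gen (Edge e) * gen (Ghost e)) (basis_vec t)
    = (if \<exists>s. edge_act G c g e s = Some t then basis_vec t else 0)"
proof (cases "partial_inv (edge_act G c g e) t")
  case None
  then show ?thesis by (auto simp: rep_mult pmp.linear_0[OF linear_pmap_op] partial_inv_def split: if_splits)
next
  case (Some s)
  then have "edge_act G c g e s = Some t" by (simp add: partial_inv_eq_Some_iff[OF inj_on_edge_act])
  then have "\<exists>s. edge_act G c g e s = Some t" by blast
  with Some \<open>edge_act G c g e s = Some t\<close> show ?thesis by (simp add: rep_mult)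
qed

lemma rep_cl_relations:
  fixes r :: "(('v, 'e) cl_gen, 'k::field) ncpoly"
  assumes "fin_digraph G" "r \<in> cl_relations G P \<Lambda>"
  shows "rep (cl_act G c g) r x = 0"
proof (rule rep_eq_0_if_basis_vec)
  fix s :: "'v \<times> int"
  let ?rep = "rep (cl_act G c g) :: (('v, 'e) cl_gen, 'k) ncpoly \<Rightarrow> _"
  note inv = partial_inv_eq_Some_iff[OF inj_on_edge_act]
  note zero = pmp.linear_0[OF linear_rep_right] pmp.linear_0[OF linear_pmap_op]
  show "?rep r (basis_vec s) = 0"
    using assms(2)
  proof cases
    case (V v w)
    then show ?thesis by (simp add: rep_simps rep_mult rep_vtx_basis_vec del: rep_gen)
  next
    case (E1_source e)
    have "fst t = tail G e \<and> t \<in> half_lines G c" if "edge_act G c g e s = Some t" for t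
      using that edge_act_half_lines[OF that] by (cases s; cases t) (auto simp: edge_act_eq_Some_iff)
    moreover have "tail G e \<in> verts G" using E1_source wf by (simp add: wf_digraph.tail_in_verts)
    ultimately show ?thesis using E1_source
      by (cases "edge_act G c g e s")
        (simp_all add: rep_simps rep_mult zero rep_gen[of _ "Edge _"] rep_vtx_basis_vec del: rep_gen)
  next
    case (E1_target e)
    have "fst s = head G e \<and> s \<in> half_lines G c" if "edge_act G c g e s = Some t" for t
      using that edge_act_half_lines[OF that] by (cases s; cases t) (auto simp: edge_act_eq_Some_iff)
    moreover have "head G e \<in> verts G" using E1_target wf by (simp add: wf_digraph.head_in_verts)
    ultimately show ?thesis using E1_target
      by (cases "edge_act G c g e s")
        (simp_all add: rep_simps rep_mult zero rep_gen[of _ "Edge _"] rep_vtx_basis_vec del: rep_gen)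
  next
    case (E2_target e)
    have "fst t = head G e \<and> t \<in> half_lines G c" if "partial_inv (edge_act G c g e) s = Some t" for t
      using that edge_act_half_lines[of e t s] by (cases s; cases t) (auto simp: edge_act_eq_Some_iff inv)
    moreover have "head G e \<in> verts G" using E2_target wf by (simp add: wf_digraph.head_in_verts)
    ultimately show ?thesis using E2_target
      by (cases "partial_inv (edge_act G c g e) s")
        (simp_all add: rep_simps rep_mult zero rep_gen[of _ "Ghost _"] rep_vtx_basis_vec del: rep_gen)
  next
    case (E2_source e)
    have "fst s = tail G e \<and> s \<in> half_lines G c" if "partial_inv (edge_act G c g e) s = Some t" for t
      using that edge_act_half_lines[of e t s] by (cases s; cases t) (auto simp: edge_act_eq_Some_iff inv)
    moreover have "tail G e \<in> verts G" using E2_source wf by (simp add: wf_digraph.tail_in_verts)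
    ultimately show ?thesis using E2_source
      by (cases "partial_inv (edge_act G c g e) s")
        (simp_all add: rep_simps rep_mult zero rep_gen[of _ "Ghost _"] rep_vtx_basis_vec del: rep_gen)
  next
    case (CK1 X e f)
    have f: "f \<in> arcs G" "head G f \<in> verts G"
      using block_source(2)[OF sep CK1(2)] CK1 wf by (auto simp: wf_digraph.head_in_verts)
    show ?thesis
    proof (cases "edge_act G c g f s")
      case None
      then have "\<not> (s \<in> half_lines G c \<and> fst s = head G f)"
        using f by (cases s) (auto simp: edge_act_def half_lines_def split: if_splits)
      then have "?rep (gen (Vertex (head G f))) (basis_vec s) = 0"
        by (auto simp: rep_vtx_basis_vec[OF f(2)] simp del: rep_gen)
      moreover have "?rep (gen (Ghost e) * gen (Edge f)) (basis_vec s) = 0"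
        using None by (simp add: rep_mult zero)
      ultimately show ?thesis by (cases "e = f") (simp_all add: CK1 rep_simps del: rep_gen)
    next
      case (Some t)
      have "fst s = head G f" "s \<in> half_lines G c"
        using Some edge_act_half_lines[OF Some] by (cases s; cases t; auto simp: edge_act_eq_Some_iff)+
      then have vert: "?rep (gen (Vertex (head G f))) (basis_vec s) = basis_vec s"
        by (simp add: rep_vtx_basis_vec[OF f(2)] del: rep_gen)
      have mult: "?rep (gen (Ghost e) * gen (Edge f)) (basis_vec s)
          = (case partial_inv (edge_act G c g e) t of None \<Rightarrow> 0 | Some t \<Rightarrow> basis_vec t)"
        by (simp add: rep_mult Some)
      show ?thesis
      proof (cases "e = f")
        case True
        then have "partial_inv (edge_act G c g e) t = Some s" using Some by (simp add: inv)
        then show ?thesis using True vert mult by (simp add: CK1 rep_simps del: rep_gen)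
      next
        case False
        have "partial_inv (edge_act G c g e) t = None"
        proof (cases "partial_inv (edge_act G c g e) t")
          case (Some s')
          then have "edge_act G c g e s' = Some t" by (simp add: inv)
          then show ?thesis using edge_act_inj(1)[OF CK1(2-4) _ \<open>edge_act G c g f s = Some t\<close>] False by blast
        qed
        then show ?thesis using False mult by (simp add: CK1 rep_simps del: rep_gen)
      qed
    qed
  next
    case (CK2 X)
    then have X: "X \<in> P" using sub by blast
    obtain e where e: "e \<in> X" using separated_graph_block_nonempty[OF sep X] .
    have src: "block_source G X \<in> verts G"
      using block_source[OF sep X e] wf by (simp add: wf_digraph.tail_in_verts)
    have finX: "finite X" by (rule finite_blocks(2)[OF assms(1) sep X])
    have "(\<Sum>e\<in>X. ?rep (gen (Edge e) * gen (Ghost e)) (basis_vec s))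
        = ?rep (gen (Vertex (block_source G X))) (basis_vec s)"
    proof (cases "s \<in> half_lines G c \<and> fst s = block_source G X")
      case True
      then obtain k where s: "s = (block_source G X, k)" "c (block_source G X) \<le> k"
        by (cases s) (auto simp: half_lines_def)
      obtain f t where f: "f \<in> X" "edge_act G c g f t = Some s"
        using edge_act_covers[OF CK2(2) s(2)] s(1) by blast
      have "(\<exists>t. edge_act G c g e t = Some s) \<longleftrightarrow> e = f" if "e \<in> X" for e
        using edge_act_inj(1)[OF X that f(1) _ f(2)] f by blast
      then have "(\<Sum>e\<in>X. ?rep (gen (Edge e) * gen (Ghost e)) (basis_vec s))
          = (\<Sum>e\<in>X. if e = f then basis_vec s else 0)"
        by (intro sum.cong) (simp_all add: rep_edg_gho_basis_vec)
      then show ?thesis using True f finX by (simp add: rep_vtx_basis_vec[OF src] del: rep_gen)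
    next
      case False
      have "\<not> (\<exists>t. edge_act G c g e t = Some s)" if e: "e \<in> X" for e
      proof
        assume "\<exists>t. edge_act G c g e t = Some s"
        then obtain t where t: "edge_act G c g e t = Some s" by blast
        then have "fst s = tail G e" by (cases s; cases t) (auto simp: edge_act_eq_Some_iff)
        with t False show False
          using edge_act_half_lines(2) block_source(1)[OF sep X e] by simp
      qed
      then have "(\<Sum>e\<in>X. ?rep (gen (Edge e) * gen (Ghost e)) (basis_vec s)) = 0"
        by (intro sum.neutral) (simp add: rep_edg_gho_basis_vec)
      then show ?thesis using False by (auto simp: rep_vtx_basis_vec[OF src] simp del: rep_gen)
    qed
    then show ?thesis by (simp add: CK2 rep_simps del: rep_gen)
  qed
qed

end

text \<open>Over each vertex the two actions can differ only below \<open>M\<close> or where just one of the two half-lines has begun, and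
  neither action moves anything before both half-lines.\<close>

lemma finite_cl_act_diff:
  assumes sep: "separated_graph G P" and sub: "\<Lambda> \<subseteq> P"
    and g: "edge_maps G P \<Lambda> c g" "edge_maps G P \<Lambda> c' g'"
    and M: "\<And>e k. e \<in> arcs G \<Longrightarrow> M \<le> k \<Longrightarrow> g e k = g' e k"
  shows "finite {s. cl_act G c g x s \<noteq> cl_act G c' g' x s}"
proof -
  have edge: "finite {s. edge_act G c g e s \<noteq> edge_act G c' g' e s}" for e
  proof (rule finite_subset)
    let ?w = "head G e"
    let ?N = "max M (max (c ?w) (c' ?w))"
    show "finite ({?w} \<times> {min (c ?w) (c' ?w)..?N})" by simp
    show "{s. edge_act G c g e s \<noteq> edge_act G c' g' e s} \<subseteq> {?w} \<times> {min (c ?w) (c' ?w)..?N}"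
    proof
      fix s assume s: "s \<in> {s. edge_act G c g e s \<noteq> edge_act G c' g' e s}"
      obtain w k where wk: "s = (w, k)" by force
      show "s \<in> {?w} \<times> {min (c ?w) (c' ?w)..?N}"
        using s M[of e k] by (fastforce simp: wk edge_act_def min_def max_def split: if_splits)
    qed
  qed
  show ?thesis
  proof (cases x)
    case (Vertex v)
    have "{s. cl_act G c g x s \<noteq> cl_act G c' g' x s} \<subseteq> {v} \<times> {min (c v) (c' v)..max (c v) (c' v)}"
      by (auto simp: Vertex split: if_splits)
    then show ?thesis by (rule finite_subset) simp
  next
    case (Edge e)
    then show ?thesis using edge by simp
  next
    case (Ghost e)
    then show ?thesis
      using finite_partial_inv_diff[OF inj_on_edge_act[OF sep sub g(1)] inj_on_edge_act[OF sep sub g(2)] edge]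
      by simp
  qed
qed

lemma rel_dim_half_lines:
  assumes "finite (verts G)"
  shows "rel_dim (half_lines G c) (half_lines G c') = (\<Sum>v\<in>verts G. c' v - c v)"
    "finite (half_lines G c - half_lines G c')"
proof -
  have eq: "half_lines G c - half_lines G c' = (SIGMA v:verts G. {c v..<c' v})" for c c'
    by (auto simp: half_lines_def)
  show "finite (half_lines G c - half_lines G c')" using assms by (simp add: eq)
  have "rel_dim (half_lines G c) (half_lines G c')
      = (\<Sum>v\<in>verts G. int (nat (c' v - c v)) - int (nat (c v - c' v)))"
    using assms by (simp add: rel_dim_def eq card_SigmaI sum_subtractf)
  also have "\<dots> = (\<Sum>v\<in>verts G. c' v - c v)" by (rule sum.cong) auto
  finally show "rel_dim (half_lines G c) (half_lines G c') = (\<Sum>v\<in>verts G. c' v - c v)" .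
qed

text \<open>The actions for \<open>c = 0\<close> and \<open>c = f\<close> have relative dimension \<open>\<Sum>v. f v\<close>, which can be cancelled.\<close>

lemma cl_matrix_size_eq:
  fixes G :: "('v, 'e) pre_digraph" and A B :: "nat \<Rightarrow> nat \<Rightarrow> (('v, 'e) cl_gen, 'k::field) ncpoly"
  assumes fin: "fin_digraph G" and sep: "separated_graph G P" and sub: "\<Lambda> \<subseteq> P"
    and f: "balanced G \<Lambda> f" "(\<Sum>v\<in>verts G. f v) \<noteq> 0"
    and A: "\<And>i j. i < n \<Longrightarrow> j < m \<Longrightarrow> A i j \<in> carrier (free_algebra (cl_gens G))"
    and B: "\<And>i j. j < m \<Longrightarrow> i < n \<Longrightarrow> B j i \<in> carrier (free_algebra (cl_gens G))"
    and AB: "\<And>i k. i < n \<Longrightarrow> k < n \<Longrightarrow>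
      (\<Sum>j<m. A i j * B j k) - (if i = k then \<Sum>v\<in>verts G. gen (Vertex v) else 0) \<in> cl_ideal G P \<Lambda>"
    and BA: "\<And>j k. j < m \<Longrightarrow> k < m \<Longrightarrow>
      (\<Sum>i<n. B j i * A i k) - (if j = k then \<Sum>v\<in>verts G. gen (Vertex v) else 0) \<in> cl_ideal G P \<Lambda>"
  shows "m = n"
proof -
  have finV: "finite (verts G)" using fin by (rule fin_digraph.finite_verts)
  have "balanced G \<Lambda> (\<lambda>_. 0)" by (simp add: balanced_def)
  with f(1) obtain r j :: "'e \<Rightarrow> int" and c :: "bool \<Rightarrow> 'v \<Rightarrow> int" and g M where
    c: "c True = (\<lambda>_. 0)" "c False = f"
    and g: "\<And>b. edge_maps G P \<Lambda> (c b) (g b)"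
    and M: "\<And>b e k. e \<in> arcs G \<Longrightarrow> M b \<le> k \<Longrightarrow> g b e k = r e * k + j e"
  proof -
    obtain r j :: "'e \<Rightarrow> int" where rj: "\<And>c. balanced G \<Lambda> c \<Longrightarrow> \<exists>g M. edge_maps G P \<Lambda> c g \<and>
       (\<forall>e\<in>arcs G. \<forall>k\<ge>M. g e k = r e * k + j e)"
      using exists_edge_maps[OF fin sep, of \<Lambda>] by blast
    define c where "c b = (if b then \<lambda>_. 0 else f)" for b :: bool
    have "balanced G \<Lambda> (c b)" for b using f(1) by (simp add: c_def balanced_def)
    then have "\<forall>b. \<exists>g M. edge_maps G P \<Lambda> (c b) g \<and> (\<forall>e\<in>arcs G. \<forall>k\<ge>M. g e k = r e * k + j e)"
      using rj by blast
    then obtain g M where "\<And>b. edge_maps G P \<Lambda> (c b) (g b) \<and>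
        (\<forall>e\<in>arcs G. \<forall>k\<ge>M b. g b e k = r e * k + j e)" by metis
    then show thesis by (intro that[of c g M r j]) (auto simp: c_def)
  qed
  define act where "act b = cl_act G (c b) (g b)" for b
  let ?u = "\<Sum>v\<in>verts G. gen (Vertex v) :: (('v, 'e) cl_gen, 'k) ncpoly"
  have ideal: "rep (act b) p x = (if i = k then rep (act b) ?u x else 0)"
    if "p - (if i = k then ?u else 0) \<in> cl_ideal G P \<Lambda>" for b p x and i k :: nat
  proof -
    have "rep (act b) (p - (if i = k then ?u else 0)) x = 0"
      using that unfolding cl_ideal_def act_def
      by (rule rep_algebra_ideal[rotated]) (rule rep_cl_relations[OF sep sub g fin])
    then show ?thesis by (auto simp: rep_simps split: if_splits)
  qed
  have "int m * rel_dim (half_lines G (c True)) (half_lines G (c False))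
      = int n * rel_dim (half_lines G (c True)) (half_lines G (c False))"
  proof (rule matrix_size_eq_of_almost_equal_reps[where act = act and u = ?u and A = A and B = B
        and X = "cl_gens G" and S = "\<lambda>b. half_lines G (c b)"])
    show "finite {s. act True a s \<noteq> act False a s}" for a
      unfolding act_def
      by (rule finite_cl_act_diff[OF sep sub g g, where M = "max (M True) (M False)"]) (simp add: M)
    show "rep (act b) (\<Sum>j<m. A i j * B j k) x = (if i = k then rep (act b) ?u x else 0)"
      if "i < n" "k < n" for i k x b
      by (rule ideal[OF AB[OF that]])
    show "rep (act b) (\<Sum>i<n. B j i * A i k) x = (if j = k then rep (act b) ?u x else 0)"
      if "j < m" "k < m" for j k x b
      by (rule ideal[OF BA[OF that]])
  qed (use A B in \<open>auto simp: act_def inj_on_cl_act[OF sep sub g] cl_act_half_lines[OF sep sub g]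
      rel_dim_half_lines(2)[OF finV] rep_sum_vtx_basis_vec[OF finV]\<close>)
  then show ?thesis using f(2) by (simp add: rel_dim_half_lines(1)[OF finV] c)
qed

section \<open>Isomorphic free modules and invertible matrices\<close>

lemma (in ring) free_rmodule_iso_sym:
  assumes iso: "free_rmodule_iso R m n \<phi>"
  shows "free_rmodule_iso R n m (inv_into (free_rmodule R m) \<phi>)"
proof -
  let ?M = "free_rmodule R m" and ?N = "free_rmodule R n"
  let ?\<psi> = "inv_into ?M \<phi>"
  have bij: "bij_betw \<phi> ?M ?N" using iso by (simp add: free_rmodule_iso_def)
  have \<psi>: "?\<psi> y \<in> ?M" "\<phi> (?\<psi> y) = y" if "y \<in> ?N" for y
    using that bij by (auto simp: bij_betw_def inv_into_into f_inv_into_f)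
  have \<psi>_eq: "?\<psi> y = x" if "x \<in> ?M" "\<phi> x = y" for x y
    using that bij by (auto simp: bij_betw_def inv_into_f_f)
  show ?thesis
    unfolding free_rmodule_iso_def
  proof (intro conjI ballI)
    show "bij_betw ?\<psi> ?N ?M" by (rule bij_betw_inv_into[OF bij])
    fix x y assume xy: "x \<in> ?N" "y \<in> ?N"
    have "free_rmodule_add R m (?\<psi> x) (?\<psi> y) \<in> ?M"
      using \<psi>(1)[OF xy(1)] \<psi>(1)[OF xy(2)] by (auto simp: free_rmodule_add_def free_rmodule_def)
    then show "?\<psi> (free_rmodule_add R n x y) = free_rmodule_add R m (?\<psi> x) (?\<psi> y)"
      using iso \<psi> xy by (intro \<psi>_eq) (auto simp: free_rmodule_iso_def)
  next
    fix x r assume xr: "x \<in> ?N" "r \<in> carrier R"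
    have "free_rmodule_act R m (?\<psi> x) r \<in> ?M"
      using \<psi>(1)[OF xr(1)] xr by (auto simp: free_rmodule_act_def free_rmodule_def)
    then show "?\<psi> (free_rmodule_act R n x r) = free_rmodule_act R m (?\<psi> x) r"
      using iso \<psi> xr by (intro \<psi>_eq) (auto simp: free_rmodule_iso_def)
  qed
qed

definition unit_vec :: "('a, 'b) ring_scheme \<Rightarrow> nat \<Rightarrow> nat \<Rightarrow> (nat \<Rightarrow> 'a)" where
  "unit_vec R m j = (\<lambda>i\<in>{..<m}. if i = j then \<one>\<^bsub>R\<^esub> else \<zero>\<^bsub>R\<^esub>)"

text \<open>A vector is the sum of its coordinates times unit vectors; the sum is built up one coordinate at a time.\<close>

lemma (in ring) free_rmodule_iso_matrix:
  assumes iso: "free_rmodule_iso R m n \<phi>"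
    and x: "x \<in> free_rmodule R m" and i: "i < n"
  shows "\<phi> x i = (\<Oplus>\<^bsub>R\<^esub>j\<in>{..<m}. \<phi> (unit_vec R m j) i \<otimes>\<^bsub>R\<^esub> x j)"
proof -
  let ?M = "free_rmodule R m"
  have \<phi>M: "\<phi> y \<in> free_rmodule R n" if "y \<in> ?M" for y
    using that iso by (auto simp: free_rmodule_iso_def bij_betw_def)
  have \<phi>i: "\<phi> y i \<in> carrier R" if "y \<in> ?M" for y
    using \<phi>M[OF that] i by (auto simp: free_rmodule_def)
  have add: "\<phi> (free_rmodule_add R m y z) i = \<phi> y i \<oplus> \<phi> z i" if "y \<in> ?M" "z \<in> ?M" for y z
    using iso that i by (auto simp: free_rmodule_iso_def free_rmodule_add_def)
  have act: "\<phi> (free_rmodule_act R m y r) i = \<phi> y i \<otimes> r" if "y \<in> ?M" "r \<in> carrier R" for y r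
    using iso that i by (auto simp: free_rmodule_iso_def free_rmodule_act_def)
  have e: "unit_vec R m j \<in> ?M" for j by (auto simp: unit_vec_def free_rmodule_def)
  have xc: "x j \<in> carrier R" if "j < m" for j using x that by (auto simp: free_rmodule_def)
  define t where "t k = (\<lambda>j\<in>{..<m}. if j < k then x j else \<zero>)" for k
  have t: "t k \<in> ?M" for k using xc by (auto simp: t_def free_rmodule_def)
  have "k \<le> m \<Longrightarrow> \<phi> (t k) i = (\<Oplus>j\<in>{..<k}. \<phi> (unit_vec R m j) i \<otimes> x j)" for k
  proof (induction k)
    case 0
    have "free_rmodule_add R m (t 0) (t 0) = t 0"
      by (auto simp: t_def free_rmodule_add_def fun_eq_iff)
    then have "\<phi> (t 0) i \<oplus> \<phi> (t 0) i = \<phi> (t 0) i" using add[OF t t, of 0 0] by simp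
    then have "\<phi> (t 0) i = \<zero>" using \<phi>i[OF t, of 0] by (simp add: add.l_cancel_one')
    then show ?case by simp
  next
    case (Suc k)
    have "t (Suc k) = free_rmodule_add R m (t k) (free_rmodule_act R m (unit_vec R m k) (x k))"
      using Suc.prems xc
      by (auto simp: t_def free_rmodule_add_def free_rmodule_act_def unit_vec_def fun_eq_iff less_Suc_eq)
    moreover have "free_rmodule_act R m (unit_vec R m k) (x k) \<in> ?M"
      using e[of k] xc[of k] Suc.prems by (auto simp: free_rmodule_act_def free_rmodule_def)
    ultimately have "\<phi> (t (Suc k)) i = \<phi> (t k) i \<oplus> \<phi> (unit_vec R m k) i \<otimes> x k"
      using add[OF t] act[OF e] xc Suc.prems by simp
    also have "\<dots> = (\<Oplus>j\<in>{..<Suc k}. \<phi> (unit_vec R m j) i \<otimes> x j)"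
    proof -
      have "(\<Oplus>j\<in>insert k {..<k}. \<phi> (unit_vec R m j) i \<otimes> x j)
          = \<phi> (unit_vec R m k) i \<otimes> x k \<oplus> (\<Oplus>j\<in>{..<k}. \<phi> (unit_vec R m j) i \<otimes> x j)"
        using Suc.prems \<phi>i[OF e] xc by (intro finsum_insert) auto
      moreover have "(\<Oplus>j\<in>{..<k}. \<phi> (unit_vec R m j) i \<otimes> x j) \<in> carrier R"
        using Suc.prems \<phi>i[OF e] xc by (intro finsum_closed) auto
      ultimately show ?thesis using Suc \<phi>i[OF e] xc by (simp add: lessThan_Suc a_comm)
    qed
    finally show ?case .
  qed
  from this[of m] have "\<phi> (t m) i = (\<Oplus>j\<in>{..<m}. \<phi> (unit_vec R m j) i \<otimes> x j)" by simp
  moreover have "t m = x" using x by (auto simp: t_def free_rmodule_def PiE_def extensional_def fun_eq_iff)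
  ultimately show ?thesis by simp
qed

lemma (in ring) free_rmodule_iso_imp_invertible_matrix:
  assumes iso: "free_rmodule_iso R m n \<phi>"
  obtains A B where
    "\<And>i j. i < n \<Longrightarrow> j < m \<Longrightarrow> A i j \<in> carrier R" "\<And>i j. j < m \<Longrightarrow> i < n \<Longrightarrow> B j i \<in> carrier R"
    "\<And>i k. i < n \<Longrightarrow> k < n \<Longrightarrow> (\<Oplus>\<^bsub>R\<^esub>j\<in>{..<m}. A i j \<otimes>\<^bsub>R\<^esub> B j k) = (if i = k then \<one>\<^bsub>R\<^esub> else \<zero>\<^bsub>R\<^esub>)"
    "\<And>j k. j < m \<Longrightarrow> k < m \<Longrightarrow> (\<Oplus>\<^bsub>R\<^esub>i\<in>{..<n}. B j i \<otimes>\<^bsub>R\<^esub> A i k) = (if j = k then \<one>\<^bsub>R\<^esub> else \<zero>\<^bsub>R\<^esub>)"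
proof -
  define \<psi> where "\<psi> = inv_into (free_rmodule R m) \<phi>"
  have iso': "free_rmodule_iso R n m \<psi>" unfolding \<psi>_def by (rule free_rmodule_iso_sym[OF iso])
  have bij: "bij_betw \<phi> (free_rmodule R m) (free_rmodule R n)"
    using iso by (simp add: free_rmodule_iso_def)
  have e: "unit_vec R k j \<in> free_rmodule R k" for k j by (auto simp: unit_vec_def free_rmodule_def)
  have \<phi>e: "\<phi> (unit_vec R m j) \<in> free_rmodule R n" for j
    using bij e by (auto simp: bij_betw_def)
  have \<psi>e: "\<psi> (unit_vec R n j) \<in> free_rmodule R m" for j
    using iso' e by (auto simp: free_rmodule_iso_def bij_betw_def)
  show thesis
  proof (rule that[of "\<lambda>i j. \<phi> (unit_vec R m j) i" "\<lambda>j i. \<psi> (unit_vec R n i) j"])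
    show "\<phi> (unit_vec R m j) i \<in> carrier R" if "i < n" for i j
      using \<phi>e[of j] that by (auto simp: free_rmodule_def)
    show "\<psi> (unit_vec R n i) j \<in> carrier R" if "j < m" for i j
      using \<psi>e[of i] that by (auto simp: free_rmodule_def)
    show "(\<Oplus>\<^bsub>R\<^esub>j\<in>{..<m}. \<phi> (unit_vec R m j) i \<otimes> \<psi> (unit_vec R n k) j) = (if i = k then \<one> else \<zero>)"
      if "i < n" "k < n" for i k
    proof -
      have "\<phi> (\<psi> (unit_vec R n k)) = unit_vec R n k"
        using bij e unfolding \<psi>_def by (auto simp: bij_betw_def f_inv_into_f)
      then show ?thesis
        using free_rmodule_iso_matrix[OF iso \<psi>e that(1), of k] that by (simp add: unit_vec_def)
    qed
    show "(\<Oplus>\<^bsub>R\<^esub>i\<in>{..<n}. \<psi> (unit_vec R n i) j \<otimes> \<phi> (unit_vec R m k) i) = (if j = k then \<one> else \<zero>)"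
      if "j < m" "k < m" for j k
    proof -
      have "\<psi> (\<phi> (unit_vec R m k)) = unit_vec R m k"
        using bij e unfolding \<psi>_def by (auto simp: bij_betw_def inv_into_f_f)
      then show ?thesis
        using free_rmodule_iso_matrix[OF iso' \<phi>e that(1), of k] that by (simp add: unit_vec_def)
    qed
  qed
qed

section \<open>Residue classes in a Cohn-Leavitt algebra\<close>

definition cl_class ::
    "('v, 'e) pre_digraph \<Rightarrow> 'e set set \<Rightarrow> 'e set set \<Rightarrow> (('v, 'e) cl_gen, 'k::field) ncpoly \<Rightarrow> (('v, 'e) cl_gen, 'k) ncpoly set" where
  "cl_class G P \<Lambda> p = cl_ideal G P \<Lambda> +>\<^bsub>free_algebra (cl_gens G)\<^esub> p"

lemma carrier_cl:
  "carrier (CL_algebra G P \<Lambda>) = cl_class G P \<Lambda> ` carrier (free_algebra (cl_gens G))"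
  by (auto simp: cl_class_def CL_algebra_def FactRing_def A_RCOSETS_def')

lemma add_cl: "cl_class G P \<Lambda> p \<oplus>\<^bsub>CL_algebra G P \<Lambda>\<^esub> cl_class G P \<Lambda> q = cl_class G P \<Lambda> (p + q)"
  by (simp add: cl_class_def CL_algebra_def FactRing_def cl_ideal_def coset_add)

lemma one_cl: "\<one>\<^bsub>CL_algebra G P \<Lambda>\<^esub> = cl_class G P \<Lambda> (\<Sum>v\<in>verts G. gen (Vertex v))"
  by (simp add: cl_class_def CL_algebra_def)

lemma zero_cl: "\<zero>\<^bsub>CL_algebra G P \<Lambda>\<^esub> = cl_class G P \<Lambda> 0"
  by (auto simp: cl_class_def CL_algebra_def FactRing_def cl_ideal_def coset_iff)

lemma cl_class_eq_iff: "cl_class G P \<Lambda> p = cl_class G P \<Lambda> q \<longleftrightarrow> p - q \<in> cl_ideal G P \<Lambda>"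
  by (simp add: cl_class_def cl_ideal_def coset_eq_iff)

context
  fixes G :: "('v, 'e) pre_digraph" and P \<Lambda> :: "'e set set"
  assumes fin: "fin_digraph G" and sep: "separated_graph G P" and sub: "\<Lambda> \<subseteq> P"
begin

private abbreviation (input) "F \<equiv> carrier (free_algebra (cl_gens G)) :: (('v, 'e) cl_gen, 'k::field) ncpoly set"
private abbreviation (input) "cls \<equiv> cl_class G P \<Lambda> :: (('v, 'e) cl_gen, 'k::field) ncpoly \<Rightarrow> _"
private abbreviation (input) "L \<equiv> CL_algebra G P \<Lambda> :: ('v, 'e, 'k::field) cl_ring"

lemma mult_cl:
  fixes p q :: "(('v, 'e) cl_gen, 'k::field) ncpoly"
  assumes "p \<in> F" "q \<in> F"
  shows "cls p \<otimes>\<^bsub>L\<^esub> cls q = cls (p * q)"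
  using assms cl_relations_subset[OF sep sub, where 'k = 'k]
  by (simp add: cl_class_def CL_algebra_def FactRing_def cl_ideal_def coset_mult)

lemma ring_cl: "ring L" by (rule ring_CL_algebra[OF fin sep sub])

lemma finsum_cl:
  fixes p :: "'i \<Rightarrow> (('v, 'e) cl_gen, 'k::field) ncpoly"
  assumes "finite I" "\<And>i. i \<in> I \<Longrightarrow> p i \<in> F"
  shows "(\<Oplus>\<^bsub>L\<^esub>i\<in>I. cls (p i)) = cls (\<Sum>i\<in>I. p i)"
proof -
  interpret ring "L :: ('v, 'e, 'k) cl_ring" by (rule ring_cl)
  show ?thesis using assms
  proof (induction I)
    case empty
    show ?case by (simp add: zero_cl)
  next
    case (insert i I)
    have "(\<Oplus>\<^bsub>L\<^esub>i\<in>insert i I. cls (p i)) = cls (p i) \<oplus>\<^bsub>L\<^esub> (\<Oplus>\<^bsub>L\<^esub>i\<in>I. cls (p i))"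
      using insert by (intro finsum_insert) (auto simp: carrier_cl)
    then show ?case using insert by (simp add: add_cl)
  qed
qed

lemma IBN_of_balanced:
  assumes f: "balanced G \<Lambda> f" "(\<Sum>v\<in>verts G. f v) \<noteq> 0"
  shows "IBN (L :: ('v, 'e, 'k::field) cl_ring)"
  unfolding IBN_def
proof (intro allI impI notI)
  fix m n :: nat assume "m \<noteq> n" "\<exists>\<phi>. free_rmodule_iso (L :: ('v, 'e, 'k) cl_ring) m n \<phi>"
  then obtain \<phi> where \<phi>: "free_rmodule_iso (L :: ('v, 'e, 'k) cl_ring) m n \<phi>" by blast
  obtain A B :: "nat \<Rightarrow> nat \<Rightarrow> (('v, 'e) cl_gen, 'k) ncpoly set" where
    A: "\<And>i j. i < n \<Longrightarrow> j < m \<Longrightarrow> A i j \<in> carrier L"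
    and B: "\<And>i j. j < m \<Longrightarrow> i < n \<Longrightarrow> B j i \<in> carrier L"
    and AB: "\<And>i k. i < n \<Longrightarrow> k < n \<Longrightarrow> (\<Oplus>\<^bsub>L\<^esub>j\<in>{..<m}. A i j \<otimes>\<^bsub>L\<^esub> B j k) = (if i = k then \<one>\<^bsub>L\<^esub> else \<zero>\<^bsub>L\<^esub>)"
    and BA: "\<And>j k. j < m \<Longrightarrow> k < m \<Longrightarrow> (\<Oplus>\<^bsub>L\<^esub>i\<in>{..<n}. B j i \<otimes>\<^bsub>L\<^esub> A i k) = (if j = k then \<one>\<^bsub>L\<^esub> else \<zero>\<^bsub>L\<^esub>)"
    using ring.free_rmodule_iso_imp_invertible_matrix[OF ring_cl \<phi>] by blast
  have "\<forall>i j. \<exists>p::(('v, 'e) cl_gen, 'k) ncpoly. i < n \<longrightarrow> j < m \<longrightarrow> p \<in> F \<and> cls p = A i j"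
    using A unfolding carrier_cl by blast
  then obtain A' where A': "\<And>i j. i < n \<Longrightarrow> j < m \<Longrightarrow> A' i j \<in> F" "\<And>i j. i < n \<Longrightarrow> j < m \<Longrightarrow> cls (A' i j) = A i j"
    by metis
  have "\<forall>j i. \<exists>p::(('v, 'e) cl_gen, 'k) ncpoly. j < m \<longrightarrow> i < n \<longrightarrow> p \<in> F \<and> cls p = B j i"
    using B unfolding carrier_cl by blast
  then obtain B' where B': "\<And>i j. j < m \<Longrightarrow> i < n \<Longrightarrow> B' j i \<in> F" "\<And>i j. j < m \<Longrightarrow> i < n \<Longrightarrow> cls (B' j i) = B j i"
    by metis
  have *: "(\<Sum>j<l. p j * q j) - (if i = k then \<Sum>v\<in>verts G. gen (Vertex v) else 0) \<in> cl_ideal G P \<Lambda>"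
    if "(\<Oplus>\<^bsub>L\<^esub>j\<in>{..<l}. cls (p j) \<otimes>\<^bsub>L\<^esub> cls (q j)) = (if i = k then \<one>\<^bsub>L\<^esub> else \<zero>\<^bsub>L\<^esub>)"
      "\<And>j. j < l \<Longrightarrow> p j \<in> F" "\<And>j. j < l \<Longrightarrow> q j \<in> F" for l and p q :: "nat \<Rightarrow> (('v, 'e) cl_gen, 'k) ncpoly" and i k :: nat
  proof -
    interpret ring "L :: ('v, 'e, 'k) cl_ring" by (rule ring_cl)
    have "(\<Oplus>\<^bsub>L\<^esub>j\<in>{..<l}. cls (p j) \<otimes>\<^bsub>L\<^esub> cls (q j)) = (\<Oplus>\<^bsub>L\<^esub>j\<in>{..<l}. cls (p j * q j))"
      using that by (intro finsum_cong') (simp_all add: mult_cl carrier_cl free_algebra_mult)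
    also have "\<dots> = cls (\<Sum>j<l. p j * q j)"
      by (rule finsum_cl) (simp_all add: that free_algebra_mult)
    finally have "cls (\<Sum>j<l. p j * q j) = (if i = k then \<one>\<^bsub>L\<^esub> else \<zero>\<^bsub>L\<^esub>)" using that(1) by simp
    also have "\<dots> = cls (if i = k then \<Sum>v\<in>verts G. gen (Vertex v) else 0)"
      by (simp add: one_cl zero_cl)
    finally show ?thesis by (simp only: cl_class_eq_iff)
  qed
  have "m = n"
  proof (rule cl_matrix_size_eq[OF fin sep sub f])
    show "A' i j \<in> F" if "i < n" "j < m" for i j by (rule A'(1)[OF that])
    show "B' j i \<in> F" if "j < m" "i < n" for i j by (rule B'(1)[OF that])
    show "(\<Sum>j<m. A' i j * B' j k) - (if i = k then \<Sum>v\<in>verts G. gen (Vertex v) else 0) \<in> cl_ideal G P \<Lambda>"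
      if "i < n" "k < n" for i k
    proof (rule *)
      interpret ring "L :: ('v, 'e, 'k) cl_ring" by (rule ring_cl)
      have "(\<Oplus>\<^bsub>L\<^esub>j\<in>{..<m}. cls (A' i j) \<otimes>\<^bsub>L\<^esub> cls (B' j k)) = (\<Oplus>\<^bsub>L\<^esub>j\<in>{..<m}. A i j \<otimes>\<^bsub>L\<^esub> B j k)"
        using that A B A' B' by (intro finsum_cong') auto
      then show "(\<Oplus>\<^bsub>L\<^esub>j\<in>{..<m}. cls (A' i j) \<otimes>\<^bsub>L\<^esub> cls (B' j k)) = (if i = k then \<one>\<^bsub>L\<^esub> else \<zero>\<^bsub>L\<^esub>)"
        using AB[OF that] by simp
    qed (use that A' B' in auto)
    show "(\<Sum>i<n. B' j i * A' i k) - (if j = k then \<Sum>v\<in>verts G. gen (Vertex v) else 0) \<in> cl_ideal G P \<Lambda>"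
      if "j < m" "k < m" for j k
    proof (rule *)
      interpret ring "L :: ('v, 'e, 'k) cl_ring" by (rule ring_cl)
      have "(\<Oplus>\<^bsub>L\<^esub>i\<in>{..<n}. cls (B' j i) \<otimes>\<^bsub>L\<^esub> cls (A' i k)) = (\<Oplus>\<^bsub>L\<^esub>i\<in>{..<n}. B j i \<otimes>\<^bsub>L\<^esub> A i k)"
        using that A B A' B' by (intro finsum_cong') auto
      then show "(\<Oplus>\<^bsub>L\<^esub>i\<in>{..<n}. cls (B' j i) \<otimes>\<^bsub>L\<^esub> cls (A' i k)) = (if j = k then \<one>\<^bsub>L\<^esub> else \<zero>\<^bsub>L\<^esub>)"
        using BA[OF that] by simp
    qed (use that A' B' in auto)
  qed
  with \<open>m \<noteq> n\<close> show False by simp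
qed

end

section \<open>Direct sums of principal projective modules\<close>

text \<open>The direct sum of the right modules \<open>pR\<close> for the entries \<open>p\<close> of a list of idempotents, where \<open>x\<close> belongs to
  \<open>pR\<close> if and only if \<open>px = x\<close>. With lists, direct sums are concatenations.\<close>

definition proj_sum :: "('a, 'b) ring_scheme \<Rightarrow> 'a list \<Rightarrow> 'a list set" where
  "proj_sum R ps = {xs. list_all2 (\<lambda>p x. x \<in> carrier R \<and> p \<otimes>\<^bsub>R\<^esub> x = x) ps xs}"

definition proj_iso :: "('a, 'b) ring_scheme \<Rightarrow> 'a list \<Rightarrow> 'a list \<Rightarrow> bool" where
  "proj_iso R ps qs \<longleftrightarrow> (\<exists>\<phi>. bij_betw \<phi> (proj_sum R ps) (proj_sum R qs) \<and>
     (\<forall>x\<in>proj_sum R ps. \<forall>y\<in>proj_sum R ps.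
        \<phi> (map2 (add R) x y) = map2 (add R) (\<phi> x) (\<phi> y)) \<and>
     (\<forall>x\<in>proj_sum R ps. \<forall>r\<in>carrier R.
        \<phi> (map (\<lambda>a. a \<otimes>\<^bsub>R\<^esub> r) x) = map (\<lambda>a. a \<otimes>\<^bsub>R\<^esub> r) (\<phi> x)))"

lemma proj_sum_length: "xs \<in> proj_sum R ps \<Longrightarrow> length xs = length ps"
  by (auto simp: proj_sum_def dest: list_all2_lengthD)

lemma proj_sum_append_iff:
  assumes "length xs = length ps"
  shows "xs @ ys \<in> proj_sum R (ps @ qs) \<longleftrightarrow> xs \<in> proj_sum R ps \<and> ys \<in> proj_sum R qs"
  using assms by (simp add: proj_sum_def list_all2_append)

lemma proj_sum_appendI:
  "xs \<in> proj_sum R ps \<Longrightarrow> ys \<in> proj_sum R qs \<Longrightarrow> xs @ ys \<in> proj_sum R (ps @ qs)"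
  by (simp add: proj_sum_append_iff proj_sum_length)

lemma proj_sum_appendE:
  assumes "zs \<in> proj_sum R (ps @ qs)"
  obtains xs ys where "zs = xs @ ys" "xs \<in> proj_sum R ps" "ys \<in> proj_sum R qs"
  using assms unfolding proj_sum_def mem_Collect_eq list_all2_append1 by blast

lemma proj_isoI:
  assumes "\<And>x. x \<in> proj_sum R ps \<Longrightarrow> \<phi> x \<in> proj_sum R qs" "\<And>y. y \<in> proj_sum R qs \<Longrightarrow> \<psi> y \<in> proj_sum R ps"
    and "\<And>x. x \<in> proj_sum R ps \<Longrightarrow> \<psi> (\<phi> x) = x" "\<And>y. y \<in> proj_sum R qs \<Longrightarrow> \<phi> (\<psi> y) = y"
    and "\<And>x y. x \<in> proj_sum R ps \<Longrightarrow> y \<in> proj_sum R ps \<Longrightarrow> \<phi> (map2 (add R) x y) = map2 (add R) (\<phi> x) (\<phi> y)"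
    and "\<And>x r. x \<in> proj_sum R ps \<Longrightarrow> r \<in> carrier R \<Longrightarrow>
      \<phi> (map (\<lambda>a. a \<otimes>\<^bsub>R\<^esub> r) x) = map (\<lambda>a. a \<otimes>\<^bsub>R\<^esub> r) (\<phi> x)"
  shows "proj_iso R ps qs"
proof -
  have "bij_betw \<phi> (proj_sum R ps) (proj_sum R qs)"
    by (rule bij_betw_byWitness[where f' = \<psi>]) (use assms in auto)
  then show ?thesis using assms(5,6) unfolding proj_iso_def by blast
qed

lemma proj_iso_refl: "proj_iso R ps ps"
  by (rule proj_isoI[where \<phi> = id and \<psi> = id]) simp_all

lemma proj_iso_trans:
  assumes "proj_iso R ps qs" "proj_iso R qs us"
  shows "proj_iso R ps us"
proof -
  obtain \<phi> where \<phi>: "bij_betw \<phi> (proj_sum R ps) (proj_sum R qs)"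
    "\<And>x y. x \<in> proj_sum R ps \<Longrightarrow> y \<in> proj_sum R ps \<Longrightarrow> \<phi> (map2 (add R) x y) = map2 (add R) (\<phi> x) (\<phi> y)"
    "\<And>x r. x \<in> proj_sum R ps \<Longrightarrow> r \<in> carrier R \<Longrightarrow>
      \<phi> (map (\<lambda>a. a \<otimes>\<^bsub>R\<^esub> r) x) = map (\<lambda>a. a \<otimes>\<^bsub>R\<^esub> r) (\<phi> x)"
    using assms(1) unfolding proj_iso_def by blast
  obtain \<psi> where \<psi>: "bij_betw \<psi> (proj_sum R qs) (proj_sum R us)"
    "\<And>x y. x \<in> proj_sum R qs \<Longrightarrow> y \<in> proj_sum R qs \<Longrightarrow> \<psi> (map2 (add R) x y) = map2 (add R) (\<psi> x) (\<psi> y)"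
    "\<And>x r. x \<in> proj_sum R qs \<Longrightarrow> r \<in> carrier R \<Longrightarrow>
      \<psi> (map (\<lambda>a. a \<otimes>\<^bsub>R\<^esub> r) x) = map (\<lambda>a. a \<otimes>\<^bsub>R\<^esub> r) (\<psi> x)"
    using assms(2) unfolding proj_iso_def by blast
  have "\<phi> x \<in> proj_sum R qs" if "x \<in> proj_sum R ps" for x
    using that \<phi>(1) by (auto simp: bij_betw_def)
  then show ?thesis
    unfolding proj_iso_def using bij_betw_trans[OF \<phi>(1) \<psi>(1)] \<phi>(2,3) \<psi>(2,3)
    by (intro exI[of _ "\<psi> \<circ> \<phi>"]) simp
qed

context ring
begin

lemma proj_sum_add:
  assumes "set ps \<subseteq> carrier R" "xs \<in> proj_sum R ps" "ys \<in> proj_sum R ps"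
  shows "map2 (add R) xs ys \<in> proj_sum R ps"
  using assms by (auto simp: proj_sum_def list_all2_conv_all_nth r_distr subset_iff)

lemma proj_sum_act:
  assumes "set ps \<subseteq> carrier R" "xs \<in> proj_sum R ps" "r \<in> carrier R"
  shows "map (\<lambda>a. a \<otimes> r) xs \<in> proj_sum R ps"
  using assms by (auto simp: proj_sum_def list_all2_conv_all_nth m_assoc[symmetric] subset_iff)

lemma proj_iso_sym:
  assumes "set ps \<subseteq> carrier R" "proj_iso R ps qs"
  shows "proj_iso R qs ps"
proof -
  obtain \<phi> where \<phi>: "bij_betw \<phi> (proj_sum R ps) (proj_sum R qs)"
    "\<And>x y. x \<in> proj_sum R ps \<Longrightarrow> y \<in> proj_sum R ps \<Longrightarrow> \<phi> (map2 (add R) x y) = map2 (add R) (\<phi> x) (\<phi> y)"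
    "\<And>x r. x \<in> proj_sum R ps \<Longrightarrow> r \<in> carrier R \<Longrightarrow> \<phi> (map (\<lambda>a. a \<otimes> r) x) = map (\<lambda>a. a \<otimes> r) (\<phi> x)"
    using assms(2) unfolding proj_iso_def by blast
  define \<psi> where "\<psi> = inv_into (proj_sum R ps) \<phi>"
  have \<psi>: "\<psi> y \<in> proj_sum R ps" "\<phi> (\<psi> y) = y" if "y \<in> proj_sum R qs" for y
    using that \<phi>(1) by (auto simp: \<psi>_def bij_betw_def inv_into_into f_inv_into_f)
  have \<psi>_eq: "\<psi> y = x" if "x \<in> proj_sum R ps" "\<phi> x = y" for x y
    using that \<phi>(1) by (auto simp: \<psi>_def bij_betw_def inv_into_f_f)
  show ?thesis
  proof (rule proj_isoI[where \<phi> = \<psi> and \<psi> = \<phi>])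
    show "\<phi> x \<in> proj_sum R qs" if "x \<in> proj_sum R ps" for x
      using that \<phi>(1) by (auto simp: bij_betw_def)
  qed (use \<phi> \<psi> in \<open>auto intro!: \<psi>_eq proj_sum_add proj_sum_act assms(1)\<close>)
qed

lemma proj_iso_append:
  assumes "proj_iso R ps qs" "proj_iso R us vs" "set ps \<subseteq> carrier R" "set us \<subseteq> carrier R"
  shows "proj_iso R (ps @ us) (qs @ vs)"
proof -
  obtain \<phi> where \<phi>: "bij_betw \<phi> (proj_sum R ps) (proj_sum R qs)"
    "\<And>x y. x \<in> proj_sum R ps \<Longrightarrow> y \<in> proj_sum R ps \<Longrightarrow> \<phi> (map2 (add R) x y) = map2 (add R) (\<phi> x) (\<phi> y)"
    "\<And>x r. x \<in> proj_sum R ps \<Longrightarrow> r \<in> carrier R \<Longrightarrow> \<phi> (map (\<lambda>a. a \<otimes> r) x) = map (\<lambda>a. a \<otimes> r) (\<phi> x)"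
    using assms(1) unfolding proj_iso_def by blast
  obtain \<psi> where \<psi>: "bij_betw \<psi> (proj_sum R us) (proj_sum R vs)"
    "\<And>x y. x \<in> proj_sum R us \<Longrightarrow> y \<in> proj_sum R us \<Longrightarrow> \<psi> (map2 (add R) x y) = map2 (add R) (\<psi> x) (\<psi> y)"
    "\<And>x r. x \<in> proj_sum R us \<Longrightarrow> r \<in> carrier R \<Longrightarrow> \<psi> (map (\<lambda>a. a \<otimes> r) x) = map (\<lambda>a. a \<otimes> r) (\<psi> x)"
    using assms(2) unfolding proj_iso_def by blast
  define F where "F zs = \<phi> (take (length ps) zs) @ \<psi> (drop (length ps) zs)" for zs
  define \<phi>' \<psi>' where "\<phi>' = inv_into (proj_sum R ps) \<phi>" and "\<psi>' = inv_into (proj_sum R us) \<psi>"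
  define F' where "F' zs = \<phi>' (take (length qs) zs) @ \<psi>' (drop (length qs) zs)" for zs
  have F: "F (xs @ ys) = \<phi> xs @ \<psi> ys" if "xs \<in> proj_sum R ps" for xs ys
    using proj_sum_length[OF that] by (simp add: F_def)
  have F': "F' (xs @ ys) = \<phi>' xs @ \<psi>' ys" if "xs \<in> proj_sum R qs" for xs ys
    using proj_sum_length[OF that] by (simp add: F'_def)
  have \<phi>_in: "\<phi> x \<in> proj_sum R qs" "\<phi>' (\<phi> x) = x" if "x \<in> proj_sum R ps" for x
    using that \<phi>(1) by (auto simp: bij_betw_def \<phi>'_def inv_into_f_f)
  have \<psi>_in: "\<psi> x \<in> proj_sum R vs" "\<psi>' (\<psi> x) = x" if "x \<in> proj_sum R us" for x
    using that \<psi>(1) by (auto simp: bij_betw_def \<psi>'_def inv_into_f_f)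
  have \<phi>'_in: "\<phi>' y \<in> proj_sum R ps" "\<phi> (\<phi>' y) = y" if "y \<in> proj_sum R qs" for y
    using that \<phi>(1) by (auto simp: bij_betw_def \<phi>'_def inv_into_into f_inv_into_f)
  have \<psi>'_in: "\<psi>' y \<in> proj_sum R us" "\<psi> (\<psi>' y) = y" if "y \<in> proj_sum R vs" for y
    using that \<psi>(1) by (auto simp: bij_betw_def \<psi>'_def inv_into_into f_inv_into_f)
  note len = proj_sum_length
  show ?thesis
  proof (rule proj_isoI[where \<phi> = F and \<psi> = F'])
    fix x assume "x \<in> proj_sum R (ps @ us)"
    then obtain a b where x: "x = a @ b" "a \<in> proj_sum R ps" "b \<in> proj_sum R us"
      by (rule proj_sum_appendE)
    show "F x \<in> proj_sum R (qs @ vs)" "F' (F x) = x"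
      using x \<phi>_in \<psi>_in by (simp_all add: F F' proj_sum_appendI)
    show "F (map (\<lambda>a. a \<otimes> r) x) = map (\<lambda>a. a \<otimes> r) (F x)" if "r \<in> carrier R" for r
      using x that proj_sum_act[OF assms(3) x(2) that] by (simp add: F \<phi> \<psi>)
    fix y assume "y \<in> proj_sum R (ps @ us)"
    then obtain c d where y: "y = c @ d" "c \<in> proj_sum R ps" "d \<in> proj_sum R us"
      by (rule proj_sum_appendE)
    have "length a = length c" "length (\<phi> a) = length (\<phi> c)"
      using len[OF x(2)] len[OF y(2)] len[OF \<phi>_in(1)[OF x(2)]] len[OF \<phi>_in(1)[OF y(2)]] by simp_all
    then show "F (map2 (add R) x y) = map2 (add R) (F x) (F y)"
      using x y proj_sum_add[OF assms(3) x(2) y(2)] by (simp add: F \<phi> \<psi>)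
  next
    fix y assume "y \<in> proj_sum R (qs @ vs)"
    then obtain c d where y: "y = c @ d" "c \<in> proj_sum R qs" "d \<in> proj_sum R vs"
      by (rule proj_sum_appendE)
    then show "F' y \<in> proj_sum R (ps @ us)" "F (F' y) = y"
      using \<phi>'_in \<psi>'_in by (simp_all add: F F' proj_sum_appendI)
  qed
qed

lemma proj_iso_append_commute: "proj_iso R (ps @ us) (us @ ps)"
proof -
  have *: "drop (length ps) x @ take (length ps) x \<in> proj_sum R (us @ ps)"
    "drop (length us) (drop (length ps) x @ take (length ps) x)
      @ take (length us) (drop (length ps) x @ take (length ps) x) = x"
    if "x \<in> proj_sum R (ps @ us)" for x and ps us :: "'a list"
  proof -
    from that obtain a b where "x = a @ b" "a \<in> proj_sum R ps" "b \<in> proj_sum R us"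
      by (rule proj_sum_appendE)
    then show "drop (length ps) x @ take (length ps) x \<in> proj_sum R (us @ ps)"
      "drop (length us) (drop (length ps) x @ take (length ps) x)
        @ take (length us) (drop (length ps) x @ take (length ps) x) = x"
      by (simp_all add: proj_sum_appendI proj_sum_length)
  qed
  show ?thesis
  proof (rule proj_isoI[where \<phi> = "\<lambda>x. drop (length ps) x @ take (length ps) x"
        and \<psi> = "\<lambda>x. drop (length us) x @ take (length us) x"])
    fix x y assume "x \<in> proj_sum R (ps @ us)" "y \<in> proj_sum R (ps @ us)"
    then have "length x = length y" by (simp add: proj_sum_length)
    then show "drop (length ps) (map2 (add R) x y) @ take (length ps) (map2 (add R) x y)
      = map2 (add R) (drop (length ps) x @ take (length ps) x) (drop (length ps) y @ take (length ps) y)"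
      by (simp add: take_map drop_map take_zip drop_zip)
  qed (rule *; assumption | simp add: take_map drop_map)+
qed

lemma proj_iso_mset:
  assumes "mset ps = mset qs" "set ps \<subseteq> carrier R"
  shows "proj_iso R ps qs"
  using assms
proof (induction ps arbitrary: qs)
  case Nil
  then have "qs = []" by simp
  then show ?case by (simp add: proj_iso_refl)
next
  case (Cons a ps)
  then have "a \<in> set qs" by (metis list.set_intros(1) mset_eq_setD)
  then obtain us vs where qs: "qs = us @ a # vs" by (auto simp: in_set_conv_decomp)
  then have us: "mset ps = mset (us @ vs)" using Cons.prems by simp
  then have carr: "set us \<subseteq> carrier R" "set vs \<subseteq> carrier R"
    using Cons.prems(2) mset_eq_setD[OF us] by auto
  have "proj_iso R ([a] @ ps) ([a] @ (us @ vs))"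
    using us Cons by (intro proj_iso_append proj_iso_refl) auto
  moreover have "proj_iso R (([a] @ us) @ vs) ((us @ [a]) @ vs)"
    using Cons.prems carr by (intro proj_iso_append proj_iso_refl proj_iso_append_commute) auto
  ultimately show ?case using proj_iso_trans by (auto simp: qs)
qed

text \<open>Multiplication by the \<open>f i\<close> decomposes an element of \<open>pR\<close>, and the \<open>e i\<close> put the pieces together. The relations
  say that the row \<open>e\<close> and the column \<open>f\<close> are mutually inverse matrices between \<open>pR\<close> and
  \<open>\<Oplus>i. (q i)R\<close>.\<close>

lemma proj_iso_split:
  fixes n :: nat
  assumes "p \<in> carrier R" "\<And>i. i < n \<Longrightarrow> e i \<in> carrier R" "\<And>i. i < n \<Longrightarrow> f i \<in> carrier R"
    "\<And>i. i < n \<Longrightarrow> q i \<in> carrier R"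
    and sum: "(\<Oplus>i\<in>{..<n}. e i \<otimes> f i) = p"
    and fe: "\<And>i j. i < n \<Longrightarrow> j < n \<Longrightarrow> f i \<otimes> e j = (if i = j then q i else \<zero>)"
    and pe: "\<And>i. i < n \<Longrightarrow> p \<otimes> e i = e i" and qf: "\<And>i. i < n \<Longrightarrow> q i \<otimes> f i = f i"
  shows "proj_iso R [p] (map q [0..<n])"
proof -
  note carr = assms(1-4)
  have P: "x \<in> proj_sum R [p] \<longleftrightarrow> (\<exists>a\<in>carrier R. p \<otimes> a = a \<and> x = [a])" for x
    by (auto simp: proj_sum_def list_all2_Cons1)
  have Q: "y \<in> proj_sum R (map q [0..<n]) \<longleftrightarrow>
      length y = n \<and> (\<forall>i<n. y ! i \<in> carrier R \<and> q i \<otimes> y ! i = y ! i)" for y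
    by (auto simp: proj_sum_def list_all2_conv_all_nth)
  define \<phi> where "\<phi> x = map (\<lambda>i. f i \<otimes> hd x) [0..<n]" for x
  define \<psi> where "\<psi> y = [\<Oplus>i\<in>{..<n}. e i \<otimes> y ! i]" for y
  show ?thesis
  proof (rule proj_isoI[where \<phi> = \<phi> and \<psi> = \<psi>])
    fix x assume "x \<in> proj_sum R [p]"
    then obtain a where x: "a \<in> carrier R" "p \<otimes> a = a" "x = [a]" using P by blast
    show "\<phi> x \<in> proj_sum R (map q [0..<n])"
      using x carr qf by (simp add: Q \<phi>_def m_assoc[symmetric])
    have "(\<Oplus>i\<in>{..<n}. e i \<otimes> \<phi> x ! i) = (\<Oplus>i\<in>{..<n}. (e i \<otimes> f i) \<otimes> a)"
      using x carr by (intro finsum_cong') (auto simp: \<phi>_def m_assoc)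
    also have "\<dots> = (\<Oplus>i\<in>{..<n}. e i \<otimes> f i) \<otimes> a"
      using x carr by (intro finsum_ldistr[symmetric]) auto
    finally show "\<psi> (\<phi> x) = x" using x by (simp add: \<psi>_def sum)
    show "\<phi> (map (\<lambda>a. a \<otimes> r) x) = map (\<lambda>a. a \<otimes> r) (\<phi> x)" if "r \<in> carrier R" for r
      using x that carr by (simp add: \<phi>_def m_assoc)
    fix y assume "y \<in> proj_sum R [p]"
    then obtain b where y: "b \<in> carrier R" "p \<otimes> b = b" "y = [b]" using P by blast
    show "\<phi> (map2 (add R) x y) = map2 (add R) (\<phi> x) (\<phi> y)"
      using x y carr by (intro nth_equalityI) (simp_all add: \<phi>_def r_distr)
  next
    fix y assume y: "y \<in> proj_sum R (map q [0..<n])"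
    then have yc: "length y = n" "\<And>i. i < n \<Longrightarrow> y ! i \<in> carrier R" "\<And>i. i < n \<Longrightarrow> q i \<otimes> y ! i = y ! i"
      by (auto simp: Q)
    have S: "(\<Oplus>i\<in>{..<n}. e i \<otimes> y ! i) \<in> carrier R"
      using yc carr by (intro finsum_closed) auto
    have "p \<otimes> (\<Oplus>i\<in>{..<n}. e i \<otimes> y ! i) = (\<Oplus>i\<in>{..<n}. p \<otimes> (e i \<otimes> y ! i))"
      using yc carr by (intro finsum_rdistr) auto
    also have "\<dots> = (\<Oplus>i\<in>{..<n}. e i \<otimes> y ! i)"
      using yc carr pe by (intro finsum_cong') (auto simp: m_assoc[symmetric])
    finally show "\<psi> y \<in> proj_sum R [p]" using S by (auto simp: P \<psi>_def)
    have "f i \<otimes> (\<Oplus>j\<in>{..<n}. e j \<otimes> y ! j) = y ! i" if i: "i < n" for i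
    proof -
      have "f i \<otimes> (\<Oplus>j\<in>{..<n}. e j \<otimes> y ! j) = (\<Oplus>j\<in>{..<n}. f i \<otimes> (e j \<otimes> y ! j))"
        using yc carr i by (intro finsum_rdistr) auto
      also have "\<dots> = (\<Oplus>j\<in>{..<n}. if i = j then y ! j else \<zero>)"
        using yc carr i by (intro finsum_cong') (auto simp: m_assoc[symmetric] fe)
      also have "\<dots> = y ! i"
        using yc i by (intro finsum_singleton) auto
      finally show ?thesis .
    qed
    then show "\<phi> (\<psi> y) = y"
      using yc(1) by (intro nth_equalityI) (simp_all add: \<phi>_def \<psi>_def)
  qed
qed

lemma proj_iso_replicate_one:
  assumes "proj_iso R (replicate m \<one>) (replicate n \<one>)"
  shows "\<exists>\<phi>. free_rmodule_iso R m n \<phi>"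
proof -
  obtain \<phi> where \<phi>: "bij_betw \<phi> (proj_sum R (replicate m \<one>)) (proj_sum R (replicate n \<one>))"
    "\<And>x y. x \<in> proj_sum R (replicate m \<one>) \<Longrightarrow> y \<in> proj_sum R (replicate m \<one>)
      \<Longrightarrow> \<phi> (map2 (add R) x y) = map2 (add R) (\<phi> x) (\<phi> y)"
    "\<And>x r. x \<in> proj_sum R (replicate m \<one>) \<Longrightarrow> r \<in> carrier R \<Longrightarrow> \<phi> (map (\<lambda>a. a \<otimes> r) x) = map (\<lambda>a. a \<otimes> r) (\<phi> x)"
    using assms unfolding proj_iso_def by blast
  define L where "L k x = map x [0..<k]" for k and x :: "nat \<Rightarrow> 'a"
  define U where "U k xs = (\<lambda>i\<in>{..<k}. xs ! i)" for k and xs :: "'a list"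
  have one: "xs \<in> proj_sum R (replicate k \<one>) \<longleftrightarrow> length xs = k \<and> set xs \<subseteq> carrier R" for xs k
    by (auto simp: proj_sum_def list_all2_conv_all_nth set_conv_nth)
  have L: "bij_betw (L k) (free_rmodule R k) (proj_sum R (replicate k \<one>))" for k
    by (rule bij_betw_byWitness[where f' = "U k"])
      (auto simp: L_def U_def free_rmodule_def one PiE_def Pi_def extensional_def fun_eq_iff
        intro!: nth_equalityI subsetD[OF _ nth_mem])
  have U: "bij_betw (U k) (proj_sum R (replicate k \<one>)) (free_rmodule R k)" for k
    by (rule bij_betw_byWitness[where f' = "L k"])
      (auto simp: L_def U_def free_rmodule_def one PiE_def Pi_def extensional_def fun_eq_iff
        intro!: nth_equalityI subsetD[OF _ nth_mem])
  have Ladd: "L k (free_rmodule_add R k x y) = map2 (add R) (L k x) (L k y)" for k x y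
    by (rule nth_equalityI) (simp_all add: L_def free_rmodule_add_def)
  have Lact: "L k (free_rmodule_act R k x r) = map (\<lambda>a. a \<otimes> r) (L k x)" for k x r
    by (rule nth_equalityI) (simp_all add: L_def free_rmodule_act_def)
  have Uadd: "U k (map2 (add R) xs ys) = free_rmodule_add R k (U k xs) (U k ys)"
    if "length xs = k" "length ys = k" for k xs ys
    using that by (auto simp: U_def free_rmodule_add_def fun_eq_iff)
  have Uact: "U k (map (\<lambda>a. a \<otimes> r) xs) = free_rmodule_act R k (U k xs) r" if "length xs = k" for k xs r
    using that by (auto simp: U_def free_rmodule_act_def fun_eq_iff)
  have Lin: "L m x \<in> proj_sum R (replicate m \<one>)" "\<phi> (L m x) \<in> proj_sum R (replicate n \<one>)"
    if "x \<in> free_rmodule R m" for x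
    using that L[of m] \<phi>(1) by (auto simp: bij_betw_def)
  have len: "length (\<phi> (L m x)) = n" if "x \<in> free_rmodule R m" for x
    using proj_sum_length[OF Lin(2)[OF that]] by simp
  have "bij_betw (U n \<circ> (\<phi> \<circ> L m)) (free_rmodule R m) (free_rmodule R n)"
    by (intro bij_betw_trans[OF bij_betw_trans[OF L \<phi>(1)] U])
  then have "free_rmodule_iso R m n (U n \<circ> (\<phi> \<circ> L m))"
    unfolding free_rmodule_iso_def
    by (simp add: Ladd Lact \<phi> Lin Uadd Uact len)
  then show ?thesis by blast
qed

end

section \<open>Balanced functions and the span of the block vectors\<close>

lemma common_denominator:
  assumes "finite V"
  shows "\<exists>N>0. \<forall>v\<in>V. \<exists>z. of_nat N * (q v :: rat) = of_int z"
  using assms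
proof induction
  case (insert v V)
  then obtain N where N: "N > 0" "\<forall>v\<in>V. \<exists>z. of_nat N * q v = of_int z" by blast
  obtain a b where ab: "b > 0" "q v = of_int a / of_int b"
    using Rat_cases[of "q v"] by (metis Fract_of_int_quotient)
  have "of_nat (N * nat b) * q v = of_int (int N * a)"
    using ab by (simp add: field_simps)
  moreover have "\<exists>z. of_nat (N * nat b) * q w = of_int z" if w: "w \<in> V" for w
  proof -
    obtain z where "of_nat N * q w = of_int z" using bspec[OF N(2) w] ..
    moreover have "of_nat (N * nat b) * q w = of_int b * (of_nat N * q w)" using ab by simp
    ultimately have "of_nat (N * nat b) * q w = of_int (b * z)" by simp
    then show ?thesis by blast
  qed
  ultimately have "\<forall>w\<in>insert v V. \<exists>z. of_nat (N * nat b) * q w = of_int z" by blast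
  moreover have "0 < N * nat b" using N(1) ab(1) by simp
  ultimately show ?case by blast
qed auto

definition block_vec :: "('v, 'e) pre_digraph \<Rightarrow> 'e set \<Rightarrow> ('v + 'e set) \<Rightarrow>\<^sub>0 rat" where
  "block_vec G X = vertex_vec (block_source G X) - (\<Sum>e\<in>X. vertex_vec (head G e))"

text \<open>A linear functional that vanishes on the span and is \<open>1\<close> at the sum of the vertices, multiplied by a common
  denominator of its values.\<close>

lemma exists_balanced:
  fixes G :: "('v, 'e) pre_digraph" and \<Lambda> :: "'e set set"
  assumes fin: "fin_digraph G" and sep: "separated_graph G P" and sub: "\<Lambda> \<subseteq> P"
    and not: "(\<Sum>v\<in>verts G. vertex_vec v) \<notin> pm.span (block_vec G ` \<Lambda>)"
  shows "\<exists>f. balanced G \<Lambda> f \<and> (\<Sum>v\<in>verts G. f v) \<noteq> 0"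
proof -
  interpret rat: vector_space "(*) :: rat \<Rightarrow> rat \<Rightarrow> rat"
    by standard (simp_all add: algebra_simps)
  interpret pmr: vector_space_pair
    "pm_scale :: rat \<Rightarrow> (('v + 'e set) \<Rightarrow>\<^sub>0 rat) \<Rightarrow> _" "(*) :: rat \<Rightarrow> rat \<Rightarrow> rat" ..
  let ?s = "\<Sum>v\<in>verts G. vertex_vec v :: ('v + 'e set) \<Rightarrow>\<^sub>0 rat"
  obtain B where B: "B \<subseteq> block_vec G ` \<Lambda>" "pm.independent B" "block_vec G ` \<Lambda> \<subseteq> pm.span B"
    using pm.maximal_independent_subset by blast
  have "?s \<notin> pm.span B" using not pm.span_mono[OF B(1)] by blast
  then have "pm.independent (insert ?s B)" "?s \<notin> B"
    using pm.independent_insertI[OF _ B(2)] pm.span_base by blast+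
  then obtain g where g: "Vector_Spaces.linear pm_scale (*) g"
    "\<forall>x\<in>insert ?s B. g x = (if x = ?s then 1 else 0)"
    using pmr.linear_independent_extend[of "insert ?s B" "\<lambda>x. if x = ?s then 1 else 0"] by blast
  have gB: "g x = 0" if "x \<in> block_vec G ` \<Lambda>" for x
  proof (rule pmr.linear_eq_0_on_span[OF g(1)])
    show "x \<in> pm.span B" using that B(3) by blast
    show "g b = 0" if "b \<in> B" for b using g(2) that \<open>?s \<notin> B\<close> by auto
  qed
  define q where "q v = g (vertex_vec v)" for v
  obtain N f where N: "N > 0" and f: "\<And>v. v \<in> verts G \<Longrightarrow> of_nat N * q v = of_int (f v)"
    using common_denominator[OF fin_digraph.finite_verts[OF fin], of q] by metis
  have "(\<Sum>v\<in>verts G. q v) = 1"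
    using g by (simp add: q_def pmr.linear_sum[OF g(1), symmetric])
  then have "of_int (\<Sum>v\<in>verts G. f v) = (of_nat N :: rat)"
    by (simp add: f[symmetric] sum_distrib_left[symmetric])
  then have "(\<Sum>v\<in>verts G. f v) \<noteq> 0" using N by (metis of_int_0 of_nat_eq_0_iff less_irrefl)
  moreover have "balanced G \<Lambda> f"
    unfolding balanced_def
  proof
    fix X assume X: "X \<in> \<Lambda>"
    then have XP: "X \<in> P" using sub by blast
    have wf: "wf_digraph G" using sep by (simp add: separated_graph_def)
    obtain e where e: "e \<in> X" using separated_graph_block_nonempty[OF sep XP] .
    have src: "block_source G X \<in> verts G"
      using block_source[OF sep XP e] wf by (simp add: wf_digraph.tail_in_verts)
    have hd: "head G e \<in> verts G" if "e \<in> X" for e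
      using block_source(2)[OF sep XP that] wf by (simp add: wf_digraph.head_in_verts)
    have "q (block_source G X) - (\<Sum>e\<in>X. q (head G e)) = 0"
      using gB[of "block_vec G X"] X
      by (simp add: block_vec_def q_def pmr.linear_diff[OF g(1)] pmr.linear_sum[OF g(1)])
    then have "of_nat N * q (block_source G X) = (\<Sum>e\<in>X. of_nat N * q (head G e))"
      by (simp add: sum_distrib_left)
    then have "(of_int (f (block_source G X)) :: rat) = of_int (\<Sum>e\<in>X. f (head G e))"
      using f[OF src] f[OF hd] by simp
    then show "f (block_source G X) = (\<Sum>e\<in>X. f (head G e))" by (simp only: of_int_eq_iff)
  qed
  ultimately show ?thesis by blast
qed

section \<open>Isomorphisms between sums of vertex modules\<close>

definition list_vec :: "'v list \<Rightarrow> ('v + 'e set) \<Rightarrow>\<^sub>0 rat" where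
  "list_vec vs = (\<Sum>v\<leftarrow>vs. vertex_vec v)"

lemma list_vec_append [simp]: "list_vec (vs @ ws) = list_vec vs + list_vec ws"
  by (simp add: list_vec_def)

lemma list_vec_concat_replicate: "list_vec (concat (replicate n vs)) = pm_scale (of_nat n) (list_vec vs)"
  by (induction n) (simp_all add: list_vec_def[of "[]"] pm.scale_left_distrib add.commute)

lemma lookup_list_vec: "Poly_Mapping.lookup (list_vec vs) (Inl v) = of_nat (count (mset vs) v)"
  by (induction vs) (auto simp: list_vec_def lookup_add lookup_single)

lemma list_vec_eq_imp_mset_eq:
  assumes "list_vec vs = (list_vec ws :: ('v + 'e set) \<Rightarrow>\<^sub>0 rat)"
  shows "mset vs = mset ws"
proof (rule multiset_eqI)
  fix v
  have "(of_nat (count (mset vs) v) :: rat) = of_nat (count (mset ws) v)"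
    using arg_cong[OF assms, of "\<lambda>x. Poly_Mapping.lookup x (Inl v)"] by (simp only: lookup_list_vec)
  then show "count (mset vs) v = count (mset ws) v" by (simp only: of_nat_eq_iff)
qed

lemma (in ring) proj_iso_concat_replicate:
  assumes "proj_iso R ps qs" "set ps \<subseteq> carrier R"
  shows "proj_iso R (concat (replicate n ps)) (concat (replicate n qs))"
  by (induction n) (use assms in \<open>auto intro!: proj_iso_append proj_iso_refl\<close>)

context
  fixes G :: "('v, 'e) pre_digraph" and P \<Lambda> :: "'e set set" and L :: "('v, 'e, 'k::field) cl_ring"
    and c :: "'v \<Rightarrow> (('v, 'e) cl_gen, 'k) ncpoly set"
  assumes fin: "fin_digraph G" and sep: "separated_graph G P" and sub: "\<Lambda> \<subseteq> P"
  defines L_def: "L \<equiv> CL_algebra G P \<Lambda>" and c_def: "c \<equiv> \<lambda>v. cl_class G P \<Lambda> (gen (Vertex v))"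
begin

interpretation ring L unfolding L_def by (rule ring_cl[OF fin sep sub])

text \<open>The row of the edges of \<open>X\<close> and the column of their ghost edges split the idempotent \<open>sX\<close>.\<close>

lemma proj_iso_block:
  assumes X: "X \<in> \<Lambda>" and es: "distinct es" "set es = X"
  shows "proj_iso L [c (block_source G X)] (map c (map (head G) es))"
proof -
  have XP: "X \<in> P" using X sub by blast
  have wf: "wf_digraph G" using sep by (simp add: separated_graph_def)
  have e: "e \<in> arcs G" "head G e \<in> verts G" "tail G e \<in> verts G" "block_source G X = tail G e" if "e \<in> X" for e
    using block_source[OF sep XP that] wf by (simp_all add: wf_digraph.head_in_verts wf_digraph.tail_in_verts)
  let ?F = "carrier (free_algebra (cl_gens G)) :: (('v, 'e) cl_gen, 'k) ncpoly set"
  let ?cls = "cl_class G P \<Lambda> :: (('v, 'e) cl_gen, 'k) ncpoly \<Rightarrow> _"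
  have F: "gen (Edge e) \<in> ?F" "gen (Ghost e) \<in> ?F" "gen (Vertex (head G e)) \<in> ?F"
    "gen (Vertex (block_source G X)) \<in> ?F" if "e \<in> X" for e
    using e[OF that] by (auto intro!: gen_in_free_algebra simp: cl_gens_def)
  have rel: "?cls p = ?cls q" if "p - q \<in> cl_relations G P \<Lambda>" for p q
    using that by (simp add: cl_class_eq_iff cl_ideal_def algebra_ideal.rel)
  note carr = carrier_cl[of G P \<Lambda>, where 'c = 'k, folded L_def]
  note mult = mult_cl[OF fin sep sub, where 'k = 'k, folded L_def]
  define n where "n = length es"
  have nth: "es ! i \<in> X" if "i < n" for i
    using nth_mem[of i es] that es(2) by (simp add: n_def)
  have "proj_iso L [c (block_source G X)] (map (\<lambda>i. c (head G (es ! i))) [0..<n])"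
  proof (rule proj_iso_split[where e = "\<lambda>i. ?cls (gen (Edge (es ! i)))" and f = "\<lambda>i. ?cls (gen (Ghost (es ! i)))"])
    show "c (block_source G X) \<in> carrier L"
      using F(4) separated_graph_block_nonempty[OF sep XP] by (metis carr c_def imageI)
    have "(\<Oplus>\<^bsub>L\<^esub>i\<in>{..<n}. ?cls (gen (Edge (es ! i))) \<otimes>\<^bsub>L\<^esub> ?cls (gen (Ghost (es ! i))))
        = (\<Oplus>\<^bsub>L\<^esub>i\<in>{..<n}. ?cls (gen (Edge (es ! i)) * gen (Ghost (es ! i))))"
      by (rule finsum_cong') (auto simp: mult F nth carr intro!: imageI free_algebra_mult)
    also have "\<dots> = ?cls (\<Sum>i<n. gen (Edge (es ! i)) * gen (Ghost (es ! i)))"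
      unfolding L_def by (rule finsum_cl[OF fin sep sub]) (auto simp: F nth intro!: free_algebra_mult)
    also have "(\<Sum>i<n. gen (Edge (es ! i)) * gen (Ghost (es ! i)) :: (('v, 'e) cl_gen, 'k) ncpoly)
        = (\<Sum>e\<in>X. gen (Edge e) * gen (Ghost e))"
      using bij_betw_nth[OF es(1), of "{..<n}" X] es by (intro sum.reindex_bij_betw) (simp add: n_def)
    also have "?cls \<dots> = c (block_source G X)"
      unfolding c_def by (rule rel[OF cl_relations.CK2[OF X], symmetric])
    finally show "(\<Oplus>\<^bsub>L\<^esub>i\<in>{..<n}. ?cls (gen (Edge (es ! i))) \<otimes>\<^bsub>L\<^esub> ?cls (gen (Ghost (es ! i))))
        = c (block_source G X)" .
    fix i assume i: "i < n"
    note Xi = nth[OF i]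
    show "?cls (gen (Edge (es ! i))) \<in> carrier L" "?cls (gen (Ghost (es ! i))) \<in> carrier L"
      "c (head G (es ! i)) \<in> carrier L"
      using F[OF Xi] by (auto simp: carr c_def)
    show "c (block_source G X) \<otimes>\<^bsub>L\<^esub> ?cls (gen (Edge (es ! i))) = ?cls (gen (Edge (es ! i)))"
      using rel[OF cl_relations.E1_source[OF e(1)[OF Xi]]] F[OF Xi] e(4)[OF Xi] by (simp add: c_def mult)
    show "c (head G (es ! i)) \<otimes>\<^bsub>L\<^esub> ?cls (gen (Ghost (es ! i))) = ?cls (gen (Ghost (es ! i)))"
      using rel[OF cl_relations.E2_target[OF e(1)[OF Xi]]] F[OF Xi] by (simp add: c_def mult)
    fix j assume j: "j < n"
    note Xj = nth[OF j]
    have "es ! i = es ! j \<longleftrightarrow> i = j" using es i j by (simp add: nth_eq_iff_index_eq n_def)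
    then show "?cls (gen (Ghost (es ! i))) \<otimes>\<^bsub>L\<^esub> ?cls (gen (Edge (es ! j)))
        = (if i = j then c (head G (es ! i)) else \<zero>\<^bsub>L\<^esub>)"
      using rel[OF cl_relations.CK1[OF XP Xi Xj]] F[OF Xi] F[OF Xj]
      by (auto simp: c_def mult zero_cl[of G P \<Lambda>, where 'c = 'k, folded L_def])
  qed
  moreover have "map (\<lambda>i. c (head G (es ! i))) [0..<n] = map c (map (head G) es)"
    by (rule nth_equalityI) (simp_all add: n_def)
  ultimately show ?thesis by simp
qed

text \<open>The vertices are orthogonal idempotents with sum \<open>1\<close>.\<close>

lemma proj_iso_one_vertices:
  assumes vs: "distinct vs" "set vs = verts G"
  shows "proj_iso L [\<one>\<^bsub>L\<^esub>] (map c vs)"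
proof -
  let ?F = "carrier (free_algebra (cl_gens G)) :: (('v, 'e) cl_gen, 'k) ncpoly set"
  let ?cls = "cl_class G P \<Lambda> :: (('v, 'e) cl_gen, 'k) ncpoly \<Rightarrow> _"
  define n where "n = length vs"
  have nth: "vs ! i \<in> verts G" if "i < n" for i
    using nth_mem[of i vs] that vs(2) by (simp add: n_def)
  have F: "gen (Vertex v) \<in> ?F" if "v \<in> verts G" for v
    using that by (auto intro!: gen_in_free_algebra simp: cl_gens_def)
  note carr = carrier_cl[of G P \<Lambda>, where 'c = 'k, folded L_def]
  note mult = mult_cl[OF fin sep sub, where 'k = 'k, folded L_def]
  have c: "c v \<in> carrier L" if "v \<in> verts G" for v using F[OF that] by (auto simp: carr c_def)
  have cc: "c v \<otimes>\<^bsub>L\<^esub> c w = (if v = w then c v else \<zero>\<^bsub>L\<^esub>)" if "v \<in> verts G" "w \<in> verts G" for v w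
  proof -
    have "?cls (gen (Vertex v) * gen (Vertex w)) = ?cls (if v = w then gen (Vertex v) else 0)"
      unfolding cl_class_eq_iff cl_ideal_def by (rule algebra_ideal.rel[OF cl_relations.V[OF that]])
    then show ?thesis
      using F that by (auto simp: c_def mult zero_cl[of G P \<Lambda>, where 'c = 'k, folded L_def])
  qed
  have "proj_iso L [\<one>\<^bsub>L\<^esub>] (map (\<lambda>i. c (vs ! i)) [0..<n])"
  proof (rule proj_iso_split[where e = "\<lambda>i. c (vs ! i)" and f = "\<lambda>i. c (vs ! i)"])
    have "(\<Oplus>\<^bsub>L\<^esub>i\<in>{..<n}. c (vs ! i) \<otimes>\<^bsub>L\<^esub> c (vs ! i)) = (\<Oplus>\<^bsub>L\<^esub>i\<in>{..<n}. c (vs ! i))"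
      by (rule finsum_cong') (use c nth in \<open>auto simp: cc\<close>)
    also have "\<dots> = ?cls (\<Sum>i<n. gen (Vertex (vs ! i)))"
      unfolding L_def c_def by (rule finsum_cl[OF fin sep sub]) (auto simp: F nth)
    also have "(\<Sum>i<n. gen (Vertex (vs ! i)) :: (('v, 'e) cl_gen, 'k) ncpoly) = (\<Sum>v\<in>verts G. gen (Vertex v))"
      using bij_betw_nth[OF vs(1), of "{..<n}" "verts G"] vs by (intro sum.reindex_bij_betw) (simp add: n_def)
    also have "?cls \<dots> = \<one>\<^bsub>L\<^esub>" by (simp add: L_def one_cl)
    finally show "(\<Oplus>\<^bsub>L\<^esub>i\<in>{..<n}. c (vs ! i) \<otimes>\<^bsub>L\<^esub> c (vs ! i)) = \<one>\<^bsub>L\<^esub>" .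
    show "c (vs ! i) \<otimes>\<^bsub>L\<^esub> c (vs ! j) = (if i = j then c (vs ! i) else \<zero>\<^bsub>L\<^esub>)" if "i < n" "j < n" for i j
      using that vs nth by (simp add: cc nth_eq_iff_index_eq n_def)
  qed (use c nth in \<open>auto simp: cc\<close>)
  moreover have "map (\<lambda>i. c (vs ! i)) [0..<n] = map c vs"
    by (rule nth_equalityI) (simp_all add: n_def)
  ultimately show ?thesis by simp
qed

text \<open>Up to a positive multiple, \<open>x\<close> is the formal difference of two isomorphic direct sums of vertex modules. These
  vectors form a subspace (a rational multiple is absorbed by repeating the lists), so all vectors of the span
  have this property as soon as the block vectors do.\<close>

definition iso_difference :: "(('v + 'e set) \<Rightarrow>\<^sub>0 rat) \<Rightarrow> bool" where
  "iso_difference x \<longleftrightarrow> (\<exists>N>0. \<exists>vs ws. set vs \<subseteq> verts G \<and> set ws \<subseteq> verts G \<and>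
     proj_iso L (map c vs) (map c ws) \<and> pm_scale (of_nat N) x = list_vec vs - list_vec ws)"

lemma c_carrier: "set vs \<subseteq> verts G \<Longrightarrow> set (map c vs) \<subseteq> carrier L"
  by (auto simp: L_def c_def carrier_cl cl_gens_def intro!: imageI gen_in_free_algebra)

lemma proj_iso_copies:
  assumes "set vs \<subseteq> verts G" "proj_iso L (map c vs) (map c ws)"
  shows "proj_iso L (map c (concat (replicate n vs))) (map c (concat (replicate n ws)))"
  using proj_iso_concat_replicate[OF assms(2) c_carrier[OF assms(1)], of n] by (simp add: map_concat)

lemma iso_difference_scale_nat:
  assumes "iso_difference x"
  shows "iso_difference (pm_scale (of_nat a / of_nat b) x)"
proof (cases "b = 0")
  case True
  then show ?thesis
    unfolding iso_difference_def
    by (intro exI[of _ 1] conjI exI[of _ "[]"]) (simp_all add: proj_iso_refl)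
next
  case False
  obtain N vs ws where N: "N > 0" "set vs \<subseteq> verts G" "set ws \<subseteq> verts G"
    "proj_iso L (map c vs) (map c ws)" "pm_scale (of_nat N) x = list_vec vs - list_vec ws"
    using assms unfolding iso_difference_def by blast
  have "pm_scale (of_nat (b * N)) (pm_scale (of_nat a / of_nat b) x) = pm_scale (of_nat a) (pm_scale (of_nat N) x)"
    using False by simp
  also have "\<dots> = list_vec (concat (replicate a vs)) - list_vec (concat (replicate a ws))"
    by (simp only: N list_vec_concat_replicate pm.scale_right_diff_distrib)
  finally have "pm_scale (of_nat (b * N)) (pm_scale (of_nat a / of_nat b) x)
    = list_vec (concat (replicate a vs)) - list_vec (concat (replicate a ws))" .
  moreover have "set (concat (replicate a vs)) \<subseteq> verts G" "set (concat (replicate a ws)) \<subseteq> verts G"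
    using N by (auto split: if_splits)
  moreover have "0 < b * N" using N(1) False by simp
  ultimately show ?thesis
    unfolding iso_difference_def using proj_iso_copies[OF N(2,4), of a] by blast
qed

lemma iso_difference_uminus:
  assumes "iso_difference x"
  shows "iso_difference (- x)"
proof -
  obtain N vs ws where N: "N > 0" "set vs \<subseteq> verts G" "set ws \<subseteq> verts G"
    "proj_iso L (map c vs) (map c ws)" "pm_scale (of_nat N) x = list_vec vs - list_vec ws"
    using assms unfolding iso_difference_def by blast
  have "pm_scale (of_nat N) (- x) = list_vec ws - list_vec vs" using N by simp
  with N proj_iso_sym[OF c_carrier[OF N(2)] N(4)] show ?thesis
    unfolding iso_difference_def by blast
qed

lemma iso_difference_scale:
  assumes "iso_difference x"
  shows "iso_difference (pm_scale a x)"
proof -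
  obtain m n where mn: "n > 0" "a = of_int m / of_int n"
    using Rat_cases[of a] by (metis Fract_of_int_quotient)
  show ?thesis
  proof (cases "m \<ge> 0")
    case True
    then have "a = of_nat (nat m) / of_nat (nat n)" using mn by simp
    then show ?thesis using iso_difference_scale_nat[OF assms] by metis
  next
    case False
    then have "pm_scale a x = pm_scale (of_nat (nat (- m)) / of_nat (nat n)) (- x)"
      using mn by (simp add: pm.scale_minus_left)
    then show ?thesis using iso_difference_scale_nat[OF iso_difference_uminus[OF assms]] by metis
  qed
qed

lemma iso_difference_add:
  assumes "iso_difference x" "iso_difference y"
  shows "iso_difference (x + y)"
proof -
  obtain N vs ws where N: "N > 0" "set vs \<subseteq> verts G" "set ws \<subseteq> verts G"
    "proj_iso L (map c vs) (map c ws)" "pm_scale (of_nat N) x = list_vec vs - list_vec ws"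
    using assms(1) unfolding iso_difference_def by blast
  obtain M us zs where M: "M > 0" "set us \<subseteq> verts G" "set zs \<subseteq> verts G"
    "proj_iso L (map c us) (map c zs)" "pm_scale (of_nat M) y = list_vec us - list_vec zs"
    using assms(2) unfolding iso_difference_def by blast
  define vs' ws' us' zs' where "vs' = concat (replicate M vs)" "ws' = concat (replicate M ws)"
    "us' = concat (replicate N us)" "zs' = concat (replicate N zs)"
  have "pm_scale (of_nat (N * M)) (x + y)
      = pm_scale (of_nat M) (pm_scale (of_nat N) x) + pm_scale (of_nat N) (pm_scale (of_nat M) y)"
    by (simp add: pm.scale_right_distrib mult.commute)
  also have "\<dots> = list_vec (vs' @ us') - list_vec (ws' @ zs')"
    unfolding vs'_ws'_us'_zs'_def list_vec_append list_vec_concat_replicate N(5) M(5)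
    by (simp add: pm.scale_right_diff_distrib)
  finally have "pm_scale (of_nat (N * M)) (x + y) = list_vec (vs' @ us') - list_vec (ws' @ zs')" .
  moreover have set: "set vs' \<subseteq> verts G" "set ws' \<subseteq> verts G" "set us' \<subseteq> verts G" "set zs' \<subseteq> verts G"
    using N M by (auto simp: vs'_ws'_us'_zs'_def split: if_splits)
  moreover have "proj_iso L (map c (vs' @ us')) (map c (ws' @ zs'))"
    unfolding map_append
    using proj_iso_copies[OF N(2,4), of M] proj_iso_copies[OF M(2,4), of N] c_carrier[OF set(1)] c_carrier[OF set(3)]
    by (intro proj_iso_append) (simp_all add: vs'_ws'_us'_zs'_def)
  ultimately show ?thesis
    unfolding iso_difference_def using N(1) M(1)
    by (intro exI[of _ "N * M"] conjI exI[of _ "vs' @ us'"] exI[of _ "ws' @ zs'"]) simp_all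
qed

lemma iso_difference_span:
  assumes "x \<in> pm.span (block_vec G ` \<Lambda>)"
  shows "iso_difference x"
proof -
  have "pm.subspace {x. iso_difference x}"
  proof (rule pm.subspaceI)
    show "0 \<in> {x. iso_difference x}"
      unfolding iso_difference_def mem_Collect_eq
      by (intro exI[of _ 1] conjI exI[of _ "[]"]) (simp_all add: proj_iso_refl)
  qed (simp_all add: iso_difference_add iso_difference_scale)
  moreover have "iso_difference (block_vec G X)" if X: "X \<in> \<Lambda>" for X
  proof -
    have XP: "X \<in> P" using X sub by blast
    have wf: "wf_digraph G" using sep by (simp add: separated_graph_def)
    obtain e where e: "e \<in> X" using separated_graph_block_nonempty[OF sep XP] .
    have src: "block_source G X \<in> verts G"
      using block_source[OF sep XP e] wf by (simp add: wf_digraph.tail_in_verts)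
    have hd: "head G e \<in> verts G" if "e \<in> X" for e
      using block_source(2)[OF sep XP that] wf by (simp add: wf_digraph.head_in_verts)
    obtain es where es: "distinct es" "set es = X"
      using finite_distinct_list[OF finite_blocks(2)[OF fin sep XP]] by blast
    have "block_vec G X = list_vec [block_source G X] - list_vec (map (head G) es)"
      using es by (simp add: block_vec_def list_vec_def sum_list_distinct_conv_sum_set o_def)
    moreover have "proj_iso L (map c [block_source G X]) (map c (map (head G) es))"
      using proj_iso_block[OF X es] by simp
    ultimately show ?thesis
      unfolding iso_difference_def using src hd es
      by (intro exI[of _ 1] conjI exI[of _ "[block_source G X]"] exI[of _ "map (head G) es"]) auto
  qed
  ultimately have "pm.span (block_vec G ` \<Lambda>) \<subseteq> {x. iso_difference x}"
    by (intro pm.span_minimal) auto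
  then show ?thesis using assms by blast
qed

text \<open>If \<open>N\<close> copies of all vertices form the difference of the isomorphic sums \<open>vs\<close> and \<open>ws\<close>, then \<open>vs\<close> is a
  permutation of \<open>N\<close> copies of all vertices followed by \<open>ws\<close>, because the coefficients of a formal sum count
  multiplicities. Completing \<open>ws\<close> to \<open>k\<close> copies of all vertices gives \<open>L\<^bsup>N+k\<^esup> \<cong> L\<^sup>k\<close>.\<close>

lemma not_IBN_of_span:
  assumes "(\<Sum>v\<in>verts G. vertex_vec v) \<in> pm.span (block_vec G ` \<Lambda>)"
  shows "\<not> IBN L"
proof -
  obtain V where V: "distinct V" "set V = verts G"
    using finite_distinct_list[OF fin_digraph.finite_verts[OF fin]] by blast
  have vecV: "(\<Sum>v\<in>verts G. vertex_vec v) = (list_vec V :: ('v + 'e set) \<Rightarrow>\<^sub>0 rat)"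
    using V by (simp add: list_vec_def sum_list_distinct_conv_sum_set)
  obtain N vs ws where N: "N > 0" "set vs \<subseteq> verts G" "set ws \<subseteq> verts G"
    "proj_iso L (map c vs) (map c ws)"
    "pm_scale (of_nat N) (list_vec V) = (list_vec vs - list_vec ws :: ('v + 'e set) \<Rightarrow>\<^sub>0 rat)"
    using iso_difference_span[OF assms] unfolding iso_difference_def vecV by blast
  \<comment> \<open>Every vertex occurs at most \<open>length ws\<close> times in \<open>ws\<close>; the successor makes \<open>k\<close> positive, as IBN requires.\<close>
  define k where "k = Suc (length ws)"
  let ?kV = "concat (replicate k V)" and ?NV = "concat (replicate N V)"
  have "list_vec (?NV @ ws) = (list_vec vs :: ('v + 'e set) \<Rightarrow>\<^sub>0 rat)"
    by (simp add: list_vec_concat_replicate N(5))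
  then have vs: "mset (?NV @ ws) = mset vs" by (rule list_vec_eq_imp_mset_eq)
  have "mset ws \<subseteq># mset ?kV"
  proof (rule mset_subset_eqI)
    fix v
    show "count (mset ws) v \<le> count (mset ?kV) v"
    proof (cases "v \<in> set ws")
      case True
      then have "count (mset V) v = 1" using V N(3) by (metis distinct_count_atmost_1 subsetD)
      then have "count (mset (concat (replicate l V))) v = l" for l by (induction l) simp_all
      then have "count (mset ?kV) v = Suc (length ws)" unfolding k_def .
      moreover have "count (mset ws) v \<le> length ws" using count_le_size[of "mset ws" v] by simp
      ultimately show ?thesis by linarith
    next
      case False
      then have "v \<notin># mset ws" by simp
      then have "count (mset ws) v = 0" by (simp only: not_in_iff)
      then show ?thesis by linarith
    qed
  qed
  then obtain zs where zs: "mset ?kV = mset (ws @ zs)"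
    by (metis ex_mset mset_append subset_mset.less_eqE)
  have zsV: "set zs \<subseteq> verts G" using mset_eq_setD[OF zs] V by (auto split: if_splits)
  have perm: "proj_iso L (map c us) (map c us')" if "mset us = mset us'" "set us \<subseteq> verts G" for us us'
    using that by (intro proj_iso_mset c_carrier) simp_all
  have NkV: "set (?NV @ ?kV) \<subseteq> verts G" using V by (auto split: if_splits)
  have "proj_iso L (map c (?NV @ ?kV)) (map c (vs @ zs))"
    using vs zs NkV by (intro perm) (simp_all add: add.assoc[symmetric])
  moreover have "proj_iso L (map c (vs @ zs)) (map c (ws @ zs))"
    unfolding map_append by (intro proj_iso_append N(4) proj_iso_refl c_carrier N(2) zsV)
  moreover have "proj_iso L (map c (ws @ zs)) (map c ?kV)"
    using zs zsV N(3) by (intro perm) simp_all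
  ultimately have main: "proj_iso L (map c (concat (replicate (N + k) V))) (map c ?kV)"
    using proj_iso_trans by (metis concat_append replicate_add)
  have one: "proj_iso L (replicate m \<one>\<^bsub>L\<^esub>) (map c (concat (replicate m V)))" for m
  proof -
    have "proj_iso L [\<one>\<^bsub>L\<^esub>] (map c V)"
      using proj_iso_one_vertices[OF V] .
    from proj_iso_concat_replicate[OF this, of m]
    have "proj_iso L (concat (replicate m [\<one>\<^bsub>L\<^esub>])) (map c (concat (replicate m V)))"
      by (simp add: map_concat)
    moreover have "concat (replicate m [\<one>\<^bsub>L\<^esub>]) = replicate m \<one>\<^bsub>L\<^esub>" by (induction m) simp_all
    ultimately show ?thesis by simp
  qed
  have "set (replicate k \<one>\<^bsub>L\<^esub>) \<subseteq> carrier L" by (auto split: if_splits)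
  then have "proj_iso L (replicate (N + k) \<one>\<^bsub>L\<^esub>) (replicate k \<one>\<^bsub>L\<^esub>)"
    using proj_iso_trans[OF proj_iso_trans[OF one main] proj_iso_sym[OF _ one]] by blast
  then have iso: "\<exists>\<phi>. free_rmodule_iso L (N + k) k \<phi>" by (rule proj_iso_replicate_one)
  show ?thesis
  proof
    assume "IBN L"
    from this[unfolded IBN_def, THEN spec, THEN spec, of "N + k" k] iso N(1) show False
      by (simp add: k_def)
  qed
qed

end

theorem theorem13:
  fixes G :: "('v, 'e) pre_digraph"
    and P \<Lambda> :: "'e set set"
  assumes "fin_digraph G"
    and "separated_graph G P"
    and "\<Lambda> \<subseteq> P"
  shows "IBN (CL_algebra G P \<Lambda> :: ('v, 'e, 'k::field) cl_ring) \<longleftrightarrow>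
    (\<Sum>v\<in>verts G. vertex_vec v) \<in> free_space (Omega G P \<Lambda>) -
      pm.span {vertex_vec (block_source G X) - (\<Sum>e\<in>X. vertex_vec (head G e)) | X. X \<in> \<Lambda>}"
proof -
  have "{vertex_vec (block_source G X) - (\<Sum>e\<in>X. vertex_vec (head G e)) | X. X \<in> \<Lambda>} = block_vec G ` \<Lambda>"
    by (auto simp: block_vec_def)
  moreover have "(\<Sum>v\<in>verts G. vertex_vec v) \<in> (free_space (Omega G P \<Lambda>) :: (('v + 'e set) \<Rightarrow>\<^sub>0 rat) set)"
    by (intro pm.subspace_sum[OF subspace_free_space] vertex_vec_in_free_space)
  moreover have "IBN (CL_algebra G P \<Lambda> :: ('v, 'e, 'k) cl_ring)"
    if "(\<Sum>v\<in>verts G. vertex_vec v) \<notin> pm.span (block_vec G ` \<Lambda>)"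
    using exists_balanced[OF assms that] IBN_of_balanced[OF assms] by blast
  moreover have "\<not> IBN (CL_algebra G P \<Lambda> :: ('v, 'e, 'k) cl_ring)"
    if "(\<Sum>v\<in>verts G. vertex_vec v) \<in> pm.span (block_vec G ` \<Lambda>)"
    using not_IBN_of_span[OF assms that] .
  ultimately show ?thesis by auto
qed

end
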